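(* Let $N>2$ and $q\in\mathbb R$. Consider matrices $\mathcal D'=\mathrm{diag}(\epsilon_1,\dots,\epsilon_N)$ with $\epsilon_j^2=1$, $\epsilon_{j'}=\epsilon_j$ for all $j$, and $\epsilon_{n+1}=1$ if $N=2n+1$, respectively $\epsilon_n=\epsilon_{n+1}=1$ if $N=2n$. For $N=2n$ let $\mathcal D$ be the permutation matrix exchanging the indices $n$ and $n+1$ and fixing the others. Then: 1. For every such $\mathcal D'$, the map $\star^{\natural}$ defined by $T\mapsto C^t\mathcal D'T\mathcal D'^{-1}C^t$ (extended antilinearly and antimultiplicatively) is a $*$-conjugation on $SO_q(N)$; for $N=2n$ the map $\star^{\sharp\natural}$ defined by $T\mapsto C^t\mathcal D\mathcal D'T(\mathcal D\mathcal D')^{-1}C^t$ is a $*$-conjugation on $SO_q(N)$ as well. 2. If $N=2n+1$, then for all nonnegative integers $l,m$ with $l+m=N$ there is a $\mathcal D'$ such that $\star^\natural$ gives the real form $SO_q(l,m)$. 3. If $N=2n$, then for all nonnegative even integers $l,m$ with $l+m=N$ there is a $\mathcal D'$ such that $\star^\natural$ gives the real form $SO_q(l,m)$; and for all positive odd integers $l,m$ with $l+m=N$ there is a $\mathcal D'$ such that $\star^{\sharp\natural}$ gives the real form $SO_q(l,m)$.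
   Context: Let $N>2$; $N=2n$ or $N=2n+1$. Indices run over $1,\dots,N$; $a':=N+1-a$; for $N=2n+1$ set $n_2=(N+1)/2=n+1$. The vector $\rho$ is $(\rho_1,\dots,\rho_N)=(\tfrac N2-1,\tfrac N2-2,\dots,\tfrac12,0,-\tfrac12,\dots,-\tfrac N2+1)$ for $N$ odd and $(\tfrac N2-1,\tfrac N2-2,\dots,1,0,0,-1,\dots,-\tfrac N2+1)$ for $N$ even. The deformation parameter $q\neq0$ is not a root of unity; for $N$ odd a square root $q^{1/2}$ is fixed, real (for $q$ real) and normalized so that $q^{1/2}\to1$ as $q\to1$. The metric is $C_{ab}=q^{-\rho_a}\delta_{ab'}$; its inverse $C^{ab}$ has the same matrix entries. The nonzero entries of the matrix $R$ (no summation) are: $R^{aa}{}_{aa}=q$ ($a\ne n_2$); $R^{aa'}{}_{aa'}=q^{-1}$ ($a\neq n_2$); $R^{n_2n_2}{}_{n_2n_2}=1$ ($N$ odd); $R^{ab}{}_{ab}=1$ ($a\ne b$, $a'\neq b$); $R^{ab}{}_{ba}=q-q^{-1}$ ($a>b$, $a'\ne b$); $R^{aa'}{}_{a'a}=(q-q^{-1})(1-q^{\rho_a-\rho_{a'}})$ ($a>a'$); $R^{aa'}{}_{bb'}=-(q-q^{-1})q^{\rho_a-\rho_b}$ ($a>b$, $a'\neq b$). The relation $R_{12}T_1T_2=T_2T_1R_{12}$ means $R^{ab}{}_{ef}T^e{}_cT^f{}_d=T^b{}_fT^a{}_eR^{ef}{}_{cd}$. $SO_q(N)$ is the unital complex algebra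 generated by $T^a{}_b$ subject to $R_{12}T_1T_2=T_2T_1R_{12}$, $TCT^t=C\,I$, $T^tCT=C\,I$ and $\det_qT=1$, with Hopf structure $\Delta(T^a{}_b)=T^a{}_c\otimes T^c{}_b$, $\varepsilon(T^a{}_b)=\delta^a_b$, antipode $\kappa(T)=CT^tC$. Here $\hat R^{ab}{}_{cd}=R^{ba}{}_{cd}$, $P_0{}^{ab}{}_{cd}=(C_{ef}C^{ef})^{-1}C^{ab}C_{cd}$, $P_A=\frac1{q+q^{-1}}[-\hat R+q\,\mathbf 1-(q-q^{1-N})P_0]$, and $\det_qT$ is the group-like element through which $T$ coacts on the one-dimensional degree $N$ part of the quantum exterior algebra (generators $\xi^a$, relations $(\mathbf 1-P_A)^{ab}{}_{cd}\xi^c\xi^d=0$, coaction $\xi^a\mapsto T^a{}_b\otimes\xi^b$). A $*$-conjugation ($*$-structure) on a Hopf algebra is an antilinear, antimultiplicative map with $*^2=\mathrm{id}$, $\Delta\circ *=( *\otimes * )\circ\Delta$ and $\varepsilon(a^* )=\overline{\varepsilon(a)}$. Real form / classical limit: for a $*$-conjugation of the form $T^*=U_qTU_q^{-1}$ with $U_q$ a numerical matrix with limit $U_1$ as $q\to1$, the classical limit group is $\{g\in SL_N(\mathbb C): g^tC_{q=1}g=C_{q=1},\ \overline g=U_1gU_1^{-1}\}$. $SO(l,m)$ denotes the group of real matrices of determinant $1$ preserving a nondegenerate symmetric form of signature $(l,m)$ (so $SO(l,m)\cong SO(m,l)$). Saying that a conjugation gives the real form $SO_q(l,m)$ means that this classical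 limit group is isomorphic to $SO(l,m)$ by a complex linear change of basis. *)

theory Defs
  imports
    "HOL-Algebra.QuotRing"
    "HOL-Library.Poly_Mapping"
    "HOL-Library.Product_Plus"
    "Jordan_Normal_Form.Determinant"
begin

section \<open>Free algebras and their tensor products\<close>

text \<open>Words under concatenation, written additively, so that the convolution product of
  \<^theory>\<open>HOL-Library.Poly_Mapping\<close> makes \<open>'x fword \<Rightarrow>\<^sub>0 complex\<close> the free unital complex
  algebra on the letters \<open>'x\<close>. The monoid algebra of the product monoid
  \<open>'x fword \<times> 'y fword\<close> is the tensor product of two free algebras.\<close>

datatype 'x fword = FWord (letters: "'x list")

instantiation fword :: (type) monoid_add
begin

definition zero_fword :: "'a fword" where
  "0 = FWord []"

definition plus_fword :: "'a fword \<Rightarrow> 'a fword \<Rightarrow> 'a fword" where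
  "u + v = FWord (letters u @ letters v)"

instance
  by standard (simp_all add: zero_fword_def plus_fword_def)

end

type_synonym 'x falg = "'x fword \<Rightarrow>\<^sub>0 complex"
type_synonym ('x, 'y) ftens = "('x fword \<times> 'y fword) \<Rightarrow>\<^sub>0 complex"

definition scalar :: "complex \<Rightarrow> ('m::monoid_add \<Rightarrow>\<^sub>0 complex)" where
  "scalar c = Poly_Mapping.single 0 c"

definition gen :: "'x \<Rightarrow> 'x falg" where
  "gen x = Poly_Mapping.single (FWord [x]) 1"

definition words :: "'x set \<Rightarrow> 'x fword set" where
  "words X = {w. set (letters w) \<subseteq> X}"

text \<open>The monoid algebra of a submonoid \<open>S\<close>, as a ring in the sense of HOL-Algebra.\<close>

definition monoid_algebra :: "'m::monoid_add set \<Rightarrow> ('m \<Rightarrow>\<^sub>0 complex) ring" where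
  "monoid_algebra S =
    \<lparr>carrier = {p. Poly_Mapping.keys p \<subseteq> S}, monoid.mult = (*), one = 1, zero = 0, add = (+)\<rparr>"

definition free_algebra :: "'x set \<Rightarrow> 'x falg ring" where
  "free_algebra X = monoid_algebra (words X)"

definition free_tensor :: "'x set \<Rightarrow> 'y set \<Rightarrow> ('x, 'y) ftens ring" where
  "free_tensor X Y = monoid_algebra (words X \<times> words Y)"

definition tensor :: "'x falg \<Rightarrow> 'y falg \<Rightarrow> ('x, 'y) ftens" (infixl \<open>\<otimes>\<^sub>f\<close> 75) where
  "p \<otimes>\<^sub>f r = (\<Sum>u\<in>Poly_Mapping.keys p. \<Sum>v\<in>Poly_Mapping.keys r.
      Poly_Mapping.single (u, v) (Poly_Mapping.lookup p u * Poly_Mapping.lookup r v))"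

text \<open>For ideals \<open>I\<close> and \<open>J\<close> of free algebras \<open>F\<close> and \<open>G\<close>, this is the ideal
  \<open>I \<otimes> G + F \<otimes> J\<close>; thus \<open>(F \<otimes> G) Quot tensor_ideal X I Y J\<close> is the tensor product of the
  quotient algebras.\<close>

definition tensor_ideal ::
    "'x set \<Rightarrow> 'x falg set \<Rightarrow> 'y set \<Rightarrow> 'y falg set \<Rightarrow> ('x, 'y) ftens set" where
  "tensor_ideal X I Y J =
    Idl\<^bsub>free_tensor X Y\<^esub> ({p \<otimes>\<^sub>f 1 | p. p \<in> I} \<union> {1 \<otimes>\<^sub>f r | r. r \<in> J})"

text \<open>Extension of values on generators to an algebra homomorphism (\<open>s\<close> is the scalar
  embedding of the target), and to an antilinear antimultiplicative map.\<close>

definition hom_extend :: "(complex \<Rightarrow> 'r) \<Rightarrow> ('x \<Rightarrow> 'r) \<Rightarrow> 'x falg \<Rightarrow> 'r::semiring_1" where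
  "hom_extend s f p = (\<Sum>w\<in>Poly_Mapping.keys p.
      s (Poly_Mapping.lookup p w) * prod_list (map f (letters w)))"

definition anti_extend :: "('x \<Rightarrow> 'x falg) \<Rightarrow> 'x falg \<Rightarrow> 'x falg" where
  "anti_extend f p = (\<Sum>w\<in>Poly_Mapping.keys p.
      scalar (cnj (Poly_Mapping.lookup p w)) * prod_list (rev (map f (letters w))))"


section \<open>Numerical data\<close>

text \<open>Indices run over \<open>0, \<dots>, N - 1\<close>, so the index \<open>a\<close> of the usual numbering is \<open>a - 1\<close>
  here, and the middle index for \<open>N = 2n + 1\<close> is \<open>n\<close>.\<close>

definition flip_index :: "nat \<Rightarrow> nat \<Rightarrow> nat" where
  "flip_index N a = N - 1 - a"

definition two_rho :: "nat \<Rightarrow> nat \<Rightarrow> int" where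
  "two_rho N a =
    (if 2 * a + 1 < N then int N - 2 - 2 * int a
     else if 2 * a + 1 = N then 0
     else int N - 2 * int a)"

text \<open>\<open>q_half N q k\<close> is \<open>q\<close> to the power \<open>k/2\<close>. Half-integral exponents occur only for odd
  \<open>N\<close>, where \<open>q > 0\<close> and the positive square root is used; for even \<open>N\<close> the exponent \<open>k\<close> is
  always even and \<open>q\<close> may be negative.\<close>

definition q_half :: "nat \<Rightarrow> real \<Rightarrow> int \<Rightarrow> real" where
  "q_half N q k = (if even N then q powi (k div 2) else sqrt q powi k)"

definition admissible_q :: "nat \<Rightarrow> real \<Rightarrow> bool" where
  "admissible_q N q \<longleftrightarrow> q \<noteq> 0 \<and> (\<forall>k::nat. k > 0 \<longrightarrow> q ^ k \<noteq> 1) \<and> (odd N \<longrightarrow> q > 0)"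

definition metric :: "nat \<Rightarrow> real \<Rightarrow> complex mat" where
  "metric N q = mat N N (\<lambda>(a, b).
      if b = flip_index N a then of_real (q_half N q (- two_rho N a)) else 0)"

text \<open>\<open>R_entry N q a b c d\<close> is the entry of \<open>R\<close> with upper indices \<open>a b\<close> and lower indices
  \<open>c d\<close>.\<close>

definition R_entry :: "nat \<Rightarrow> real \<Rightarrow> nat \<Rightarrow> nat \<Rightarrow> nat \<Rightarrow> nat \<Rightarrow> real" where
  "R_entry N q a b c d =
    (if c = a \<and> d = b then
       (if a = b then (if a = flip_index N a then 1 else q)
        else if b = flip_index N a then inverse q
        else 1)
     else if c = b \<and> d = a then
       (if a > b then
          (if b = flip_index N a
           then (q - inverse q) * (1 - q_half N q (two_rho N a - two_rho N b))
           else q - inverse q)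
        else 0)
     else if b = flip_index N a \<and> d = flip_index N c \<and> a > c then
       - (q - inverse q) * q_half N q (two_rho N a - two_rho N c)
     else 0)"

definition R_hat :: "nat \<Rightarrow> real \<Rightarrow> nat \<Rightarrow> nat \<Rightarrow> nat \<Rightarrow> nat \<Rightarrow> complex" where
  "R_hat N q a b c d = of_real (R_entry N q b a c d)"

definition id_entry :: "nat \<Rightarrow> nat \<Rightarrow> nat \<Rightarrow> nat \<Rightarrow> complex" where
  "id_entry a b c d = (if a = c \<and> b = d then 1 else 0)"

text \<open>The inverse metric has the same entries as the metric.\<close>

definition P_zero :: "nat \<Rightarrow> real \<Rightarrow> nat \<Rightarrow> nat \<Rightarrow> nat \<Rightarrow> nat \<Rightarrow> complex" where
  "P_zero N q a b c d =
    inverse (\<Sum>e<N. \<Sum>f<N. metric N q $$ (e, f) * metric N q $$ (e, f))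
      * metric N q $$ (a, b) * metric N q $$ (c, d)"

definition P_anti :: "nat \<Rightarrow> real \<Rightarrow> nat \<Rightarrow> nat \<Rightarrow> nat \<Rightarrow> nat \<Rightarrow> complex" where
  "P_anti N q a b c d =
    (1 / of_real (q + inverse q)) *
      (- R_hat N q a b c d + of_real q * id_entry a b c d
       - of_real (q - q powi (1 - int N)) * P_zero N q a b c d)"


section \<open>The quantum group \<open>SO\<^sub>q(N)\<close>\<close>

definition T_index :: "nat \<Rightarrow> (nat \<times> nat) set" where
  "T_index N = {..<N} \<times> {..<N}"

abbreviation FT :: "nat \<Rightarrow> (nat \<times> nat) falg ring" where
  "FT N \<equiv> free_algebra (T_index N)"

abbreviation FT2 :: "nat \<Rightarrow> (nat \<times> nat, nat \<times> nat) ftens ring" where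
  "FT2 N \<equiv> free_tensor (T_index N) (T_index N)"

definition T_mat :: "nat \<Rightarrow> (nat \<times> nat) falg mat" where
  "T_mat N = mat N N gen"

abbreviation num_mat :: "complex mat \<Rightarrow> (nat \<times> nat) falg mat" where
  "num_mat A \<equiv> map_mat scalar A"

definition RTT_relations :: "nat \<Rightarrow> real \<Rightarrow> (nat \<times> nat) falg set" where
  "RTT_relations N q =
    {(\<Sum>e<N. \<Sum>f<N. scalar (of_real (R_entry N q a b e f)) * gen (e, c) * gen (f, d))
     - (\<Sum>e<N. \<Sum>f<N. gen (b, f) * gen (a, e) * scalar (of_real (R_entry N q e f c d)))
     | a b c d. a < N \<and> b < N \<and> c < N \<and> d < N}"

definition metric_relations :: "nat \<Rightarrow> real \<Rightarrow> (nat \<times> nat) falg set" where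
  "metric_relations N q =
    (let T = T_mat N; Tt = transpose_mat (T_mat N); C = num_mat (metric N q) in
      {(T * C * Tt - C) $$ (a, b) | a b. a < N \<and> b < N} \<union>
      {(Tt * C * T - C) $$ (a, b) | a b. a < N \<and> b < N})"

text \<open>The defining ideal before the determinant condition is imposed.\<close>

definition O_ideal :: "nat \<Rightarrow> real \<Rightarrow> (nat \<times> nat) falg set" where
  "O_ideal N q = Idl\<^bsub>FT N\<^esub> (RTT_relations N q \<union> metric_relations N q)"

definition comult_free :: "nat \<Rightarrow> (nat \<times> nat) falg \<Rightarrow> (nat \<times> nat, nat \<times> nat) ftens" where
  "comult_free N = hom_extend scalar (\<lambda>(a, b). \<Sum>c<N. gen (a, c) \<otimes>\<^sub>f gen (c, b))"

definition counit_free :: "(nat \<times> nat) falg \<Rightarrow> complex" where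
  "counit_free = hom_extend (\<lambda>c. c) (\<lambda>(a, b). if a = b then 1 else 0)"

text \<open>The quantum exterior algebra is the quotient of the free algebra on
  \<open>\<xi>\<^sup>0, \<dots>, \<xi>\<^sup>N\<^sup>-\<^sup>1\<close> by the following ideal.\<close>

definition ext_ideal :: "nat \<Rightarrow> real \<Rightarrow> nat falg set" where
  "ext_ideal N q = Idl\<^bsub>free_algebra {..<N}\<^esub>
    {\<Sum>c<N. \<Sum>d<N. scalar (id_entry a b c d - P_anti N q a b c d) * gen c * gen d
     | a b. a < N \<and> b < N}"

definition coaction_free :: "nat \<Rightarrow> nat falg \<Rightarrow> (nat \<times> nat, nat) ftens" where
  "coaction_free N = hom_extend scalar (\<lambda>a. \<Sum>b<N. gen (a, b) \<otimes>\<^sub>f gen b)"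

text \<open>\<open>d\<close> represents the quantum determinant: modulo the relations it is group-like, and the
  coaction on every element of degree \<open>N\<close> of the exterior algebra is \<open>\<omega> \<mapsto> d \<otimes> \<omega>\<close>. As the
  degree \<open>N\<close> part is one-dimensional, this fixes the class of \<open>d\<close> modulo \<^term>\<open>O_ideal N q\<close>.\<close>

definition represents_qdet :: "nat \<Rightarrow> real \<Rightarrow> (nat \<times> nat) falg \<Rightarrow> bool" where
  "represents_qdet N q d \<longleftrightarrow>
    d \<in> carrier (FT N) \<and>
    comult_free N d - d \<otimes>\<^sub>f d
      \<in> tensor_ideal (T_index N) (O_ideal N q) (T_index N) (O_ideal N q) \<and>
    counit_free d = 1 \<and>
    (\<forall>\<omega> \<in> carrier (free_algebra {..<N}).
      (\<forall>w \<in> Poly_Mapping.keys \<omega>. length (letters w) = N) \<longrightarrow>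
      coaction_free N \<omega> - d \<otimes>\<^sub>f \<omega>
        \<in> tensor_ideal (T_index N) (O_ideal N q) {..<N} (ext_ideal N q))"

definition SO_ideal :: "nat \<Rightarrow> real \<Rightarrow> (nat \<times> nat) falg set" where
  "SO_ideal N q = Idl\<^bsub>FT N\<^esub>
    (RTT_relations N q \<union> metric_relations N q \<union> {d - 1 | d. represents_qdet N q d})"

definition SO_ideal2 :: "nat \<Rightarrow> real \<Rightarrow> (nat \<times> nat, nat \<times> nat) ftens set" where
  "SO_ideal2 N q = tensor_ideal (T_index N) (SO_ideal N q) (T_index N) (SO_ideal N q)"

type_synonym qelem = "(nat \<times> nat) falg set"
type_synonym qelem2 = "(nat \<times> nat, nat \<times> nat) ftens set"

definition SOq :: "nat \<Rightarrow> real \<Rightarrow> qelem ring" where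
  "SOq N q = FT N Quot SO_ideal N q"

definition SOq2 :: "nat \<Rightarrow> real \<Rightarrow> qelem2 ring" where
  "SOq2 N q = FT2 N Quot SO_ideal2 N q"

definition qclass :: "nat \<Rightarrow> real \<Rightarrow> (nat \<times> nat) falg \<Rightarrow> qelem" where
  "qclass N q p = SO_ideal N q +>\<^bsub>FT N\<^esub> p"

definition qclass2 :: "nat \<Rightarrow> real \<Rightarrow> (nat \<times> nat, nat \<times> nat) ftens \<Rightarrow> qelem2" where
  "qclass2 N q p = SO_ideal2 N q +>\<^bsub>FT2 N\<^esub> p"

definition scale :: "nat \<Rightarrow> real \<Rightarrow> complex \<Rightarrow> qelem \<Rightarrow> qelem" where
  "scale N q c x = qclass N q (scalar c) \<otimes>\<^bsub>SOq N q\<^esub> x"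

definition scale2 :: "nat \<Rightarrow> real \<Rightarrow> complex \<Rightarrow> qelem2 \<Rightarrow> qelem2" where
  "scale2 N q c x = qclass2 N q (scalar c) \<otimes>\<^bsub>SOq2 N q\<^esub> x"

text \<open>Maps on cosets are induced from maps of representatives; when the class of the value does
  not depend on the representative, the unions below are single cosets.\<close>

definition pure_tensor :: "nat \<Rightarrow> real \<Rightarrow> qelem \<Rightarrow> qelem \<Rightarrow> qelem2" where
  "pure_tensor N q x y = (\<Union>p\<in>x. \<Union>r\<in>y. qclass2 N q (p \<otimes>\<^sub>f r))"

definition comult :: "nat \<Rightarrow> real \<Rightarrow> qelem \<Rightarrow> qelem2" where
  "comult N q x = (\<Union>p\<in>x. qclass2 N q (comult_free N p))"

definition counit :: "qelem \<Rightarrow> complex" where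
  "counit x = the_elem (counit_free ` x)"


section \<open>Conjugations\<close>

text \<open>\<open>S\<close> is the antilinear map \<open>st \<otimes> st\<close> on the tensor square, which is determined by its
  values on pure tensors.\<close>

definition is_tensor_square ::
    "nat \<Rightarrow> real \<Rightarrow> (qelem \<Rightarrow> qelem) \<Rightarrow> (qelem2 \<Rightarrow> qelem2) \<Rightarrow> bool" where
  "is_tensor_square N q st S \<longleftrightarrow>
    S \<in> carrier (SOq2 N q) \<rightarrow> carrier (SOq2 N q) \<and>
    (\<forall>x \<in> carrier (SOq2 N q). \<forall>y \<in> carrier (SOq2 N q).
      S (x \<oplus>\<^bsub>SOq2 N q\<^esub> y) = S x \<oplus>\<^bsub>SOq2 N q\<^esub> S y) \<and>
    (\<forall>c. \<forall>x \<in> carrier (SOq2 N q). S (scale2 N q c x) = scale2 N q (cnj c) (S x)) \<and>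
    (\<forall>x \<in> carrier (SOq N q). \<forall>y \<in> carrier (SOq N q).
      S (pure_tensor N q x y) = pure_tensor N q (st x) (st y))"

definition is_star_conjugation :: "nat \<Rightarrow> real \<Rightarrow> (qelem \<Rightarrow> qelem) \<Rightarrow> bool" where
  "is_star_conjugation N q st \<longleftrightarrow>
    st \<in> carrier (SOq N q) \<rightarrow> carrier (SOq N q) \<and>
    (\<forall>x \<in> carrier (SOq N q). \<forall>y \<in> carrier (SOq N q).
      st (x \<oplus>\<^bsub>SOq N q\<^esub> y) = st x \<oplus>\<^bsub>SOq N q\<^esub> st y) \<and>
    (\<forall>c. \<forall>x \<in> carrier (SOq N q). st (scale N q c x) = scale N q (cnj c) (st x)) \<and>
    (\<forall>x \<in> carrier (SOq N q). \<forall>y \<in> carrier (SOq N q).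
      st (x \<otimes>\<^bsub>SOq N q\<^esub> y) = st y \<otimes>\<^bsub>SOq N q\<^esub> st x) \<and>
    (\<forall>x \<in> carrier (SOq N q). st (st x) = x) \<and>
    (\<exists>S. is_tensor_square N q st S \<and>
      (\<forall>x \<in> carrier (SOq N q). comult N q (st x) = S (comult N q x))) \<and>
    (\<forall>x \<in> carrier (SOq N q). counit (st x) = cnj (counit x))"

definition mat_inv :: "complex mat \<Rightarrow> complex mat" where
  "mat_inv A = (THE B. B \<in> carrier_mat (dim_row A) (dim_row A)
      \<and> inverts_mat A B \<and> inverts_mat B A)"

definition sign_matrices :: "nat \<Rightarrow> complex mat set" where
  "sign_matrices N = {mat_diag N \<epsilon> | \<epsilon>.
      (\<forall>j<N. (\<epsilon> j)\<^sup>2 = 1 \<and> \<epsilon> (flip_index N j) = \<epsilon> j) \<and>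
      (if odd N then \<epsilon> (N div 2) = 1 else \<epsilon> (N div 2 - 1) = 1 \<and> \<epsilon> (N div 2) = 1)}"

definition swap_matrix :: "nat \<Rightarrow> complex mat" where
  "swap_matrix N = mat N N (\<lambda>(i, j).
      if i = Transposition.transpose (N div 2 - 1) (N div 2) j then 1 else 0)"

text \<open>The antilinear antimultiplicative map with \<open>T \<mapsto> C\<^sup>t W T W\<^sup>-\<^sup>1 C\<^sup>t\<close>.\<close>

definition twisted_star :: "nat \<Rightarrow> real \<Rightarrow> complex mat \<Rightarrow> qelem \<Rightarrow> qelem" where
  "twisted_star N q W x =
    (let Ct = num_mat (transpose_mat (metric N q));
         M = Ct * num_mat W * T_mat N * num_mat (mat_inv W) * Ct
     in \<Union>p\<in>x. qclass N q (anti_extend (\<lambda>i. M $$ i) p))"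

definition star_natural :: "nat \<Rightarrow> complex mat \<Rightarrow> real \<Rightarrow> qelem \<Rightarrow> qelem" where
  "star_natural N D' q = twisted_star N q D'"

definition star_sharp_natural :: "nat \<Rightarrow> complex mat \<Rightarrow> real \<Rightarrow> qelem \<Rightarrow> qelem" where
  "star_sharp_natural N D' q = twisted_star N q (swap_matrix N * D')"


section \<open>Real forms\<close>

definition classical_limit_group :: "nat \<Rightarrow> complex mat \<Rightarrow> complex mat set" where
  "classical_limit_group N U1 = {g \<in> carrier_mat N N.
      det g = 1 \<and>
      transpose_mat g * metric N 1 * g = metric N 1 \<and>
      map_mat cnj g = U1 * g * mat_inv U1}"

definition SO_group :: "nat \<Rightarrow> nat \<Rightarrow> real mat set" where
  "SO_group l m =
    (let \<eta> = mat_diag (l + m) (\<lambda>i. if i < l then 1 else - 1) in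
      {g \<in> carrier_mat (l + m) (l + m). det g = 1 \<and> transpose_mat g * \<eta> * g = \<eta>})"

text \<open>\<open>st\<close> is a family of conjugations indexed by \<open>q\<close>, of the form \<open>T \<mapsto> U\<^sub>q T U\<^sub>q\<^sup>-\<^sup>1\<close> with
  \<open>U\<^sub>q \<rightarrow> U\<^sub>1\<close> entrywise as \<open>q \<rightarrow> 1\<close>, whose classical limit group is carried onto \<open>SO(l, m)\<close> by
  a complex linear change of basis \<open>P\<close>.\<close>

definition gives_real_form ::
    "nat \<Rightarrow> (real \<Rightarrow> qelem \<Rightarrow> qelem) \<Rightarrow> nat \<Rightarrow> nat \<Rightarrow> bool" where
  "gives_real_form N st l m \<longleftrightarrow>
    (\<forall>q. admissible_q N q \<longrightarrow> is_star_conjugation N q (st q)) \<and>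
    (\<exists>U U1.
      (\<forall>q. admissible_q N q \<longrightarrow>
        U q \<in> carrier_mat N N \<and> invertible_mat (U q) \<and>
        (\<forall>a<N. \<forall>b<N. st q (qclass N q (gen (a, b))) =
          qclass N q ((num_mat (U q) * T_mat N * num_mat (mat_inv (U q))) $$ (a, b)))) \<and>
      U1 \<in> carrier_mat N N \<and> invertible_mat U1 \<and>
      (\<forall>a<N. \<forall>b<N. ((\<lambda>q. U q $$ (a, b)) \<longlongrightarrow> U1 $$ (a, b)) (at 1)) \<and>
      (\<exists>P \<in> carrier_mat N N. invertible_mat P \<and>
        (\<lambda>g. P * g * mat_inv P) ` classical_limit_group N U1
          = map_mat complex_of_real ` SO_group l m))"

end

theory Submission
  imports Defs
begin

text \<open>In every case \<open>W\<close> is a monomial matrix, and so is \<open>U = C\<^sup>t W\<close>: the conjugation is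
  \<open>T\<^sup>a\<^sub>b \<mapsto> (u\<^sub>a / u\<^sub>b) T\<^sup>\<tau>\<^sup>a\<^sub>\<tau>\<^sub>b\<close> for an index involution \<open>\<tau>\<close> and real weights with
  \<open>u\<^sub>a u\<^sub>\<tau>\<^sub>a = 1\<close>. Since \<open>R\<close> and \<open>C\<close> are invariant under \<open>\<tau>\<close> combined with the exchange of
  the two tensor factors, it maps each defining relation to a scalar multiple of another one.
  Together with \<open>\<xi>\<^sup>a \<mapsto> u\<^sub>a \<xi>\<^sup>\<tau>\<^sup>a\<close> it commutes with the coaction already on the free algebras, so it
  preserves the set of representatives of the quantum determinant, and no explicit formula for the
  determinant is needed.

  In the classical limit the fixed space of \<open>v \<mapsto> U\<^sub>1 (cnj v)\<close> is a real form of the complex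
  space on which the metric is \<open>v \<mapsto> cnj v\<^sup>t W v\<close>, so its signature is that of \<open>W\<close>. Taking
  the sign \<open>1\<close> on a central block of indices and \<open>-1\<close> outside realizes every required
  signature up to order.\<close>

section \<open>Monoid algebras\<close>

text \<open>The exchange of the two tensor factors is forced twice over: the map reverses products,
  and the mirror a -> a' reverses the index order on which the entries of R depend, so mirror and
  exchange together fix R. The weights are u_a = q^(rho_a) e_a. Mirror indices thus satisfy u_a u_a'
  = 1, and a nonzero entry of R either keeps its two indices up to order or replaces one mirror pair
  by another; hence all terms of a relation carry the same weight. The obstacle in even dimension is
  the swap of the two middle indices, which reverses their order. It is harmless because rho
  vanishes at both: the only entry of R that depends on their mutual order contains the factor 1 -
  q^0. Parity explains the split into cases. A mirror pair not moved by the swap contributes two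
  equal signs to the signature, the swapped pair one sign of each kind, and the middle index in odd
  dimension a plus sign. A form and its negative have the same group, so l and m may be
  interchanged.\<close>

lemma poly_mapping_single_induct [consumes 1, case_names zero single add]:
  fixes p :: "'m \<Rightarrow>\<^sub>0 complex"
  assumes "Poly_Mapping.keys p \<subseteq> S"
    and zero: "P 0"
    and single: "\<And>w c. w \<in> S \<Longrightarrow> P (Poly_Mapping.single w c)"
    and add: "\<And>p r. P p \<Longrightarrow> P r \<Longrightarrow> P (p + r)"
  shows "P p"
proof -
  have *: "p = (\<Sum>w\<in>Poly_Mapping.keys p. Poly_Mapping.single w (Poly_Mapping.lookup p w))"
    by (rule poly_mapping_eqI)
      (auto simp: lookup_sum lookup_single when_def in_keys_iff sum.delta)
  have "P (\<Sum>w\<in>K. Poly_Mapping.single w (Poly_Mapping.lookup p w))"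
    if "finite K" "K \<subseteq> S" for K
    using that by (induction K rule: finite_induct) (auto intro: zero single add)
  then show ?thesis
    using assms(1) * by (metis finite_keys)
qed

lemma scalar_zero [simp]: "scalar 0 = 0"
  and scalar_one [simp]: "scalar 1 = 1"
  and scalar_add: "scalar (c + d) = scalar c + scalar d"
  and scalar_mult: "scalar (c * d) = scalar c * scalar d"
  and scalar_uminus: "scalar (- c) = - scalar c"
  by (simp_all add: scalar_def single_add mult_single single_uminus)

lemma scalar_central: "scalar c * p = p * scalar c"
  by (rule poly_mapping_single_induct[of p UNIV])
    (auto simp: scalar_def mult_single distrib_left distrib_right mult.commute)

lemma scalar_left_commute: "p * (scalar c * r) = scalar c * (p * r)"
  by (metis mult.assoc scalar_central)

lemma keys_scalar: "Poly_Mapping.keys (scalar c) \<subseteq> {0}"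
  by (simp add: scalar_def)

text \<open>Common form of \<open>hom_extend\<close>, \<open>anti_extend\<close> and
  \<open>anti_tensor\<close>. The choice of \<open>s\<close> makes the extension linear or
  antilinear; the map \<open>\<phi>\<close> on the monoid decides whether products are preserved or
  reversed.\<close>

definition lin_ext :: "(complex \<Rightarrow> 'r) \<Rightarrow> ('m \<Rightarrow> 'r) \<Rightarrow> ('m \<Rightarrow>\<^sub>0 complex) \<Rightarrow> 'r::semiring_1" where
  "lin_ext s \<phi> p = (\<Sum>w\<in>Poly_Mapping.keys p. s (Poly_Mapping.lookup p w) * \<phi> w)"

text \<open>Only a ring homomorphism into the centre is asked for, so that
  \<open>\<lambda>c. scalar (cnj c)\<close> qualifies next to \<open>scalar\<close> and the identity
  of the complex numbers.\<close>

locale central_embedding =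
  fixes s :: "complex \<Rightarrow> 'r::ring_1"
  assumes s_add: "s (c + d) = s c + s d"
    and s_mult: "s (c * d) = s c * s d"
    and s_one: "s 1 = 1"
    and s_central: "s c * x = x * s c"
begin

lemma s_zero: "s 0 = 0"
  using s_add[of 0 0] by simp

lemma lin_ext_superset:
  assumes "finite A" "Poly_Mapping.keys p \<subseteq> A"
  shows "lin_ext s \<phi> p = (\<Sum>w\<in>A. s (Poly_Mapping.lookup p w) * \<phi> w)"
  unfolding lin_ext_def using assms
  by (intro sum.mono_neutral_left) (auto simp: s_zero in_keys_iff)

lemma lin_ext_zero: "lin_ext s \<phi> 0 = 0"
  by (simp add: lin_ext_def)

lemma lin_ext_single: "lin_ext s \<phi> (Poly_Mapping.single w c) = s c * \<phi> w"
  by (simp add: lin_ext_def s_zero)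

lemma lin_ext_add: "lin_ext s \<phi> (p + r) = lin_ext s \<phi> p + lin_ext s \<phi> r"
proof -
  let ?A = "Poly_Mapping.keys p \<union> Poly_Mapping.keys r"
  have "Poly_Mapping.keys (p + r) \<subseteq> ?A" by (rule Poly_Mapping.keys_add)
  then show ?thesis
    by (simp add: lin_ext_superset[of ?A] lookup_add s_add distrib_right sum.distrib)
qed

lemma lin_ext_uminus: "lin_ext s \<phi> (- p) = - lin_ext s \<phi> p"
  using lin_ext_add[of \<phi> "- p" p] unfolding eq_neg_iff_add_eq_0 by (simp add: lin_ext_zero)

lemma lin_ext_diff: "lin_ext s \<phi> (p - r) = lin_ext s \<phi> p - lin_ext s \<phi> r"
  using lin_ext_add[of \<phi> p "- r"] by (simp add: lin_ext_uminus)

lemma lin_ext_sum: "lin_ext s \<phi> (sum f A) = (\<Sum>x\<in>A. lin_ext s \<phi> (f x))"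
  by (induction A rule: infinite_finite_induct) (auto simp: lin_ext_zero lin_ext_add)

lemma lin_ext_scalar: "\<phi> 0 = 1 \<Longrightarrow> lin_ext s \<phi> (scalar c) = s c"
  by (simp add: scalar_def lin_ext_single)

lemma lin_ext_mult:
  assumes "\<And>u v. \<phi> (u + v) = \<phi> u * \<phi> v"
  shows "lin_ext s \<phi> (p * r) = lin_ext s \<phi> p * lin_ext s \<phi> r"
proof -
  have *: "lin_ext s \<phi> (Poly_Mapping.single w c * r) = s c * \<phi> w * lin_ext s \<phi> r" for w c
  proof (rule poly_mapping_single_induct[of r UNIV])
    fix v d
    have "s c * s d * (\<phi> w * \<phi> v) = s c * (s d * \<phi> w) * \<phi> v"
      by (simp only: mult.assoc)
    also have "\<dots> = s c * \<phi> w * (s d * \<phi> v)"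
      by (simp only: s_central[of d "\<phi> w"] mult.assoc)
    finally show "lin_ext s \<phi> (Poly_Mapping.single w c * Poly_Mapping.single v d) =
      s c * \<phi> w * lin_ext s \<phi> (Poly_Mapping.single v d)"
      by (simp add: mult_single lin_ext_single assms s_mult)
  qed (simp_all add: distrib_left lin_ext_add lin_ext_zero)
  show ?thesis
    by (rule poly_mapping_single_induct[of p UNIV])
      (simp_all add: distrib_right lin_ext_add lin_ext_zero lin_ext_single *)
qed

lemma lin_ext_antimult:
  assumes "\<And>u v. \<phi> (u + v) = \<phi> v * \<phi> u"
  shows "lin_ext s \<phi> (p * r) = lin_ext s \<phi> r * lin_ext s \<phi> p"
proof -
  have *: "lin_ext s \<phi> (Poly_Mapping.single w c * r) = lin_ext s \<phi> r * (s c * \<phi> w)" for w c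
  proof (rule poly_mapping_single_induct[of r UNIV])
    fix v d
    have "s c * s d * (\<phi> v * \<phi> w) = s d * (s c * \<phi> v) * \<phi> w"
      by (simp only: s_central[of c "s d"] mult.assoc)
    also have "\<dots> = s d * \<phi> v * (s c * \<phi> w)"
      by (simp only: s_central[of c "\<phi> v"] mult.assoc)
    finally show "lin_ext s \<phi> (Poly_Mapping.single w c * Poly_Mapping.single v d) =
      lin_ext s \<phi> (Poly_Mapping.single v d) * (s c * \<phi> w)"
      by (simp add: mult_single lin_ext_single assms s_mult)
  qed (simp_all add: distrib_left distrib_right lin_ext_add lin_ext_zero)
  show ?thesis
    by (rule poly_mapping_single_induct[of p UNIV])
      (simp_all add: distrib_left distrib_right lin_ext_add lin_ext_zero lin_ext_single *)
qed

end

lemma central_embedding_scalar: "central_embedding scalar"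
  by standard (simp_all add: scalar_add scalar_mult, rule scalar_central)

lemma central_embedding_scalar_cnj: "central_embedding (\<lambda>c. scalar (cnj c))"
  by standard (simp_all add: scalar_add scalar_mult, rule scalar_central)

lemma central_embedding_id: "central_embedding (\<lambda>c. c)"
  by standard simp_all

lemma hom_extend_eq_lin_ext: "hom_extend s f = lin_ext s (\<lambda>w. prod_list (map f (letters w)))"
  by (simp add: hom_extend_def lin_ext_def fun_eq_iff)

lemma anti_extend_eq_lin_ext:
  "anti_extend f = lin_ext (\<lambda>c. scalar (cnj c)) (\<lambda>w. prod_list (rev (map f (letters w))))"
  by (simp add: anti_extend_def lin_ext_def fun_eq_iff)

context central_embedding
begin

lemma hom_extend_add: "hom_extend s f (p + r) = hom_extend s f p + hom_extend s f r"
  and hom_extend_diff: "hom_extend s f (p - r) = hom_extend s f p - hom_extend s f r"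
  and hom_extend_sum: "hom_extend s f (sum h A) = (\<Sum>x\<in>A. hom_extend s f (h x))"
  by (simp_all add: hom_extend_eq_lin_ext lin_ext_add lin_ext_diff lin_ext_sum)

lemma hom_extend_scalar: "hom_extend s f (scalar c) = s c"
  by (simp add: hom_extend_eq_lin_ext lin_ext_scalar zero_fword_def)

lemma hom_extend_gen: "hom_extend s f (gen x) = f x"
  by (simp add: hom_extend_eq_lin_ext gen_def lin_ext_single s_one)

lemma hom_extend_mult: "hom_extend s f (p * r) = hom_extend s f p * hom_extend s f r"
  unfolding hom_extend_eq_lin_ext by (rule lin_ext_mult) (simp add: plus_fword_def)

end

interpretation scalar_cnj: central_embedding "\<lambda>c. scalar (cnj c)"
  by (rule central_embedding_scalar_cnj)

lemma anti_extend_add: "anti_extend f (p + r) = anti_extend f p + anti_extend f r"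
  and anti_extend_diff: "anti_extend f (p - r) = anti_extend f p - anti_extend f r"
  and anti_extend_sum: "anti_extend f (sum h A) = (\<Sum>x\<in>A. anti_extend f (h x))"
  by (simp_all add: anti_extend_eq_lin_ext scalar_cnj.lin_ext_add scalar_cnj.lin_ext_diff
      scalar_cnj.lin_ext_sum)

lemma anti_extend_scalar: "anti_extend f (scalar c) = scalar (cnj c)"
  by (simp add: anti_extend_eq_lin_ext scalar_cnj.lin_ext_scalar zero_fword_def)

lemma anti_extend_one: "anti_extend f 1 = 1"
  using anti_extend_scalar[of f 1] by simp

lemma anti_extend_gen: "anti_extend f (gen x) = f x"
  by (simp add: anti_extend_eq_lin_ext gen_def scalar_cnj.lin_ext_single)

lemma anti_extend_mult: "anti_extend f (p * r) = anti_extend f r * anti_extend f p"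
  unfolding anti_extend_eq_lin_ext
  by (rule scalar_cnj.lin_ext_antimult) (simp add: plus_fword_def)


section \<open>Ideals of monoid algebras\<close>

definition submonoid_add :: "'m::monoid_add set \<Rightarrow> bool" where
  "submonoid_add S \<longleftrightarrow> 0 \<in> S \<and> (\<forall>u\<in>S. \<forall>v\<in>S. u + v \<in> S)"

lemma submonoid_words: "submonoid_add (words X)"
  by (auto simp: submonoid_add_def words_def zero_fword_def plus_fword_def)

lemma submonoid_Times: "submonoid_add A \<Longrightarrow> submonoid_add B \<Longrightarrow> submonoid_add (A \<times> B)"
  by (auto simp: submonoid_add_def zero_prod_def)

lemma monoid_algebra_simps [simp]:
  "carrier (monoid_algebra S) = {p. Poly_Mapping.keys p \<subseteq> S}"
  "monoid.mult (monoid_algebra S) = (*)"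
  "one (monoid_algebra S) = 1"
  "zero (monoid_algebra S) = 0"
  "add (monoid_algebra S) = (+)"
  by (simp_all add: monoid_algebra_def)

lemma keys_add_subset:
  "Poly_Mapping.keys p \<subseteq> S \<Longrightarrow> Poly_Mapping.keys r \<subseteq> S \<Longrightarrow> Poly_Mapping.keys (p + r) \<subseteq> S"
  using Poly_Mapping.keys_add[of p r] by blast

lemma keys_uminus: "Poly_Mapping.keys (- p) = Poly_Mapping.keys (p :: 'a \<Rightarrow>\<^sub>0 complex)"
  by (auto simp: in_keys_iff)

lemma keys_diff_subset:
  fixes p :: "'a \<Rightarrow>\<^sub>0 complex"
  shows "Poly_Mapping.keys p \<subseteq> S \<Longrightarrow> Poly_Mapping.keys r \<subseteq> S \<Longrightarrow> Poly_Mapping.keys (p - r) \<subseteq> S"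
  using keys_add_subset[of p S "- r"] by (simp add: keys_uminus)

lemma keys_sum_subset:
  "(\<And>x. x \<in> A \<Longrightarrow> Poly_Mapping.keys (f x) \<subseteq> S) \<Longrightarrow> Poly_Mapping.keys (sum f A) \<subseteq> S"
  by (induction A rule: infinite_finite_induct) (simp_all add: keys_add_subset)

lemma keys_mult_subset:
  assumes "submonoid_add S" "Poly_Mapping.keys p \<subseteq> S" "Poly_Mapping.keys r \<subseteq> S"
  shows "Poly_Mapping.keys (p * r) \<subseteq> S"
  using assms Poly_Mapping.keys_mult[of p r] unfolding submonoid_add_def by blast

lemma keys_scalar_subset: "submonoid_add S \<Longrightarrow> Poly_Mapping.keys (scalar c) \<subseteq> S"
  using keys_scalar[of c] by (auto simp: submonoid_add_def)

lemma ring_monoid_algebra: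
  assumes "submonoid_add S"
  shows "ring (monoid_algebra S)"
proof (rule ringI)
  show "abelian_group (monoid_algebra S)"
  proof (rule abelian_groupI)
    fix p assume "p \<in> carrier (monoid_algebra S)"
    then show "\<exists>r\<in>carrier (monoid_algebra S). r \<oplus>\<^bsub>monoid_algebra S\<^esub> p = \<zero>\<^bsub>monoid_algebra S\<^esub>"
      by (intro bexI[of _ "- p"]) (auto simp: keys_uminus)
  qed (auto simp: add_ac keys_add_subset[THEN subsetD])
  show "Group.monoid (monoid_algebra S)"
    using assms keys_scalar_subset[of S 1]
    by (intro monoidI) (auto simp: mult.assoc keys_mult_subset[THEN subsetD])
qed (auto simp: distrib_left distrib_right)

lemma ideal_monoid_algebra:
  assumes "submonoid_add S" "ideal I (monoid_algebra S)"
  shows "p \<in> I \<Longrightarrow> Poly_Mapping.keys p \<subseteq> S"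
    and "0 \<in> I"
    and "p \<in> I \<Longrightarrow> r \<in> I \<Longrightarrow> p + r \<in> I"
    and "p \<in> I \<Longrightarrow> - p \<in> I"
    and "p \<in> I \<Longrightarrow> Poly_Mapping.keys r \<subseteq> S \<Longrightarrow> p * r \<in> I"
    and "p \<in> I \<Longrightarrow> Poly_Mapping.keys r \<subseteq> S \<Longrightarrow> r * p \<in> I"
proof -
  interpret ideal I "monoid_algebra S" by fact
  show keys: "p \<in> I \<Longrightarrow> Poly_Mapping.keys p \<subseteq> S" using Icarr by force
  show "0 \<in> I" using additive_subgroup.zero_closed[OF is_additive_subgroup] by simp
  show "p \<in> I \<Longrightarrow> r \<in> I \<Longrightarrow> p + r \<in> I" using additive_subgroup.a_closed[OF is_additive_subgroup] by simp
  show r: "p \<in> I \<Longrightarrow> Poly_Mapping.keys r \<subseteq> S \<Longrightarrow> r * p \<in> I" for r using I_l_closed by simp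
  show "p \<in> I \<Longrightarrow> Poly_Mapping.keys r \<subseteq> S \<Longrightarrow> p * r \<in> I" using I_r_closed by simp
  show "p \<in> I \<Longrightarrow> - p \<in> I"
    using r[of "- 1"] keys_scalar_subset[OF assms(1), of "- 1"] by (simp add: scalar_uminus)
qed

text \<open>Closure under negation is multiplication by the scalar -1, which is why it is absent
  from the conditions.\<close>

lemma idealI_monoid_algebra:
  assumes "submonoid_add S" "I \<subseteq> {p. Poly_Mapping.keys p \<subseteq> S}" "0 \<in> I"
    and add: "\<And>p r. p \<in> I \<Longrightarrow> r \<in> I \<Longrightarrow> p + r \<in> I"
    and l: "\<And>p r. p \<in> I \<Longrightarrow> Poly_Mapping.keys r \<subseteq> S \<Longrightarrow> r * p \<in> I"
    and r: "\<And>p r. p \<in> I \<Longrightarrow> Poly_Mapping.keys r \<subseteq> S \<Longrightarrow> p * r \<in> I"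
  shows "ideal I (monoid_algebra S)"
proof (rule idealI)
  interpret ring "monoid_algebra S" by (rule ring_monoid_algebra) fact
  show "ring (monoid_algebra S)" by (rule ring_monoid_algebra) fact
  show "subgroup I (add_monoid (monoid_algebra S))"
  proof (rule add.subgroupI)
    fix p assume p: "p \<in> I"
    have "- p \<in> I"
      using l[OF p, of "- 1"] keys_scalar_subset[OF assms(1), of "- 1"]
      by (simp add: scalar_uminus)
    moreover have "\<ominus>\<^bsub>monoid_algebra S\<^esub> p = - p"
      using minus_equality[of "- p" p] p assms(2) by (auto simp: keys_uminus)
    ultimately show "\<ominus>\<^bsub>monoid_algebra S\<^esub> p \<in> I" by simp
  qed (use assms in auto)
qed (use l r in auto)

lemma ideal_Idl:
  assumes "submonoid_add S" "J \<subseteq> {p. Poly_Mapping.keys p \<subseteq> S}"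
  shows "ideal (Idl\<^bsub>monoid_algebra S\<^esub> J) (monoid_algebra S)"
    and "J \<subseteq> Idl\<^bsub>monoid_algebra S\<^esub> J"
proof -
  interpret ring "monoid_algebra S" by (rule ring_monoid_algebra) fact
  show "ideal (Idl\<^bsub>monoid_algebra S\<^esub> J) (monoid_algebra S)"
    using genideal_ideal assms(2) by simp
  show "J \<subseteq> Idl\<^bsub>monoid_algebra S\<^esub> J"
    using genideal_self assms(2) by simp
qed

text \<open>The elements of the algebra with property \<open>P\<close> form an ideal containing the
  generators, and the generated ideal is the smallest such.\<close>

lemma Idl_induct:
  assumes S: "submonoid_add S" and J: "J \<subseteq> {p. Poly_Mapping.keys p \<subseteq> S}"
    and x: "x \<in> Idl\<^bsub>monoid_algebra S\<^esub> J"
    and base: "\<And>p. p \<in> J \<Longrightarrow> P p" and zero: "P 0"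
    and add: "\<And>p r. P p \<Longrightarrow> P r \<Longrightarrow> P (p + r)"
    and l: "\<And>p r. P p \<Longrightarrow> Poly_Mapping.keys r \<subseteq> S \<Longrightarrow> P (r * p)"
    and r: "\<And>p r. P p \<Longrightarrow> Poly_Mapping.keys r \<subseteq> S \<Longrightarrow> P (p * r)"
  shows "P x"
proof -
  have "ideal {p. Poly_Mapping.keys p \<subseteq> S \<and> P p} (monoid_algebra S)"
    using S add l r zero
    by (intro idealI_monoid_algebra)
      (auto simp: keys_add_subset[THEN subsetD] keys_mult_subset[THEN subsetD])
  then have "Idl\<^bsub>monoid_algebra S\<^esub> J \<subseteq> {p. Poly_Mapping.keys p \<subseteq> S \<and> P p}"
    using ring.genideal_minimal[OF ring_monoid_algebra[OF S]] J base by blast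
  then show ?thesis using x by blast
qed

text \<open>Reversing products exchanges left and right multiples, which a two-sided ideal does not
  notice. Stability of every ideal below is reduced to its generators in this way.\<close>

lemma Idl_antihom:
  assumes S: "submonoid_add S" and J: "J \<subseteq> {p. Poly_Mapping.keys p \<subseteq> S}"
    and S': "submonoid_add S'" and I: "ideal I (monoid_algebra S')"
    and closed: "\<And>p. Poly_Mapping.keys p \<subseteq> S \<Longrightarrow> Poly_Mapping.keys (h p) \<subseteq> S'"
    and add: "\<And>p r. h (p + r) = h p + h r"
    and mult: "\<And>p r. h (p * r) = h r * h p"
    and base: "\<And>p. p \<in> J \<Longrightarrow> h p \<in> I"
    and x: "x \<in> Idl\<^bsub>monoid_algebra S\<^esub> J"
  shows "h x \<in> I"
  using S J x
proof (rule Idl_induct)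
  show "h 0 \<in> I"
    using add[of 0 0] ideal_monoid_algebra(2)[OF S' I] by simp
qed (use ideal_monoid_algebra[OF S' I] in \<open>auto simp: add mult base closed\<close>)

lemma coset_eq_image: "I +>\<^bsub>monoid_algebra S\<^esub> p = (\<lambda>i. i + p) ` I"
  by (auto simp: a_r_coset_def r_coset_def)

section \<open>Free algebras and tensor products\<close>

lemma gen_keys: "Poly_Mapping.keys (gen x) \<subseteq> words X \<longleftrightarrow> x \<in> X"
  by (simp add: gen_def words_def)

lemma free_algebra_induct [consumes 1, case_names scalar gen add mult]:
  assumes "Poly_Mapping.keys p \<subseteq> words X"
    and scalar: "\<And>c. P (scalar c)"
    and gen: "\<And>x. x \<in> X \<Longrightarrow> P (gen x)"
    and add: "\<And>p r. P p \<Longrightarrow> P r \<Longrightarrow> P (p + r)"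
    and mult: "\<And>p r. P p \<Longrightarrow> P r \<Longrightarrow> P (p * r)"
  shows "P p"
  using assms(1)
proof (rule poly_mapping_single_induct)
  show "P 0" using scalar[of 0] by simp
  fix w c assume "w \<in> words X"
  then have w: "set (letters w) \<subseteq> X" by (simp add: words_def)
  have "set xs \<subseteq> X \<Longrightarrow> P (Poly_Mapping.single (FWord xs) c)" for xs
  proof (induction xs)
    case Nil
    then show ?case using scalar[of c] by (simp add: scalar_def zero_fword_def)
  next
    case (Cons x xs)
    then have "P (gen x * Poly_Mapping.single (FWord xs) c)" by (intro mult gen) auto
    then show ?case by (simp add: gen_def mult_single plus_fword_def)
  qed
  from this[OF w] show "P (Poly_Mapping.single w c)" by simp
qed (rule add)

lemma anti_extend_closed:
  assumes "\<And>x. x \<in> X \<Longrightarrow> Poly_Mapping.keys (f x) \<subseteq> words X"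
    and "Poly_Mapping.keys p \<subseteq> words X"
  shows "Poly_Mapping.keys (anti_extend f p) \<subseteq> words X"
  using assms(2)
  by (induction p rule: free_algebra_induct)
    (auto simp: anti_extend_scalar anti_extend_gen anti_extend_add anti_extend_mult
      keys_scalar_subset[OF submonoid_words, THEN subsetD]
      assms(1)[THEN subsetD] keys_add_subset[THEN subsetD]
      keys_mult_subset[OF submonoid_words, THEN subsetD])

lemma anti_extend_involution:
  assumes "\<And>x. x \<in> X \<Longrightarrow> anti_extend f (f x) = gen x"
    and "Poly_Mapping.keys p \<subseteq> words X"
  shows "anti_extend f (anti_extend f p) = p"
  using assms(2)
  by (induction p rule: free_algebra_induct)
    (auto simp: anti_extend_scalar anti_extend_gen anti_extend_add anti_extend_mult assms(1))

text \<open>The sums defining \<open>tensor\<close> range over supports that vary with the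
  arguments; a common finite index set makes bilinearity a termwise statement.\<close>

lemma tensor_superset:
  assumes "finite A" "finite B" "Poly_Mapping.keys p \<subseteq> A" "Poly_Mapping.keys r \<subseteq> B"
  shows "p \<otimes>\<^sub>f r = (\<Sum>u\<in>A. \<Sum>v\<in>B.
      Poly_Mapping.single (u, v) (Poly_Mapping.lookup p u * Poly_Mapping.lookup r v))"
proof -
  have "p \<otimes>\<^sub>f r = (\<Sum>u\<in>Poly_Mapping.keys p. \<Sum>v\<in>B.
      Poly_Mapping.single (u, v) (Poly_Mapping.lookup p u * Poly_Mapping.lookup r v))"
    unfolding tensor_def using assms
    by (intro sum.cong refl sum.mono_neutral_left) (auto simp: in_keys_iff)
  also have "\<dots> = (\<Sum>u\<in>A. \<Sum>v\<in>B.
      Poly_Mapping.single (u, v) (Poly_Mapping.lookup p u * Poly_Mapping.lookup r v))"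
    using assms by (intro sum.mono_neutral_left) (auto simp: in_keys_iff)
  finally show ?thesis .
qed

lemma tensor_zero [simp]: "0 \<otimes>\<^sub>f r = 0" "p \<otimes>\<^sub>f 0 = 0"
  by (simp_all add: tensor_def)

lemma tensor_single:
  "Poly_Mapping.single u c \<otimes>\<^sub>f Poly_Mapping.single v d = Poly_Mapping.single (u, v) (c * d)"
  by (simp add: tensor_superset[of "{u}" "{v}"])

lemma tensor_add_left: "(p + p') \<otimes>\<^sub>f r = p \<otimes>\<^sub>f r + p' \<otimes>\<^sub>f r"
proof -
  let ?A = "Poly_Mapping.keys p \<union> Poly_Mapping.keys p'"
  have "Poly_Mapping.keys (p + p') \<subseteq> ?A" by (rule Poly_Mapping.keys_add)
  then show ?thesis
    by (simp add: tensor_superset[of ?A "Poly_Mapping.keys r"] lookup_add distrib_right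
        single_add sum.distrib)
qed

lemma tensor_add_right: "p \<otimes>\<^sub>f (r + r') = p \<otimes>\<^sub>f r + p \<otimes>\<^sub>f r'"
proof -
  let ?A = "Poly_Mapping.keys r \<union> Poly_Mapping.keys r'"
  have "Poly_Mapping.keys (r + r') \<subseteq> ?A" by (rule Poly_Mapping.keys_add)
  then show ?thesis
    by (simp add: tensor_superset[of "Poly_Mapping.keys p" ?A] lookup_add distrib_left
        single_add sum.distrib)
qed

text \<open>Additivity in one argument at a time reduces the identity to monomials.\<close>

lemma tensor_mult: "(p \<otimes>\<^sub>f r) * (p' \<otimes>\<^sub>f r') = (p * p') \<otimes>\<^sub>f (r * r')"
proof -
  have 1: "(Poly_Mapping.single u c \<otimes>\<^sub>f Poly_Mapping.single v d) * (Poly_Mapping.single u' c' \<otimes>\<^sub>f r')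
     = (Poly_Mapping.single u c * Poly_Mapping.single u' c') \<otimes>\<^sub>f (Poly_Mapping.single v d * r')"
    for u c v d u' c'
    by (rule poly_mapping_single_induct[of r' UNIV])
      (auto simp: tensor_single mult_single distrib_left tensor_add_right mult_ac)
  have 2: "(Poly_Mapping.single u c \<otimes>\<^sub>f Poly_Mapping.single v d) * (p' \<otimes>\<^sub>f r')
     = (Poly_Mapping.single u c * p') \<otimes>\<^sub>f (Poly_Mapping.single v d * r')" for u c v d
    by (rule poly_mapping_single_induct[of p' UNIV])
      (auto simp: 1 distrib_left tensor_add_left)
  have 3: "(Poly_Mapping.single u c \<otimes>\<^sub>f r) * (p' \<otimes>\<^sub>f r')
     = (Poly_Mapping.single u c * p') \<otimes>\<^sub>f (r * r')" for u c
    by (rule poly_mapping_single_induct[of r UNIV])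
      (auto simp: 2 distrib_right tensor_add_right)
  show ?thesis
    by (rule poly_mapping_single_induct[of p UNIV])
      (auto simp: 3 distrib_right tensor_add_left)
qed

lemma tensor_scalar: "scalar c \<otimes>\<^sub>f scalar d = scalar (c * d)"
  by (simp add: scalar_def tensor_single zero_prod_def)

lemma tensor_scalar_mult: "(scalar c * p) \<otimes>\<^sub>f (scalar d * r) = scalar (c * d) * (p \<otimes>\<^sub>f r)"
  by (metis tensor_mult tensor_scalar)

lemma tensor_closed:
  assumes "Poly_Mapping.keys p \<subseteq> A" "Poly_Mapping.keys r \<subseteq> B"
  shows "Poly_Mapping.keys (p \<otimes>\<^sub>f r) \<subseteq> A \<times> B"
  unfolding tensor_def using assms by (intro keys_sum_subset) auto

lemma tensor_induct [consumes 1, case_names tensor add]: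
  assumes "Poly_Mapping.keys t \<subseteq> A \<times> B"
    and tensor: "\<And>p r. Poly_Mapping.keys p \<subseteq> A \<Longrightarrow> Poly_Mapping.keys r \<subseteq> B \<Longrightarrow> P (p \<otimes>\<^sub>f r)"
    and add: "\<And>p r. P p \<Longrightarrow> P r \<Longrightarrow> P (p + r)"
  shows "P t"
  using assms(1)
proof (rule poly_mapping_single_induct)
  show "P 0" using tensor[of 0 0] by simp
  fix w c assume "w \<in> A \<times> B"
  then show "P (Poly_Mapping.single w c)"
    using tensor[of "Poly_Mapping.single (fst w) c" "Poly_Mapping.single (snd w) 1"]
    by (auto simp: tensor_single)
qed (rule add)

text \<open>The tensor product of two antilinear maps at the level of free algebras. Words enter as
  monomials with coefficient 1, so that a coefficient is conjugated exactly once, and products are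
  reversed inside each tensor factor without exchanging the factors.\<close>

definition anti_tensor ::
    "('x \<Rightarrow> 'x falg) \<Rightarrow> ('y \<Rightarrow> 'y falg) \<Rightarrow> ('x, 'y) ftens \<Rightarrow> ('x, 'y) ftens" where
  "anti_tensor f g = lin_ext (\<lambda>c. scalar (cnj c))
    (\<lambda>w. anti_extend f (Poly_Mapping.single (fst w) 1) \<otimes>\<^sub>f
         anti_extend g (Poly_Mapping.single (snd w) 1))"

lemma anti_tensor_add: "anti_tensor f g (p + r) = anti_tensor f g p + anti_tensor f g r"
  and anti_tensor_diff: "anti_tensor f g (p - r) = anti_tensor f g p - anti_tensor f g r"
  and anti_tensor_sum: "anti_tensor f g (sum h A) = (\<Sum>x\<in>A. anti_tensor f g (h x))"
  and anti_tensor_zero: "anti_tensor f g 0 = 0"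
  by (simp_all add: anti_tensor_def scalar_cnj.lin_ext_add scalar_cnj.lin_ext_diff
      scalar_cnj.lin_ext_sum scalar_cnj.lin_ext_zero)

lemma anti_tensor_mult: "anti_tensor f g (p * r) = anti_tensor f g r * anti_tensor f g p"
  unfolding anti_tensor_def
proof (rule scalar_cnj.lin_ext_antimult)
  fix u v :: "'a fword \<times> 'b fword"
  have split: "Poly_Mapping.single (x + y) (1::complex)
    = Poly_Mapping.single x 1 * Poly_Mapping.single y 1" for x y :: "'z::monoid_add"
    by (simp add: mult_single)
  show "anti_extend f (Poly_Mapping.single (fst (u + v)) 1) \<otimes>\<^sub>f
      anti_extend g (Poly_Mapping.single (snd (u + v)) 1) =
    anti_extend f (Poly_Mapping.single (fst v) 1) \<otimes>\<^sub>f
      anti_extend g (Poly_Mapping.single (snd v) 1) *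
    (anti_extend f (Poly_Mapping.single (fst u) 1) \<otimes>\<^sub>f
      anti_extend g (Poly_Mapping.single (snd u) 1))"
    by (simp add: split anti_extend_mult tensor_mult)
qed

lemma anti_tensor_tensor: "anti_tensor f g (p \<otimes>\<^sub>f r) = anti_extend f p \<otimes>\<^sub>f anti_extend g r"
proof -
  have split: "anti_extend h (Poly_Mapping.single x c)
    = scalar (cnj c) * anti_extend h (Poly_Mapping.single x 1)" for h :: "'z \<Rightarrow> 'z falg" and x c
    by (simp add: anti_extend_eq_lin_ext scalar_cnj.lin_ext_single)
  have 1: "anti_tensor f g (Poly_Mapping.single u c \<otimes>\<^sub>f Poly_Mapping.single v d) =
    anti_extend f (Poly_Mapping.single u c) \<otimes>\<^sub>f anti_extend g (Poly_Mapping.single v d)" for u c v d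
    by (subst split[of f u c], subst split[of g v d])
      (simp add: tensor_single tensor_scalar_mult anti_tensor_def scalar_cnj.lin_ext_single)
  have 2: "anti_extend h 0 = 0" for h :: "'z \<Rightarrow> 'z falg"
    using anti_extend_scalar[of h 0] by simp
  have 3: "anti_tensor f g (Poly_Mapping.single u c \<otimes>\<^sub>f r) =
    anti_extend f (Poly_Mapping.single u c) \<otimes>\<^sub>f anti_extend g r" for u c
    by (rule poly_mapping_single_induct[of r UNIV])
      (auto simp: 1 2 anti_tensor_zero anti_tensor_add anti_extend_add tensor_add_right)
  show ?thesis
    by (rule poly_mapping_single_induct[of p UNIV])
      (auto simp: 2 3 anti_tensor_zero anti_tensor_add anti_extend_add tensor_add_left)
qed

lemma anti_tensor_scalar: "anti_tensor f g (scalar c) = scalar (cnj c)"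
  using anti_tensor_tensor[of f g "scalar c" "scalar 1"]
  by (simp only: tensor_scalar anti_extend_scalar) simp

interpretation scalar_emb: central_embedding scalar
  by (rule central_embedding_scalar)

interpretation id_emb: central_embedding "\<lambda>c::complex. c"
  by (rule central_embedding_id)

section \<open>Ideals of tensor products and maps between them\<close>

lemma tensor_ideal_gens:
  assumes "I \<subseteq> {p. Poly_Mapping.keys p \<subseteq> words X}" "J \<subseteq> {p. Poly_Mapping.keys p \<subseteq> words Y}"
  shows "{p \<otimes>\<^sub>f 1 | p. p \<in> I} \<union> {1 \<otimes>\<^sub>f r | r. r \<in> J}
      \<subseteq> {t. Poly_Mapping.keys t \<subseteq> words X \<times> words Y}"
proof -
  have one: "Poly_Mapping.keys (1 :: 'z falg) \<subseteq> words Z" for Z :: "'z set"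
    using keys_scalar_subset[OF submonoid_words, of 1] by simp
  have "Poly_Mapping.keys (p \<otimes>\<^sub>f 1) \<subseteq> words X \<times> words Y" if "p \<in> I" for p
    using that assms by (intro tensor_closed one) auto
  moreover have "Poly_Mapping.keys (1 \<otimes>\<^sub>f r) \<subseteq> words X \<times> words Y" if "r \<in> J" for r
    using that assms by (intro tensor_closed one) auto
  ultimately show ?thesis by blast
qed

lemma tensor_ideal_ideal:
  assumes "I \<subseteq> {p. Poly_Mapping.keys p \<subseteq> words X}" "J \<subseteq> {p. Poly_Mapping.keys p \<subseteq> words Y}"
  shows "ideal (tensor_ideal X I Y J) (monoid_algebra (words X \<times> words Y))"
    and "p \<in> I \<Longrightarrow> p \<otimes>\<^sub>f 1 \<in> tensor_ideal X I Y J"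
    and "r \<in> J \<Longrightarrow> 1 \<otimes>\<^sub>f r \<in> tensor_ideal X I Y J"
proof -
  note gens = tensor_ideal_gens[OF assms]
  note S = submonoid_Times[OF submonoid_words submonoid_words]
  show "ideal (tensor_ideal X I Y J) (monoid_algebra (words X \<times> words Y))"
    unfolding tensor_ideal_def free_tensor_def by (rule ideal_Idl(1)[OF S gens])
  show "p \<in> I \<Longrightarrow> p \<otimes>\<^sub>f 1 \<in> tensor_ideal X I Y J"
    and "r \<in> J \<Longrightarrow> 1 \<otimes>\<^sub>f r \<in> tensor_ideal X I Y J"
    using ideal_Idl(2)[OF S gens] unfolding tensor_ideal_def free_tensor_def by blast+
qed

lemma anti_tensor_closed:
  assumes "\<And>x. x \<in> X \<Longrightarrow> Poly_Mapping.keys (f x) \<subseteq> words X"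
    and "\<And>y. y \<in> Y \<Longrightarrow> Poly_Mapping.keys (g y) \<subseteq> words Y"
    and "Poly_Mapping.keys t \<subseteq> words X \<times> words Y"
  shows "Poly_Mapping.keys (anti_tensor f g t) \<subseteq> words X \<times> words Y"
  using assms(3)
  by (induction t rule: tensor_induct)
    (simp_all add: anti_tensor_tensor anti_tensor_add tensor_closed keys_add_subset
      anti_extend_closed assms(1,2))

lemma anti_tensor_involution:
  assumes "\<And>x. x \<in> X \<Longrightarrow> anti_extend f (f x) = gen x"
    and "\<And>y. y \<in> Y \<Longrightarrow> anti_extend g (g y) = gen y"
    and "Poly_Mapping.keys t \<subseteq> words X \<times> words Y"
  shows "anti_tensor f g (anti_tensor f g t) = t"
  using assms(3)
  by (induction t rule: tensor_induct)
    (simp_all add: anti_tensor_tensor anti_tensor_add anti_extend_involution[of X f]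
      anti_extend_involution[of Y g] assms(1,2))

text \<open>The generators are of the form p \<otimes> 1 and 1 \<otimes> r, and both antilinear maps
  fix 1, so each generator goes to a generator of the same kind.\<close>

lemma anti_tensor_tensor_ideal:
  assumes f: "\<And>x. x \<in> X \<Longrightarrow> Poly_Mapping.keys (f x) \<subseteq> words X"
    and g: "\<And>y. y \<in> Y \<Longrightarrow> Poly_Mapping.keys (g y) \<subseteq> words Y"
    and I: "I \<subseteq> {p. Poly_Mapping.keys p \<subseteq> words X}"
    and J: "J \<subseteq> {p. Poly_Mapping.keys p \<subseteq> words Y}"
    and fI: "\<And>p. p \<in> I \<Longrightarrow> anti_extend f p \<in> I"
    and gJ: "\<And>p. p \<in> J \<Longrightarrow> anti_extend g p \<in> J"
    and t: "t \<in> tensor_ideal X I Y J"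
  shows "anti_tensor f g t \<in> tensor_ideal X I Y J"
proof (rule Idl_antihom[where h = "anti_tensor f g" and x = t,
      OF submonoid_Times[OF submonoid_words submonoid_words] _
      submonoid_Times[OF submonoid_words submonoid_words]])
  show "ideal (tensor_ideal X I Y J) (monoid_algebra (words X \<times> words Y))"
    by (rule tensor_ideal_ideal[OF I J])
  show "{p \<otimes>\<^sub>f 1 | p. p \<in> I} \<union> {1 \<otimes>\<^sub>f r | r. r \<in> J}
      \<subseteq> {t. Poly_Mapping.keys t \<subseteq> words X \<times> words Y}"
    by (rule tensor_ideal_gens[OF I J])
  show "anti_tensor f g p \<in> tensor_ideal X I Y J"
    if "p \<in> {p \<otimes>\<^sub>f 1 | p. p \<in> I} \<union> {1 \<otimes>\<^sub>f r | r. r \<in> J}" for p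
    using that fI gJ tensor_ideal_ideal(2,3)[OF I J]
    by (auto simp: anti_tensor_tensor anti_extend_one)
  show "t \<in> Idl\<^bsub>monoid_algebra (words X \<times> words Y)\<^esub> ({p \<otimes>\<^sub>f 1 | p. p \<in> I} \<union> {1 \<otimes>\<^sub>f r | r. r \<in> J})"
    using t by (simp add: tensor_ideal_def free_tensor_def)
qed (simp_all add: anti_tensor_closed f g anti_tensor_add anti_tensor_mult)

lemma hom_extend_closed:
  assumes "submonoid_add S" "\<And>x. x \<in> X \<Longrightarrow> Poly_Mapping.keys (f x) \<subseteq> S"
    and "Poly_Mapping.keys p \<subseteq> words X"
  shows "Poly_Mapping.keys (hom_extend scalar f p) \<subseteq> S"
  using assms(3)
  by (induction p rule: free_algebra_induct)
    (simp_all add: scalar_emb.hom_extend_scalar scalar_emb.hom_extend_gen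
      scalar_emb.hom_extend_add scalar_emb.hom_extend_mult assms(1,2) keys_scalar_subset
      keys_add_subset keys_mult_subset)

text \<open>Both sides are antilinear and reverse products in \<open>p\<close>, so agreement on
  generators is enough. The map \<open>\<delta>\<close> will be the comultiplication in one use and
  the coaction in the other.\<close>

lemma hom_extend_anti:
  assumes "\<And>x. x \<in> X \<Longrightarrow> hom_extend scalar \<delta> (f x) = anti_tensor g h (\<delta> x)"
    and "Poly_Mapping.keys p \<subseteq> words X"
  shows "hom_extend scalar \<delta> (anti_extend f p) = anti_tensor g h (hom_extend scalar \<delta> p)"
  using assms(2)
  by (induction p rule: free_algebra_induct)
    (simp_all add: scalar_emb.hom_extend_scalar scalar_emb.hom_extend_gen
      scalar_emb.hom_extend_add scalar_emb.hom_extend_mult assms(1) anti_extend_scalar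
      anti_extend_gen anti_extend_add anti_extend_mult anti_tensor_scalar anti_tensor_add
      anti_tensor_mult)

section \<open>Quotients of monoid algebras\<close>

locale quotient_algebra =
  fixes S :: "'m::monoid_add set" and I :: "('m \<Rightarrow>\<^sub>0 complex) set"
  assumes S: "submonoid_add S" and I: "ideal I (monoid_algebra S)"
begin

abbreviation Q where "Q \<equiv> monoid_algebra S Quot I"
abbreviation cls where "cls p \<equiv> I +>\<^bsub>monoid_algebra S\<^esub> p"

lemmas ideal_simps = ideal_monoid_algebra[OF S I]

lemma carrier_Q: "carrier Q = {cls p | p. Poly_Mapping.keys p \<subseteq> S}"
  by (auto simp: FactRing_def A_RCOSETS_def RCOSETS_def a_r_coset_def)

lemma cls_add:
  "Poly_Mapping.keys p \<subseteq> S \<Longrightarrow> Poly_Mapping.keys r \<subseteq> S \<Longrightarrow> cls p \<oplus>\<^bsub>Q\<^esub> cls r = cls (p + r)"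
  using abelian_subgroup.a_rcos_sum[OF abelian_subgroupI3[OF ideal.axioms(1)[OF I]
      ring.is_abelian_group[OF ring_monoid_algebra[OF S]]], of p r]
  by (simp add: FactRing_simps)

lemma cls_mult:
  "Poly_Mapping.keys p \<subseteq> S \<Longrightarrow> Poly_Mapping.keys r \<subseteq> S \<Longrightarrow> cls p \<otimes>\<^bsub>Q\<^esub> cls r = cls (p * r)"
  using ideal.rcoset_mult_add[OF I, of p r] by (simp add: FactRing_simps)

lemma mem_cls: "r \<in> cls p \<longleftrightarrow> r - p \<in> I"
  by (auto simp: coset_eq_image image_iff intro: bexI[of _ "r - p"])

lemma cls_self: "p \<in> cls p"
  by (simp add: mem_cls ideal_simps(2))

lemma cls_eqI:
  assumes "r - p \<in> I"
  shows "cls r = cls p"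
proof -
  have "x - r \<in> I \<longleftrightarrow> x - p \<in> I" for x
    using ideal_simps(3)[of "x - r" "r - p"] ideal_simps(3)[of "x - p" "- (r - p)"]
      ideal_simps(4)[OF assms] assms by auto
  then show ?thesis by (auto simp: mem_cls)
qed

lemma cls_keys: "Poly_Mapping.keys p \<subseteq> S \<Longrightarrow> r \<in> cls p \<Longrightarrow> Poly_Mapping.keys r \<subseteq> S"
  using keys_add_subset[of "r - p" S p] ideal_simps(1)[of "r - p"] by (simp add: mem_cls)

end

text \<open>Instantiated twice: with the free algebra on the matrix entries, and with its tensor
  square.\<close>

locale anti_involution = quotient_algebra S I
  for S :: "'m::monoid_add set" and I :: "('m \<Rightarrow>\<^sub>0 complex) set" +
  fixes h :: "('m \<Rightarrow>\<^sub>0 complex) \<Rightarrow> ('m \<Rightarrow>\<^sub>0 complex)"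
  assumes closed: "Poly_Mapping.keys p \<subseteq> S \<Longrightarrow> Poly_Mapping.keys (h p) \<subseteq> S"
    and inv: "Poly_Mapping.keys p \<subseteq> S \<Longrightarrow> h (h p) = p"
    and h_add: "h (p + r) = h p + h r"
    and h_mult: "h (p * r) = h r * h p"
    and h_scalar: "h (scalar c) = scalar (cnj c)"
    and h_ideal: "p \<in> I \<Longrightarrow> h p \<in> I"
begin

text \<open>Written with the same union over representatives as \<open>twisted_star\<close>, so that
  the two agree as functions and not merely on cosets.\<close>

definition hq where "hq x = (\<Union>p\<in>x. cls (h p))"

lemma h_diff: "h (p - r) = h p - h r"
  using h_add[of "p - r" r] by simp

text \<open>Since \<open>h\<close> is its own inverse on the algebra, a coset is carried onto a
  whole coset and not just into one. This permits unions over representatives to be reindexed along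
  \<open>h\<close>.\<close>

lemma h_cls: "Poly_Mapping.keys p \<subseteq> S \<Longrightarrow> h ` cls p = cls (h p)"
proof (intro equalityI subsetI)
  fix x assume p: "Poly_Mapping.keys p \<subseteq> S" and x: "x \<in> cls (h p)"
  have "h x \<in> cls p"
    using h_ideal[of "x - h p"] x by (simp add: mem_cls h_diff inv p)
  moreover have "x = h (h x)"
    using cls_keys[OF closed[OF p] x] by (simp add: inv)
  ultimately show "x \<in> h ` cls p" by blast
qed (auto simp: mem_cls h_diff[symmetric] h_ideal)

lemma hq_cls: "Poly_Mapping.keys p \<subseteq> S \<Longrightarrow> hq (cls p) = cls (h p)"
proof -
  have "cls (h r) = cls (h p)" if "r \<in> cls p" for r
    using that by (intro cls_eqI) (simp add: mem_cls h_diff[symmetric] h_ideal)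
  then have "hq (cls p) = (\<Union>r\<in>cls p. cls (h p))"
    unfolding hq_def by (intro SUP_cong refl)
  moreover have "cls p \<noteq> {}"
    using cls_self[of p] by blast
  ultimately show ?thesis
    by (simp only: UN_constant if_False)
qed

lemma hq_carrier:
  assumes "x \<in> carrier Q"
  shows "hq x \<in> carrier Q"
proof -
  obtain p where "x = cls p" "Poly_Mapping.keys p \<subseteq> S"
    using assms by (auto simp: carrier_Q)
  then have "hq x = cls (h p)" "Poly_Mapping.keys (h p) \<subseteq> S"
    by (simp_all add: hq_cls closed)
  then show ?thesis
    unfolding carrier_Q by blast
qed

lemma hq_add:
  assumes "x \<in> carrier Q" "y \<in> carrier Q"
  shows "hq (x \<oplus>\<^bsub>Q\<^esub> y) = hq x \<oplus>\<^bsub>Q\<^esub> hq y"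
  using assms by (auto simp: carrier_Q hq_cls cls_add closed keys_add_subset h_add)

lemma hq_mult:
  assumes "x \<in> carrier Q" "y \<in> carrier Q"
  shows "hq (x \<otimes>\<^bsub>Q\<^esub> y) = hq y \<otimes>\<^bsub>Q\<^esub> hq x"
  using assms by (auto simp: carrier_Q hq_cls cls_mult closed keys_mult_subset[OF S] h_mult)

lemma hq_scale:
  assumes "x \<in> carrier Q"
  shows "hq (cls (scalar c) \<otimes>\<^bsub>Q\<^esub> x) = cls (scalar (cnj c)) \<otimes>\<^bsub>Q\<^esub> hq x"
proof -
  obtain p where "x = cls p" "Poly_Mapping.keys p \<subseteq> S"
    using assms by (auto simp: carrier_Q)
  then show ?thesis
    by (simp add: hq_cls cls_mult closed keys_mult_subset[OF S] h_mult
        keys_scalar_subset[OF S] h_scalar scalar_central[of "cnj c" "h p"])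
qed

lemma hq_inv: "x \<in> carrier Q \<Longrightarrow> hq (hq x) = x"
  by (auto simp: carrier_Q hq_cls closed inv)

lemma hq_UN:
  assumes "\<And>a. a \<in> A \<Longrightarrow> Poly_Mapping.keys (k a) \<subseteq> S"
  shows "hq (\<Union>a\<in>A. cls (k a)) = (\<Union>a\<in>A. cls (h (k a)))"
proof -
  have "hq (\<Union>a\<in>A. cls (k a)) = (\<Union>a\<in>A. hq (cls (k a)))"
    by (auto simp: hq_def)
  then show ?thesis using assms by (simp add: hq_cls)
qed

end

section \<open>Monomial conjugations\<close>

abbreviation rscalar :: "real \<Rightarrow> ('m::monoid_add \<Rightarrow>\<^sub>0 complex)" where
  "rscalar x \<equiv> scalar (complex_of_real x)"

abbreviation metric_entry :: "nat \<Rightarrow> real \<Rightarrow> nat \<Rightarrow> nat \<Rightarrow> real" where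
  "metric_entry N q a b \<equiv> (if b = flip_index N a then q_half N q (- two_rho N a) else 0)"

lemma metric_index: "a < N \<Longrightarrow> b < N \<Longrightarrow> metric N q $$ (a, b) = of_real (metric_entry N q a b)"
  by (simp add: metric_def)

text \<open>Moves scalars to the front; \<open>scalar_central\<close> itself loops as a rewrite rule.\<close>

lemma scalar_normalize:
  "gen x * scalar c = scalar c * gen x"
  "gen x * (scalar c * p) = scalar c * (gen x * p)"
  "scalar c * (scalar d * p) = scalar (c * d) * p"
  by (rule scalar_central[symmetric], rule scalar_left_commute, simp add: scalar_mult mult.assoc)

definition rtt_relation :: "nat \<Rightarrow> real \<Rightarrow> nat \<Rightarrow> nat \<Rightarrow> nat \<Rightarrow> nat \<Rightarrow> (nat \<times> nat) falg" where
  "rtt_relation N q a b c d =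
    (\<Sum>e<N. \<Sum>f<N. rscalar (R_entry N q a b e f) * (gen (e, c) * gen (f, d)))
    - (\<Sum>e<N. \<Sum>f<N. rscalar (R_entry N q e f c d) * (gen (b, f) * gen (a, e)))"

lemma RTT_relations_eq:
  "RTT_relations N q = {rtt_relation N q a b c d | a b c d. a < N \<and> b < N \<and> c < N \<and> d < N}"
  by (simp add: RTT_relations_def rtt_relation_def scalar_normalize mult.assoc)

text \<open>The outer sum runs over the second metric index because the triple matrix product is
  bracketed to the left.\<close>

definition row_relation :: "nat \<Rightarrow> real \<Rightarrow> nat \<Rightarrow> nat \<Rightarrow> (nat \<times> nat) falg" where
  "row_relation N q a b =
    (\<Sum>d<N. \<Sum>c<N. rscalar (metric_entry N q c d) * (gen (a, c) * gen (b, d)))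
    - rscalar (metric_entry N q a b)"

definition column_relation :: "nat \<Rightarrow> real \<Rightarrow> nat \<Rightarrow> nat \<Rightarrow> (nat \<times> nat) falg" where
  "column_relation N q a b =
    (\<Sum>d<N. \<Sum>c<N. rscalar (metric_entry N q c d) * (gen (c, a) * gen (d, b)))
    - rscalar (metric_entry N q a b)"

lemma metric_relations_eq:
  "metric_relations N q = {row_relation N q a b | a b. a < N \<and> b < N}
    \<union> {column_relation N q a b | a b. a < N \<and> b < N}"
proof -
  have dims: "dim_row (metric N q) = N" "dim_col (metric N q) = N"
    by (simp_all add: metric_def)
  have 1: "(T_mat N * num_mat (metric N q) * transpose_mat (T_mat N) - num_mat (metric N q)) $$ (a, b)
      = row_relation N q a b" if "a < N" "b < N" for a b
    using that
    by (simp add: T_mat_def row_relation_def scalar_prod_def atLeast0LessThan dims metric_index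
        sum_distrib_right scalar_normalize mult.assoc del: of_real_0 cong: sum.cong_simp)
  have 2: "(transpose_mat (T_mat N) * num_mat (metric N q) * T_mat N - num_mat (metric N q)) $$ (a, b)
      = column_relation N q a b" if "a < N" "b < N" for a b
    using that
    by (simp add: T_mat_def column_relation_def scalar_prod_def atLeast0LessThan dims metric_index
        sum_distrib_right scalar_normalize mult.assoc del: of_real_0 cong: sum.cong_simp)
  show ?thesis
    unfolding metric_relations_def Let_def
    by (intro arg_cong2[where f = "(\<union>)"] Collect_cong iff_exI) (use 1 2 in auto)
qed

lemma keys_rscalar_mult:
  "submonoid_add S \<Longrightarrow> Poly_Mapping.keys p \<subseteq> S \<Longrightarrow> Poly_Mapping.keys (scalar c * p) \<subseteq> S"
  by (intro keys_mult_subset keys_scalar_subset)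

abbreviation T_words :: "nat \<Rightarrow> (nat \<times> nat) fword set" where
  "T_words N \<equiv> words (T_index N)"

lemma T_index_iff: "(a, b) \<in> T_index N \<longleftrightarrow> a < N \<and> b < N"
  by (auto simp: T_index_def)

lemma relations_closed:
  "RTT_relations N q \<union> metric_relations N q \<subseteq> {p. Poly_Mapping.keys p \<subseteq> T_words N}"
proof -
  note intros = keys_diff_subset keys_sum_subset keys_rscalar_mult
    keys_mult_subset[OF submonoid_words] submonoid_words keys_scalar_subset
  have "Poly_Mapping.keys (rtt_relation N q a b c d) \<subseteq> T_words N"
    if "a < N" "b < N" "c < N" "d < N" for a b c d
    unfolding rtt_relation_def using that by (intro intros) (auto simp: gen_keys T_index_iff)
  moreover have "Poly_Mapping.keys (row_relation N q a b) \<subseteq> T_words N"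
    if "a < N" "b < N" for a b
    unfolding row_relation_def using that by (intro intros) (auto simp: gen_keys T_index_iff)
  moreover have "Poly_Mapping.keys (column_relation N q a b) \<subseteq> T_words N"
    if "a < N" "b < N" for a b
    unfolding column_relation_def using that by (intro intros) (auto simp: gen_keys T_index_iff)
  ultimately show ?thesis
    unfolding RTT_relations_eq metric_relations_eq
    by (intro Un_least subsetI; elim CollectE exE conjE; simp)
qed

lemma ideal_O_ideal: "ideal (O_ideal N q) (monoid_algebra (T_words N))"
  and relations_O_ideal: "RTT_relations N q \<union> metric_relations N q \<subseteq> O_ideal N q"
  unfolding O_ideal_def free_algebra_def
  by (rule ideal_Idl[OF submonoid_words relations_closed])+

lemma SO_gens_closed:
  "RTT_relations N q \<union> metric_relations N q \<union> {d - 1 | d. represents_qdet N q d}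
    \<subseteq> {p. Poly_Mapping.keys p \<subseteq> T_words N}"
proof -
  have "Poly_Mapping.keys (d - 1) \<subseteq> T_words N" if "represents_qdet N q d" for d
    using that keys_scalar_subset[OF submonoid_words, of 1 "T_index N"]
    by (intro keys_diff_subset) (auto simp: represents_qdet_def free_algebra_def)
  then have "{d - 1 | d. represents_qdet N q d} \<subseteq> {p. Poly_Mapping.keys p \<subseteq> T_words N}"
    by (intro subsetI; elim CollectE exE conjE; simp)
  with relations_closed show ?thesis
    by (rule Un_least)
qed

lemma ideal_SO_ideal: "ideal (SO_ideal N q) (monoid_algebra (T_words N))"
  and SO_gens: "RTT_relations N q \<union> metric_relations N q \<union> {d - 1 | d. represents_qdet N q d}
    \<subseteq> SO_ideal N q"
  unfolding SO_ideal_def free_algebra_def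
  by (rule ideal_Idl[OF submonoid_words SO_gens_closed])+

section \<open>Relations of the quantum exterior algebra\<close>

definition ext_coeff :: "nat \<Rightarrow> real \<Rightarrow> nat \<Rightarrow> nat \<Rightarrow> nat \<Rightarrow> nat \<Rightarrow> complex" where
  "ext_coeff N q a b c d = id_entry a b c d - P_anti N q a b c d"

definition ext_relation :: "nat \<Rightarrow> real \<Rightarrow> nat \<Rightarrow> nat \<Rightarrow> nat falg" where
  "ext_relation N q a b = (\<Sum>c<N. \<Sum>d<N. scalar (ext_coeff N q a b c d) * (gen c * gen d))"

lemma ext_relations_closed:
  "{ext_relation N q a b | a b. a < N \<and> b < N} \<subseteq> {p. Poly_Mapping.keys p \<subseteq> words {..<N}}"
proof -
  have "Poly_Mapping.keys (ext_relation N q a b) \<subseteq> words {..<N}" for a b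
    unfolding ext_relation_def
    by (intro keys_sum_subset keys_rscalar_mult keys_mult_subset submonoid_words)
      (auto simp: gen_keys)
  then show ?thesis
    by (intro subsetI; elim CollectE exE conjE; simp)
qed

lemma ext_ideal_eq:
  "ext_ideal N q = Idl\<^bsub>monoid_algebra (words {..<N})\<^esub> {ext_relation N q a b | a b. a < N \<and> b < N}"
  by (simp add: ext_ideal_def free_algebra_def ext_relation_def ext_coeff_def mult.assoc)

lemma ideal_ext_ideal: "ideal (ext_ideal N q) (monoid_algebra (words {..<N}))"
  and ext_relations_ideal: "{ext_relation N q a b | a b. a < N \<and> b < N} \<subseteq> ext_ideal N q"
  unfolding ext_ideal_eq by (rule ideal_Idl[OF submonoid_words ext_relations_closed])+

text \<open>For real \<open>q\<close> the matrices R and C are real, so an antilinear map leaves the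
  coefficients of the exterior relations alone.\<close>

lemma cnj_ext_coeff:
  assumes "a < N" "b < N" "c < N" "d < N"
  shows "cnj (ext_coeff N q a b c d) = ext_coeff N q a b c d"
proof -
  have "cnj (metric N q $$ (e, f)) = metric N q $$ (e, f)" if "e < N" "f < N" for e f
    using that by (simp add: metric_index)
  then show ?thesis
    using assms
    by (simp add: ext_coeff_def P_anti_def P_zero_def R_hat_def id_entry_def)
qed

definition homogeneous :: "nat \<Rightarrow> 'x falg \<Rightarrow> bool" where
  "homogeneous k p \<longleftrightarrow> (\<forall>w\<in>Poly_Mapping.keys p. length (letters w) = k)"

text \<open>What the relations see of the matrix U. The assumptions \<open>metric_tau\<close> and
  \<open>R_tau\<close> express invariance under \<open>\<tau>\<close> combined with the exchange of
  factors; \<open>metric_weight\<close> and \<open>R_weight\<close> say that weights balance along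
  nonzero entries, so that a whole relation is multiplied by one factor.\<close>

locale monomial_twist =
  fixes N :: nat and q :: real and \<tau> :: "nat \<Rightarrow> nat" and u :: "nat \<Rightarrow> real"
    and f :: "nat \<times> nat \<Rightarrow> (nat \<times> nat) falg"
  assumes tau_less: "a < N \<Longrightarrow> \<tau> a < N"
    and tau_tau: "a < N \<Longrightarrow> \<tau> (\<tau> a) = a"
    and u_tau: "a < N \<Longrightarrow> u a * u (\<tau> a) = 1"
    and metric_tau: "a < N \<Longrightarrow> b < N \<Longrightarrow>
      metric_entry N q (\<tau> b) (\<tau> a) = metric_entry N q a b"
    and metric_weight: "a < N \<Longrightarrow> b < N \<Longrightarrow> metric_entry N q a b \<noteq> 0 \<Longrightarrow> u a * u b = 1"
    and R_tau: "a < N \<Longrightarrow> b < N \<Longrightarrow> c < N \<Longrightarrow> d < N \<Longrightarrow>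
      R_entry N q (\<tau> b) (\<tau> a) (\<tau> d) (\<tau> c) = R_entry N q a b c d"
    and R_weight: "a < N \<Longrightarrow> b < N \<Longrightarrow> c < N \<Longrightarrow> d < N \<Longrightarrow>
      R_entry N q a b c d \<noteq> 0 \<Longrightarrow> u c * u d = u a * u b"
    and f_eq: "a < N \<Longrightarrow> b < N \<Longrightarrow> f (a, b) = rscalar (u a / u b) * gen (\<tau> a, \<tau> b)"
begin

definition g :: "nat \<Rightarrow> nat falg" where
  "g a = rscalar (u a) * gen (\<tau> a)"

lemma u_nz: "a < N \<Longrightarrow> u a \<noteq> 0"
  using u_tau[of a] by auto

lemma u_tau_eq: "a < N \<Longrightarrow> u (\<tau> a) = 1 / u a"
  using u_tau[of a] u_nz[of a] by (simp add: field_simps)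

lemma bij_tau: "bij_betw \<tau> {..<N} {..<N}"
  by (rule bij_betw_byWitness[where f' = \<tau>]) (auto simp: tau_tau tau_less)

lemma tau_inj: "a < N \<Longrightarrow> b < N \<Longrightarrow> \<tau> a = \<tau> b \<longleftrightarrow> a = b"
  using tau_tau by metis

lemma sum_tau: "(\<Sum>e<N. h (\<tau> e)) = (\<Sum>e<N. h e)"
  by (rule sum.reindex_bij_betw[OF bij_tau])

text \<open>Besides applying \<open>\<tau>\<close>, the substitution exchanges the two summation
  indices; this undoes the reversal of a product of two generators.\<close>

lemma sum_tau2: "(\<Sum>e<N. \<Sum>k<N. h (\<tau> k) (\<tau> e)) = (\<Sum>e<N. \<Sum>k<N. h e k)"
proof -
  have "(\<Sum>e<N. \<Sum>k<N. h (\<tau> k) (\<tau> e)) = (\<Sum>e<N. \<Sum>k<N. h k (\<tau> e))"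
    by (intro sum.cong refl sum_tau)
  also have "\<dots> = (\<Sum>e<N. \<Sum>k<N. h k e)"
    by (rule sum_tau[of "\<lambda>e. \<Sum>k<N. h k e"])
  also have "\<dots> = (\<Sum>e<N. \<Sum>k<N. h e k)"
    by (rule sum.swap)
  finally show ?thesis .
qed

lemma f_closed:
  assumes "x \<in> T_index N"
  shows "Poly_Mapping.keys (f x) \<subseteq> T_words N"
proof -
  obtain a b where "x = (a, b)" "a < N" "b < N"
    using assms by (auto simp: T_index_def)
  then show ?thesis
    by (simp add: f_eq keys_rscalar_mult submonoid_words gen_keys T_index_iff tau_less)
qed

lemma g_closed: "a \<in> {..<N} \<Longrightarrow> Poly_Mapping.keys (g a) \<subseteq> words {..<N}"
  unfolding g_def by (intro keys_rscalar_mult submonoid_words) (simp add: gen_keys tau_less)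

lemma f_involution:
  assumes "x \<in> T_index N"
  shows "anti_extend f (f x) = gen x"
proof -
  obtain a b where x: "x = (a, b)" "a < N" "b < N"
    using assms by (auto simp: T_index_def)
  then have "u a / u b * (u (\<tau> a) / u (\<tau> b)) = 1"
    by (simp add: u_tau_eq u_nz)
  then have "complex_of_real (u a / u b) * complex_of_real (u (\<tau> a) / u (\<tau> b)) = 1"
    by (simp only: of_real_mult[symmetric] of_real_1)
  with x show ?thesis
    by (simp add: f_eq tau_less tau_tau anti_extend_mult anti_extend_scalar anti_extend_gen
        scalar_normalize mult.assoc mult.commute)
qed

lemma g_involution:
  assumes "a \<in> {..<N}"
  shows "anti_extend g (g a) = gen a"
proof -
  have "complex_of_real (u a) * complex_of_real (u (\<tau> a)) = 1"
    using u_tau[of a] assms by (simp flip: of_real_mult)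
  with assms show ?thesis
    by (simp add: g_def tau_tau anti_extend_mult anti_extend_scalar anti_extend_gen
        scalar_normalize mult.assoc mult.commute)
qed

text \<open>In the first sum a term has weight u_e u_k / (u_c u_d). Where the entry of R is nonzero,
  \<open>R_weight\<close> turns this into u_a u_b / (u_c u_d), which no longer depends on the
  summation indices; where it is zero there is nothing to compare. The second sum produces the same
  factor.\<close>

lemma star_rtt:
  assumes "a < N" "b < N" "c < N" "d < N"
  shows "anti_extend f (rtt_relation N q a b c d) =
    rscalar (u a * u b / (u c * u d)) * rtt_relation N q (\<tau> b) (\<tau> a) (\<tau> d) (\<tau> c)"
proof -
  have 1: "R_entry N q a b e k * (u k / u d * (u e / u c))
      = u a * u b / (u c * u d) * R_entry N q (\<tau> b) (\<tau> a) (\<tau> k) (\<tau> e)" if "e < N" "k < N" for e k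
  proof (cases "R_entry N q a b e k = 0")
    case False
    have "R_entry N q a b e k * (u k / u d * (u e / u c))
      = (u e * u k) / (u c * u d) * R_entry N q a b e k"
      by (simp add: mult_ac)
    then show ?thesis
      using R_weight[OF assms(1,2) that False] R_tau[OF assms(1,2) that] by simp
  qed (use R_tau[OF assms(1,2) that] in simp)
  have 2: "R_entry N q e k c d * (u a / u e * (u b / u k))
      = u a * u b / (u c * u d) * R_entry N q (\<tau> k) (\<tau> e) (\<tau> d) (\<tau> c)" if "e < N" "k < N" for e k
  proof (cases "R_entry N q e k c d = 0")
    case False
    have "R_entry N q e k c d * (u a / u e * (u b / u k))
      = u a * u b / (u e * u k) * R_entry N q e k c d"
      by (simp add: mult_ac)
    then show ?thesis
      using R_weight[OF that assms(3,4) False] R_tau[OF that assms(3,4)] by simp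
  qed (use R_tau[OF that assms(3,4)] in simp)
  let ?\<kappa> = "u a * u b / (u c * u d)"
  have A: "anti_extend f (\<Sum>e<N. \<Sum>k<N. rscalar (R_entry N q a b e k) * (gen (e, c) * gen (k, d)))
    = rscalar ?\<kappa> * (\<Sum>e<N. \<Sum>k<N. rscalar (R_entry N q (\<tau> b) (\<tau> a) e k) * (gen (e, \<tau> d) * gen (k, \<tau> c)))"
  proof -
    have "anti_extend f (\<Sum>e<N. \<Sum>k<N. rscalar (R_entry N q a b e k) * (gen (e, c) * gen (k, d)))
      = (\<Sum>e<N. \<Sum>k<N. rscalar (R_entry N q a b e k * (u k / u d * (u e / u c)))
          * (gen (\<tau> k, \<tau> d) * gen (\<tau> e, \<tau> c)))"
      unfolding anti_extend_sum
      by (intro sum.cong refl)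
        (simp add: anti_extend_mult anti_extend_scalar anti_extend_gen f_eq assms scalar_normalize
          mult.assoc mult.commute mult.left_commute)
    also have "\<dots> = (\<Sum>e<N. \<Sum>k<N. rscalar (?\<kappa> * R_entry N q (\<tau> b) (\<tau> a) (\<tau> k) (\<tau> e))
          * (gen (\<tau> k, \<tau> d) * gen (\<tau> e, \<tau> c)))"
      by (intro sum.cong refl) (simp only: 1 lessThan_iff)
    also have "\<dots> = (\<Sum>e<N. \<Sum>k<N. rscalar (?\<kappa> * R_entry N q (\<tau> b) (\<tau> a) e k)
          * (gen (e, \<tau> d) * gen (k, \<tau> c)))"
      by (rule sum_tau2)
    finally show ?thesis
      by (simp add: sum_distrib_left scalar_normalize)
  qed
  have B: "anti_extend f (\<Sum>e<N. \<Sum>k<N. rscalar (R_entry N q e k c d) * (gen (b, k) * gen (a, e)))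
    = rscalar ?\<kappa> * (\<Sum>e<N. \<Sum>k<N. rscalar (R_entry N q e k (\<tau> d) (\<tau> c)) * (gen (\<tau> a, k) * gen (\<tau> b, e)))"
  proof -
    have "anti_extend f (\<Sum>e<N. \<Sum>k<N. rscalar (R_entry N q e k c d) * (gen (b, k) * gen (a, e)))
      = (\<Sum>e<N. \<Sum>k<N. rscalar (R_entry N q e k c d * (u a / u e * (u b / u k)))
          * (gen (\<tau> a, \<tau> e) * gen (\<tau> b, \<tau> k)))"
      unfolding anti_extend_sum
      by (intro sum.cong refl)
        (simp add: anti_extend_mult anti_extend_scalar anti_extend_gen f_eq assms scalar_normalize
          mult.assoc mult.commute mult.left_commute)
    also have "\<dots> = (\<Sum>e<N. \<Sum>k<N. rscalar (?\<kappa> * R_entry N q (\<tau> k) (\<tau> e) (\<tau> d) (\<tau> c))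
          * (gen (\<tau> a, \<tau> e) * gen (\<tau> b, \<tau> k)))"
      by (intro sum.cong refl) (simp only: 2 lessThan_iff)
    also have "\<dots> = (\<Sum>e<N. \<Sum>k<N. rscalar (?\<kappa> * R_entry N q e k (\<tau> d) (\<tau> c))
          * (gen (\<tau> a, k) * gen (\<tau> b, e)))"
      by (rule sum_tau2)
    finally show ?thesis
      by (simp add: sum_distrib_left scalar_normalize)
  qed
  show ?thesis
    unfolding rtt_relation_def anti_extend_diff A B by (simp add: right_diff_distrib)
qed

end

section \<open>Degrees of words, and the counit on the defining relations\<close>

lemma homogeneous_scalar: "homogeneous 0 (scalar c)"
  using keys_scalar[of c] by (auto simp: homogeneous_def zero_fword_def)

lemma homogeneous_gen: "homogeneous 1 (gen x)"
  by (simp add: homogeneous_def gen_def)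

lemma homogeneous_mult:
  assumes "homogeneous j p" "homogeneous k r"
  shows "homogeneous (j + k) (p * r)"
  unfolding homogeneous_def
proof
  fix w assume "w \<in> Poly_Mapping.keys (p * r)"
  then obtain v v' where "w = v + v'" "v \<in> Poly_Mapping.keys p" "v' \<in> Poly_Mapping.keys r"
    using Poly_Mapping.keys_mult[of p r] by blast
  then show "length (letters w) = j + k"
    using assms by (simp add: homogeneous_def plus_fword_def)
qed

lemma homogeneous_sum:
  assumes "\<And>x. x \<in> A \<Longrightarrow> homogeneous k (h x)"
  shows "homogeneous k (sum h A)"
  using Poly_Mapping.keys_sum[of h A] assms unfolding homogeneous_def by blast

lemma homogeneous_anti_extend:
  assumes h: "\<And>x. x \<in> X \<Longrightarrow> homogeneous 1 (h x)"
    and p: "homogeneous k p" "Poly_Mapping.keys p \<subseteq> words X"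
  shows "homogeneous k (anti_extend h p)"
proof -
  have word: "set xs \<subseteq> X \<Longrightarrow> homogeneous (length xs) (prod_list (rev (map h xs)))" for xs
  proof (induction xs)
    case Nil
    then show ?case using homogeneous_scalar[of 1] by simp
  next
    case (Cons x xs)
    then show ?case
      using homogeneous_mult[of "length xs" "prod_list (rev (map h xs))" 1 "h x"] h by simp
  qed
  show ?thesis
    unfolding anti_extend_def
  proof (rule homogeneous_sum)
    fix w assume w: "w \<in> Poly_Mapping.keys p"
    then have "set (letters w) \<subseteq> X" "length (letters w) = k"
      using p by (auto simp: homogeneous_def words_def)
    then show "homogeneous k (scalar (cnj (Poly_Mapping.lookup p w)) *
        prod_list (rev (map h (letters w))))"
      using homogeneous_mult[OF homogeneous_scalar word] by fastforce
  qed
qed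

lemma represents_qdet_iff:
  "represents_qdet N q d \<longleftrightarrow>
    Poly_Mapping.keys d \<subseteq> T_words N \<and>
    comult_free N d - d \<otimes>\<^sub>f d
      \<in> tensor_ideal (T_index N) (O_ideal N q) (T_index N) (O_ideal N q) \<and>
    counit_free d = 1 \<and>
    (\<forall>\<omega>. Poly_Mapping.keys \<omega> \<subseteq> words {..<N} \<longrightarrow> homogeneous N \<omega> \<longrightarrow>
      coaction_free N \<omega> - d \<otimes>\<^sub>f \<omega>
        \<in> tensor_ideal (T_index N) (O_ideal N q) {..<N} (ext_ideal N q))"
  by (auto simp: represents_qdet_def homogeneous_def free_algebra_def)

lemma counit_free_simps:
  "counit_free (scalar c) = c"
  "counit_free (gen (a, b)) = (if a = b then 1 else 0)"
  "counit_free (p + r) = counit_free p + counit_free r"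
  "counit_free (p - r) = counit_free p - counit_free r"
  "counit_free (p * r) = counit_free p * counit_free r"
  "counit_free (sum h A) = (\<Sum>x\<in>A. counit_free (h x))"
  by (simp_all add: counit_free_def id_emb.hom_extend_scalar id_emb.hom_extend_gen
      id_emb.hom_extend_add id_emb.hom_extend_diff id_emb.hom_extend_mult id_emb.hom_extend_sum)

text \<open>The counit evaluates T at the identity matrix, where the relations read R = R and C =
  C.\<close>

lemma counit_free_relations:
  assumes "p \<in> RTT_relations N q \<union> metric_relations N q"
  shows "counit_free p = 0"
proof -
  have delta: "(\<Sum>x<N. \<Sum>y<N. h x y * ((if x = a then 1 else 0) * (if y = b then 1 else 0))) = h a b"
    if "a < N" "b < N" for h :: "nat \<Rightarrow> nat \<Rightarrow> complex" and a b
  proof -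
    have "(\<Sum>x<N. \<Sum>y<N. h x y * ((if x = a then 1 else 0) * (if y = b then 1 else 0)))
      = (\<Sum>x<N. \<Sum>y<N. if y = b then if x = a then h x y else 0 else 0)"
      by (intro sum.cong refl) simp
    also have "\<dots> = h a b"
      using that by (simp add: sum.delta)
    finally show ?thesis .
  qed
  \<comment> \<open>The same contraction with the two Kronecker factors commuted, respectively with
    their equations reversed, as they occur for the different relations.\<close>
  have delta': "(\<Sum>x<N. \<Sum>y<N. h x y * ((if y = b then 1 else 0) * (if x = a then 1 else 0))) = h a b"
    "(\<Sum>x<N. \<Sum>y<N. h x y * ((if b = y then 1 else 0) * (if a = x then 1 else 0))) = h a b"
    if "a < N" "b < N" for h :: "nat \<Rightarrow> nat \<Rightarrow> complex" and a b
    using delta[of a b h] that by (simp_all only: mult.commute eq_commute)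
  have "counit_free (rtt_relation N q a b c d) = 0" if "a < N" "b < N" "c < N" "d < N" for a b c d
    by (simp only: rtt_relation_def counit_free_simps diff_self delta[OF that(3,4)]
        delta'(2)[OF that(1,2), of "\<lambda>e f. of_real (R_entry N q e f c d)"])
  moreover have "counit_free (row_relation N q a b) = 0" if "a < N" "b < N" for a b
    by (simp only: row_relation_def counit_free_simps diff_self
        delta'(2)[OF that(2,1), of "\<lambda>d c. of_real (metric_entry N q c d)"])
  moreover have "counit_free (column_relation N q a b) = 0" if "a < N" "b < N" for a b
    by (simp only: column_relation_def counit_free_simps diff_self
        delta'(1)[OF that(2,1), of "\<lambda>d c. of_real (metric_entry N q c d)"])
  ultimately show ?thesis
    using assms unfolding RTT_relations_eq metric_relations_eq
    by (elim UnE CollectE exE conjE; simp)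
qed

text \<open>Makes the image of a coset under \<open>counit_free\<close> a singleton, as
  \<open>the_elem\<close> in \<open>counit\<close> demands. On the generators d - 1 it is the
  normalization of the counit contained in \<open>represents_qdet\<close>.\<close>

lemma counit_free_SO_ideal:
  assumes "p \<in> SO_ideal N q"
  shows "counit_free p = 0"
proof (rule Idl_induct[OF submonoid_words SO_gens_closed])
  show "p \<in> Idl\<^bsub>monoid_algebra (T_words N)\<^esub> (RTT_relations N q \<union> metric_relations N q \<union>
      {d - 1 | d. represents_qdet N q d})"
    using assms by (simp add: SO_ideal_def free_algebra_def)
  show "counit_free r = 0" if "r \<in> RTT_relations N q \<union> metric_relations N q \<union>
      {d - 1 | d. represents_qdet N q d}" for r
    using that
  proof
    assume "r \<in> {d - 1 | d. represents_qdet N q d}"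
    then show ?thesis
      using counit_free_simps(1)[of 1]
      by (auto simp: counit_free_simps represents_qdet_iff)
  qed (rule counit_free_relations)
qed (use counit_free_simps(1)[of 0] in \<open>simp_all add: counit_free_simps\<close>)

section \<open>Stability of the defining ideals and of the quantum determinant\<close>

context monomial_twist
begin

lemma star_row:
  assumes "a < N" "b < N"
  shows "anti_extend f (row_relation N q a b) =
    rscalar (u a * u b) * row_relation N q (\<tau> b) (\<tau> a)"
proof -
  have 1: "metric_entry N q c d * (u b / u d * (u a / u c))
      = u a * u b * metric_entry N q (\<tau> d) (\<tau> c)" if "c < N" "d < N" for c d
  proof (cases "metric_entry N q c d = 0")
    case False
    have "metric_entry N q c d * (u b / u d * (u a / u c))
      = u a * u b / (u c * u d) * metric_entry N q c d"
      by (simp add: mult_ac)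
    then show ?thesis
      by (simp only: metric_weight[OF that False] metric_tau[OF that] div_by_1)
  next
    case True
    then show ?thesis by (simp only: metric_tau[OF that] mult_zero_left mult_zero_right)
  qed
  have "anti_extend f (\<Sum>d<N. \<Sum>c<N. rscalar (metric_entry N q c d) * (gen (a, c) * gen (b, d)))
      = (\<Sum>d<N. \<Sum>c<N. rscalar (metric_entry N q c d * (u b / u d * (u a / u c)))
          * (gen (\<tau> b, \<tau> d) * gen (\<tau> a, \<tau> c)))"
    unfolding anti_extend_sum
    by (intro sum.cong refl)
      (simp add: anti_extend_mult anti_extend_scalar anti_extend_gen f_eq assms scalar_normalize
        mult.assoc mult.commute mult.left_commute)
  also have "\<dots> = (\<Sum>d<N. \<Sum>c<N. rscalar (u a * u b * metric_entry N q (\<tau> d) (\<tau> c))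
          * (gen (\<tau> b, \<tau> d) * gen (\<tau> a, \<tau> c)))"
    by (intro sum.cong refl) (simp only: 1 lessThan_iff)
  also have "\<dots> = (\<Sum>d<N. \<Sum>c<N. rscalar (u a * u b * metric_entry N q c d)
          * (gen (\<tau> b, c) * gen (\<tau> a, d)))"
    by (rule sum_tau2)
  finally have A: "anti_extend f
      (\<Sum>d<N. \<Sum>c<N. rscalar (metric_entry N q c d) * (gen (a, c) * gen (b, d)))
      = rscalar (u a * u b) * (\<Sum>d<N. \<Sum>c<N. rscalar (metric_entry N q c d)
          * (gen (\<tau> b, c) * gen (\<tau> a, d)))"
    by (simp only: sum_distrib_left scalar_normalize of_real_mult)
  \<comment> \<open>The constant term contains no generators that could supply a weight. Where it is
    nonzero, \<open>metric_weight\<close> says that the required factor is 1.\<close>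
  have B: "metric_entry N q a b = u a * u b * metric_entry N q (\<tau> b) (\<tau> a)"
    using metric_weight[OF assms] metric_tau[OF assms]
    by (cases "metric_entry N q a b = 0") (simp_all only: mult_zero_right mult_1 not_False_eq_True)
  have "anti_extend f (row_relation N q a b) =
      rscalar (u a * u b) * (\<Sum>d<N. \<Sum>c<N. rscalar (metric_entry N q c d)
          * (gen (\<tau> b, c) * gen (\<tau> a, d))) - rscalar (metric_entry N q a b)"
    by (simp only: row_relation_def anti_extend_diff A anti_extend_scalar complex_cnj_complex_of_real)
  then show ?thesis
    by (subst (asm) B)
      (simp only: row_relation_def right_diff_distrib of_real_mult scalar_mult)
qed

text \<open>Here the free indices are lower indices of T, whose weights stand in the denominator;
  hence the inverse of the factor in \<open>star_row\<close>.\<close>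

lemma star_column:
  assumes "a < N" "b < N"
  shows "anti_extend f (column_relation N q a b) =
    rscalar (1 / (u a * u b)) * column_relation N q (\<tau> b) (\<tau> a)"
proof -
  have 1: "metric_entry N q c d * (u d / u b * (u c / u a))
      = 1 / (u a * u b) * metric_entry N q (\<tau> d) (\<tau> c)" if "c < N" "d < N" for c d
  proof (cases "metric_entry N q c d = 0")
    case False
    have "metric_entry N q c d * (u d / u b * (u c / u a))
      = u c * u d / (u a * u b) * metric_entry N q c d"
      by (simp add: mult_ac)
    then show ?thesis
      by (simp only: metric_weight[OF that False] metric_tau[OF that])
  next
    case True
    then show ?thesis by (simp only: metric_tau[OF that] mult_zero_left mult_zero_right)
  qed
  have "anti_extend f (\<Sum>d<N. \<Sum>c<N. rscalar (metric_entry N q c d) * (gen (c, a) * gen (d, b)))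
      = (\<Sum>d<N. \<Sum>c<N. rscalar (metric_entry N q c d * (u d / u b * (u c / u a)))
          * (gen (\<tau> d, \<tau> b) * gen (\<tau> c, \<tau> a)))"
    unfolding anti_extend_sum
    by (intro sum.cong refl)
      (simp add: anti_extend_mult anti_extend_scalar anti_extend_gen f_eq assms scalar_normalize
        mult.assoc mult.commute mult.left_commute)
  also have "\<dots> = (\<Sum>d<N. \<Sum>c<N. rscalar (1 / (u a * u b) * metric_entry N q (\<tau> d) (\<tau> c))
          * (gen (\<tau> d, \<tau> b) * gen (\<tau> c, \<tau> a)))"
    by (intro sum.cong refl) (simp only: 1 lessThan_iff)
  also have "\<dots> = (\<Sum>d<N. \<Sum>c<N. rscalar (1 / (u a * u b) * metric_entry N q c d)
          * (gen (c, \<tau> b) * gen (d, \<tau> a)))"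
    by (rule sum_tau2)
  finally have A: "anti_extend f
      (\<Sum>d<N. \<Sum>c<N. rscalar (metric_entry N q c d) * (gen (c, a) * gen (d, b)))
      = rscalar (1 / (u a * u b)) * (\<Sum>d<N. \<Sum>c<N. rscalar (metric_entry N q c d)
          * (gen (c, \<tau> b) * gen (d, \<tau> a)))"
    by (simp only: sum_distrib_left scalar_normalize of_real_mult)
  have B: "metric_entry N q a b = 1 / (u a * u b) * metric_entry N q (\<tau> b) (\<tau> a)"
    using metric_weight[OF assms] metric_tau[OF assms]
    by (cases "metric_entry N q a b = 0")
      (simp_all only: mult_zero_right mult_1 not_False_eq_True div_by_1)
  have "anti_extend f (column_relation N q a b) =
      rscalar (1 / (u a * u b)) * (\<Sum>d<N. \<Sum>c<N. rscalar (metric_entry N q c d)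
          * (gen (c, \<tau> b) * gen (d, \<tau> a))) - rscalar (metric_entry N q a b)"
    by (simp only: column_relation_def anti_extend_diff A anti_extend_scalar
        complex_cnj_complex_of_real)
  then show ?thesis
    by (subst (asm) B)
      (simp only: column_relation_def right_diff_distrib of_real_mult scalar_mult)
qed

lemma ext_coeff_tau:
  assumes "a < N" "b < N" "c < N" "d < N"
  shows "ext_coeff N q (\<tau> b) (\<tau> a) (\<tau> d) (\<tau> c) = ext_coeff N q a b c d"
  using R_tau[of b a c d] metric_tau[of a b] metric_tau[of c d] assms
  by (simp add: ext_coeff_def P_anti_def P_zero_def R_hat_def id_entry_def metric_index tau_inj
      tau_less conj_commute del: of_real_0)

text \<open>A nonzero coefficient comes from at least one of three sources: the identity keeps the
  indices, the braid matrix obeys \<open>R_weight\<close>, and the rank one projector P_0 forces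
  both products of weights to be 1.\<close>

lemma ext_coeff_weight:
  assumes "a < N" "b < N" "c < N" "d < N" "ext_coeff N q a b c d \<noteq> 0"
  shows "u c * u d = u a * u b"
proof (cases "a = c \<and> b = d")
  case False
  show ?thesis
  proof (cases "R_entry N q b a c d = 0")
    case True
    with False assms(5) have "P_zero N q a b c d \<noteq> 0"
      by (auto simp: ext_coeff_def P_anti_def id_entry_def R_hat_def)
    then have "metric_entry N q a b \<noteq> 0" "metric_entry N q c d \<noteq> 0"
      using assms by (auto simp: P_zero_def metric_index simp del: of_real_0)
    then show ?thesis
      using metric_weight assms by metis
  next
    case R: False
    then show ?thesis
      using R_weight[of b a c d] assms by (simp add: mult.commute)
  qed
qed simp

lemma star_ext:
  assumes "a < N" "b < N"
  shows "anti_extend g (ext_relation N q a b) =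
    rscalar (u a * u b) * ext_relation N q (\<tau> b) (\<tau> a)"
proof -
  have 1: "ext_coeff N q a b c d * (of_real (u d) * of_real (u c))
      = of_real (u a * u b) * ext_coeff N q (\<tau> b) (\<tau> a) (\<tau> d) (\<tau> c)" if "c < N" "d < N" for c d
  proof (cases "ext_coeff N q a b c d = 0")
    case False
    have "ext_coeff N q a b c d * (of_real (u d) * of_real (u c))
      = of_real (u c * u d) * ext_coeff N q a b c d"
      by (simp add: mult_ac)
    then show ?thesis
      by (simp only: ext_coeff_weight[OF assms that False] ext_coeff_tau[OF assms that])
  qed (simp add: ext_coeff_tau[OF assms that])
  have "anti_extend g (ext_relation N q a b)
      = (\<Sum>c<N. \<Sum>d<N. scalar (ext_coeff N q a b c d * (of_real (u d) * of_real (u c)))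
          * (gen (\<tau> d) * gen (\<tau> c)))"
    unfolding anti_extend_sum ext_relation_def
    by (intro sum.cong refl)
      (simp add: anti_extend_mult anti_extend_scalar anti_extend_gen g_def assms cnj_ext_coeff
        scalar_normalize mult.assoc mult.commute mult.left_commute)
  also have "\<dots> = (\<Sum>c<N. \<Sum>d<N.
      scalar (of_real (u a * u b) * ext_coeff N q (\<tau> b) (\<tau> a) (\<tau> d) (\<tau> c))
          * (gen (\<tau> d) * gen (\<tau> c)))"
    by (intro sum.cong refl) (simp only: 1 lessThan_iff)
  also have "\<dots> = (\<Sum>c<N. \<Sum>d<N. scalar (of_real (u a * u b) * ext_coeff N q (\<tau> b) (\<tau> a) c d)
          * (gen c * gen d))"
    by (rule sum_tau2)
  finally show ?thesis
    by (simp only: ext_relation_def sum_distrib_left scalar_normalize)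
qed

text \<open>Stated for an arbitrary ideal containing the relations, since it is applied both before
  and after the determinant condition is imposed.\<close>

lemma star_relations:
  assumes I: "ideal I (monoid_algebra (T_words N))"
    and sub: "RTT_relations N q \<union> metric_relations N q \<subseteq> I"
    and p: "p \<in> RTT_relations N q \<union> metric_relations N q"
  shows "anti_extend f p \<in> I"
proof -
  note l = ideal_monoid_algebra(6)[OF submonoid_words I _ keys_scalar_subset[OF submonoid_words]]
  have rtt: "rtt_relation N q a b c d \<in> I" if "a < N" "b < N" "c < N" "d < N" for a b c d
    using sub that unfolding RTT_relations_eq by blast
  have met: "row_relation N q a b \<in> I" "column_relation N q a b \<in> I" if "a < N" "b < N" for a b
    using sub that unfolding metric_relations_eq by blast+
  from p consider a b c d where "a < N" "b < N" "c < N" "d < N" "p = rtt_relation N q a b c d"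
    | a b where "a < N" "b < N" "p = row_relation N q a b"
    | a b where "a < N" "b < N" "p = column_relation N q a b"
    unfolding RTT_relations_eq metric_relations_eq by blast
  then show ?thesis
    by cases (simp_all only: star_rtt star_row star_column l rtt met tau_less)
qed

lemma star_O_ideal:
  assumes "p \<in> O_ideal N q"
  shows "anti_extend f p \<in> O_ideal N q"
  by (rule Idl_antihom[where h = "anti_extend f" and x = p, OF submonoid_words relations_closed
        submonoid_words ideal_O_ideal anti_extend_closed[OF f_closed] anti_extend_add
        anti_extend_mult star_relations[OF ideal_O_ideal relations_O_ideal]])
    (use assms in \<open>simp_all add: O_ideal_def free_algebra_def\<close>)

lemma star_ext_ideal:
  assumes "p \<in> ext_ideal N q"
  shows "anti_extend g p \<in> ext_ideal N q"
proof (rule Idl_antihom[where h = "anti_extend g" and x = p, OF submonoid_words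
      ext_relations_closed submonoid_words ideal_ext_ideal anti_extend_closed[OF g_closed]
      anti_extend_add anti_extend_mult])
  fix r assume "r \<in> {ext_relation N q a b |a b. a < N \<and> b < N}"
  then obtain a b where r: "r = ext_relation N q a b" "a < N" "b < N" by blast
  then have "ext_relation N q (\<tau> b) (\<tau> a) \<in> ext_ideal N q"
    using ext_relations_ideal tau_less by blast
  then show "anti_extend g r \<in> ext_ideal N q"
    using ideal_monoid_algebra(6)[OF submonoid_words ideal_ext_ideal _
      keys_scalar_subset[OF submonoid_words]] r by (simp only: star_ext)
qed (use assms in \<open>simp_all add: ext_ideal_eq\<close>)

text \<open>The weight of the contracted index cancels, (u_a / u_c)(u_c / u_b) = u_a / u_b, and
  \<open>\<tau>\<close> merely permutes the summation.\<close>

lemma comult_star: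
  assumes "Poly_Mapping.keys p \<subseteq> T_words N"
  shows "comult_free N (anti_extend f p) = anti_tensor f f (comult_free N p)"
  unfolding comult_free_def
proof (rule hom_extend_anti[OF _ assms])
  fix x assume "x \<in> T_index N"
  then obtain a b where x: "x = (a, b)" "a < N" "b < N" by (auto simp: T_index_def)
  have "anti_tensor f f (\<Sum>c<N. gen (a, c) \<otimes>\<^sub>f gen (c, b))
    = (\<Sum>c<N. rscalar (u a / u b) * (gen (\<tau> a, \<tau> c) \<otimes>\<^sub>f gen (\<tau> c, \<tau> b)))"
    unfolding anti_tensor_sum
  proof (intro sum.cong refl)
    fix c assume "c \<in> {..<N}"
    moreover from this have "u a / u c * (u c / u b) = u a / u b"
      using u_nz[of c] by simp
    then have "complex_of_real (u a / u c) * complex_of_real (u c / u b)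
      = complex_of_real (u a / u b)"
      by (simp only: of_real_mult[symmetric])
    ultimately show "anti_tensor f f (gen (a, c) \<otimes>\<^sub>f gen (c, b))
      = rscalar (u a / u b) * (gen (\<tau> a, \<tau> c) \<otimes>\<^sub>f gen (\<tau> c, \<tau> b))"
      using x by (simp only: anti_tensor_tensor anti_extend_gen f_eq tensor_scalar_mult lessThan_iff)
  qed
  also have "\<dots> = rscalar (u a / u b) * (\<Sum>c<N. gen (\<tau> a, c) \<otimes>\<^sub>f gen (c, \<tau> b))"
    unfolding sum_distrib_left
    by (rule sum_tau[of "\<lambda>c. rscalar (u a / u b) * (gen (\<tau> a, c) \<otimes>\<^sub>f gen (c, \<tau> b))"])
  finally show "hom_extend scalar (\<lambda>(a, b). \<Sum>c<N. gen (a, c) \<otimes>\<^sub>f gen (c, b)) (f x)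
    = anti_tensor f f (case x of (a, b) \<Rightarrow> \<Sum>c<N. gen (a, c) \<otimes>\<^sub>f gen (c, b))"
    using x by (simp add: f_eq scalar_emb.hom_extend_mult scalar_emb.hom_extend_scalar
        scalar_emb.hom_extend_gen)
qed

text \<open>The cancellation (u_a / u_b) u_b = u_a is what dictates the weights in
  \<open>g\<close>.\<close>

lemma coaction_star:
  assumes "Poly_Mapping.keys p \<subseteq> words {..<N}"
  shows "coaction_free N (anti_extend g p) = anti_tensor f g (coaction_free N p)"
  unfolding coaction_free_def
proof (rule hom_extend_anti[OF _ assms])
  fix a assume a: "a \<in> {..<N}"
  have "anti_tensor f g (\<Sum>b<N. gen (a, b) \<otimes>\<^sub>f gen b)
    = (\<Sum>b<N. rscalar (u a) * (gen (\<tau> a, \<tau> b) \<otimes>\<^sub>f gen (\<tau> b)))"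
    unfolding anti_tensor_sum
  proof (intro sum.cong refl)
    fix b assume "b \<in> {..<N}"
    moreover from this have "u a / u b * u b = u a"
      using u_nz[of b] by simp
    then have "complex_of_real (u a / u b) * complex_of_real (u b) = complex_of_real (u a)"
      by (simp only: of_real_mult[symmetric])
    ultimately show "anti_tensor f g (gen (a, b) \<otimes>\<^sub>f gen b)
      = rscalar (u a) * (gen (\<tau> a, \<tau> b) \<otimes>\<^sub>f gen (\<tau> b))"
      using a by (simp only: anti_tensor_tensor anti_extend_gen f_eq g_def tensor_scalar_mult
          lessThan_iff)
  qed
  also have "\<dots> = rscalar (u a) * (\<Sum>b<N. gen (\<tau> a, b) \<otimes>\<^sub>f gen b)"
    unfolding sum_distrib_left
    by (rule sum_tau[of "\<lambda>b. rscalar (u a) * (gen (\<tau> a, b) \<otimes>\<^sub>f gen b)"])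
  finally show "hom_extend scalar (\<lambda>a. \<Sum>b<N. gen (a, b) \<otimes>\<^sub>f gen b) (g a)
    = anti_tensor f g (\<Sum>b<N. gen (a, b) \<otimes>\<^sub>f gen b)"
    by (simp add: g_def scalar_emb.hom_extend_mult scalar_emb.hom_extend_scalar
        scalar_emb.hom_extend_gen)
qed

lemma counit_star:
  assumes "Poly_Mapping.keys p \<subseteq> T_words N"
  shows "counit_free (anti_extend f p) = cnj (counit_free p)"
  using assms
proof (induction p rule: free_algebra_induct)
  case (gen x)
  then obtain a b where x: "x = (a, b)" "a < N" "b < N" by (auto simp: T_index_def)
  then show ?case
    using u_nz[of a] u_nz[of b] by (simp add: anti_extend_gen f_eq counit_free_simps tau_inj)
qed (simp_all add: anti_extend_scalar anti_extend_add anti_extend_mult counit_free_simps)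

text \<open>All conditions are equations modulo ideals that the conjugations preserve. To test the
  conjugate of \<open>d\<close> on a form of degree N, the condition for \<open>d\<close> is applied
  to the conjugate form and then conjugated; since \<open>g\<close> is an involution, the original
  form returns.\<close>

lemma represents_qdet_star:
  assumes "represents_qdet N q d"
  shows "represents_qdet N q (anti_extend f d)"
proof -
  have d: "Poly_Mapping.keys d \<subseteq> T_words N"
    using assms by (simp add: represents_qdet_iff)
  note O = ideal_monoid_algebra(1)[OF submonoid_words ideal_O_ideal]
  note E = ideal_monoid_algebra(1)[OF submonoid_words ideal_ext_ideal]
  have O': "O_ideal N q \<subseteq> {p. Poly_Mapping.keys p \<subseteq> T_words N}"
    and E': "ext_ideal N q \<subseteq> {p. Poly_Mapping.keys p \<subseteq> words {..<N}}"
    using O E by blast+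
  show ?thesis
    unfolding represents_qdet_iff
  proof (intro conjI allI impI)
    show "Poly_Mapping.keys (anti_extend f d) \<subseteq> T_words N"
      using anti_extend_closed[OF f_closed d] .
    have "comult_free N (anti_extend f d) - anti_extend f d \<otimes>\<^sub>f anti_extend f d
      = anti_tensor f f (comult_free N d - d \<otimes>\<^sub>f d)"
      by (simp only: comult_star[OF d] anti_tensor_diff anti_tensor_tensor)
    then show "comult_free N (anti_extend f d) - anti_extend f d \<otimes>\<^sub>f anti_extend f d
      \<in> tensor_ideal (T_index N) (O_ideal N q) (T_index N) (O_ideal N q)"
      using anti_tensor_tensor_ideal[OF f_closed f_closed O' O' star_O_ideal star_O_ideal] assms
      by (simp add: represents_qdet_iff)
    show "counit_free (anti_extend f d) = 1"
      using assms counit_star[OF d] by (simp add: represents_qdet_iff)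
  next
    fix \<omega> :: "nat falg"
    assume \<omega>: "Poly_Mapping.keys \<omega> \<subseteq> words {..<N}" "homogeneous N \<omega>"
    let ?\<omega> = "anti_extend g \<omega>"
    have keys: "Poly_Mapping.keys ?\<omega> \<subseteq> words {..<N}"
      by (rule anti_extend_closed[OF g_closed \<omega>(1)])
    have "homogeneous 1 (g a)" for a
      using homogeneous_mult[OF homogeneous_scalar homogeneous_gen] by (simp add: g_def)
    then have "homogeneous N ?\<omega>"
      using homogeneous_anti_extend[of "{..<N}" g N \<omega>] \<omega> by blast
    then have "coaction_free N ?\<omega> - d \<otimes>\<^sub>f ?\<omega>
        \<in> tensor_ideal (T_index N) (O_ideal N q) {..<N} (ext_ideal N q)"
      using assms keys by (simp add: represents_qdet_iff)
    then have "anti_tensor f g (coaction_free N ?\<omega> - d \<otimes>\<^sub>f ?\<omega>)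
        \<in> tensor_ideal (T_index N) (O_ideal N q) {..<N} (ext_ideal N q)"
      by (rule anti_tensor_tensor_ideal[OF _ _ O' E', rotated -1])
        (simp_all add: f_closed g_closed star_O_ideal star_ext_ideal)
    moreover have "anti_tensor f g (coaction_free N ?\<omega> - d \<otimes>\<^sub>f ?\<omega>)
      = coaction_free N \<omega> - anti_extend f d \<otimes>\<^sub>f \<omega>"
      by (simp only: anti_tensor_diff anti_tensor_tensor coaction_star[OF keys, symmetric]
          anti_extend_involution[OF g_involution \<omega>(1)])
    ultimately show "coaction_free N \<omega> - anti_extend f d \<otimes>\<^sub>f \<omega>
        \<in> tensor_ideal (T_index N) (O_ideal N q) {..<N} (ext_ideal N q)"
      by simp
  qed
qed

lemma star_SO_ideal:
  assumes "p \<in> SO_ideal N q"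
  shows "anti_extend f p \<in> SO_ideal N q"
proof (rule Idl_antihom[where h = "anti_extend f" and x = p, OF submonoid_words SO_gens_closed
      submonoid_words ideal_SO_ideal anti_extend_closed[OF f_closed] anti_extend_add
      anti_extend_mult])
  fix r assume r: "r \<in> RTT_relations N q \<union> metric_relations N q
    \<union> {d - 1 | d. represents_qdet N q d}"
  then consider "r \<in> RTT_relations N q \<union> metric_relations N q"
    | d where "r = d - 1" "represents_qdet N q d" by blast
  then show "anti_extend f r \<in> SO_ideal N q"
  proof cases
    case 1
    then show ?thesis
      using star_relations[OF ideal_SO_ideal] SO_gens by blast
  next
    case 2
    then have "anti_extend f r = anti_extend f d - 1"
      by (simp only: anti_extend_diff anti_extend_one)
    then show ?thesis
      using represents_qdet_star[OF 2(2)] SO_gens by blast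
  qed
qed (use assms in \<open>simp_all add: SO_ideal_def free_algebra_def\<close>)

end

section \<open>Descent of the conjugation to the quantum group and its tensor square\<close>

context monomial_twist
begin

interpretation SO: anti_involution "T_words N" "SO_ideal N q" "anti_extend f"
proof (intro anti_involution.intro quotient_algebra.intro anti_involution_axioms.intro)
  show "submonoid_add (T_words N)" by (rule submonoid_words)
  show "ideal (SO_ideal N q) (monoid_algebra (T_words N))" by (rule ideal_SO_ideal)
qed (simp_all add: anti_extend_closed[OF f_closed] anti_extend_involution[OF f_involution]
    anti_extend_add anti_extend_mult anti_extend_scalar star_SO_ideal)

lemma SO_ideal_subset: "SO_ideal N q \<subseteq> {p. Poly_Mapping.keys p \<subseteq> T_words N}"
  using SO.ideal_simps(1) by blast

interpretation SO2: anti_involution "T_words N \<times> T_words N" "SO_ideal2 N q" "anti_tensor f f"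
proof (intro anti_involution.intro quotient_algebra.intro anti_involution_axioms.intro)
  show "submonoid_add (T_words N \<times> T_words N)"
    by (intro submonoid_Times submonoid_words)
  show "ideal (SO_ideal2 N q) (monoid_algebra (T_words N \<times> T_words N))"
    unfolding SO_ideal2_def by (rule tensor_ideal_ideal(1)[OF SO_ideal_subset SO_ideal_subset])
  fix p :: "(nat \<times> nat, nat \<times> nat) ftens"
  show "Poly_Mapping.keys p \<subseteq> T_words N \<times> T_words N \<Longrightarrow>
      Poly_Mapping.keys (anti_tensor f f p) \<subseteq> T_words N \<times> T_words N"
    by (rule anti_tensor_closed[OF f_closed f_closed])
  show "Poly_Mapping.keys p \<subseteq> T_words N \<times> T_words N \<Longrightarrow> anti_tensor f f (anti_tensor f f p) = p"
    by (rule anti_tensor_involution[OF f_involution f_involution])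
  show "p \<in> SO_ideal2 N q \<Longrightarrow> anti_tensor f f p \<in> SO_ideal2 N q"
    unfolding SO_ideal2_def
    using anti_tensor_tensor_ideal[OF f_closed f_closed SO_ideal_subset SO_ideal_subset
      star_SO_ideal star_SO_ideal] by blast
qed (simp_all add: anti_tensor_add anti_tensor_mult anti_tensor_scalar)

lemma SOq_eq: "SOq N q = SO.Q" "qclass N q p = SO.cls p"
  by (simp_all add: SOq_def qclass_def free_algebra_def)

lemma SOq2_eq: "SOq2 N q = SO2.Q" "qclass2 N q t = SO2.cls t"
  by (simp_all add: SOq2_def qclass2_def free_tensor_def)

lemma comult_free_closed:
  assumes "Poly_Mapping.keys p \<subseteq> T_words N"
  shows "Poly_Mapping.keys (comult_free N p) \<subseteq> T_words N \<times> T_words N"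
  unfolding comult_free_def
proof (rule hom_extend_closed[OF SO2.S _ assms])
  fix x assume "x \<in> T_index N"
  then obtain a b where x: "x = (a, b)" "a < N" "b < N" by (auto simp: T_index_def)
  have "Poly_Mapping.keys (\<Sum>c<N. gen (a, c) \<otimes>\<^sub>f gen (c, b)) \<subseteq> T_words N \<times> T_words N"
    by (intro keys_sum_subset tensor_closed) (simp_all add: gen_keys T_index_iff x)
  with x show "Poly_Mapping.keys (case x of (a, b) \<Rightarrow> \<Sum>c<N. gen (a, c) \<otimes>\<^sub>f gen (c, b))
      \<subseteq> T_words N \<times> T_words N"
    by simp
qed

lemma counit_cls:
  assumes "Poly_Mapping.keys p \<subseteq> T_words N"
  shows "counit (SO.cls p) = counit_free p"
proof -
  have "counit_free r = counit_free p" if "r \<in> SO.cls p" for r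
    using counit_free_SO_ideal[of "r - p"] that by (simp add: SO.mem_cls counit_free_simps)
  then have "counit_free ` SO.cls p = {counit_free p}"
    using SO.cls_self[of p] by blast
  then show ?thesis
    by (simp add: counit_def)
qed

lemma tensor_square: "is_tensor_square N q SO.hq SO2.hq"
  unfolding is_tensor_square_def scale2_def SOq2_eq
proof (intro conjI ballI allI)
  fix x y assume "x \<in> carrier (SOq N q)" "y \<in> carrier (SOq N q)"
  then obtain p r where p: "Poly_Mapping.keys p \<subseteq> T_words N" "x = SO.cls p"
    and r: "Poly_Mapping.keys r \<subseteq> T_words N" "y = SO.cls r"
    by (auto simp: SOq_eq SO.carrier_Q)
  have keys: "Poly_Mapping.keys (fst z \<otimes>\<^sub>f snd z) \<subseteq> T_words N \<times> T_words N"
    if "z \<in> x \<times> y" for z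
  proof (rule tensor_closed)
    show "Poly_Mapping.keys (fst z) \<subseteq> T_words N"
      using SO.cls_keys[OF p(1), of "fst z"] that p by (simp add: mem_Times_iff)
    show "Poly_Mapping.keys (snd z) \<subseteq> T_words N"
      using SO.cls_keys[OF r(1), of "snd z"] that r by (simp add: mem_Times_iff)
  qed
  \<comment> \<open>A single union over pairs of representatives lets \<open>SO2.hq_UN\<close> act
    on the pure tensor in one go.\<close>
  have UN: "(\<Union>z\<in>A \<times> B. F (fst z) (snd z)) = (\<Union>p\<in>A. \<Union>r\<in>B. F p r)"
    for A B and F :: "(nat \<times> nat) falg \<Rightarrow> (nat \<times> nat) falg \<Rightarrow> qelem2"
    by force
  have "SO2.hq (pure_tensor N q x y) = SO2.hq (\<Union>z\<in>x \<times> y. SO2.cls (fst z \<otimes>\<^sub>f snd z))"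
    by (simp only: UN[of "\<lambda>p r. SO2.cls (p \<otimes>\<^sub>f r)"] pure_tensor_def SOq2_eq)
  also have "\<dots> = (\<Union>z\<in>x \<times> y. SO2.cls (anti_extend f (fst z) \<otimes>\<^sub>f anti_extend f (snd z)))"
    unfolding anti_tensor_tensor[symmetric] by (rule SO2.hq_UN[OF keys])
  also have "\<dots> = (\<Union>p\<in>anti_extend f ` x. \<Union>r\<in>anti_extend f ` y. SO2.cls (p \<otimes>\<^sub>f r))"
    by (simp only: UN[of "\<lambda>p r. SO2.cls (anti_extend f p \<otimes>\<^sub>f anti_extend f r)"] UN_simps image_image
        UN_extend_simps SUP_image o_def)
  \<comment> \<open>The image is the full conjugate coset, so the reindexed union is again a pure
    tensor.\<close>
  also have "anti_extend f ` x = SO.hq x"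
    using p by (simp add: SO.h_cls SO.hq_cls)
  also have "anti_extend f ` y = SO.hq y"
    using r by (simp add: SO.h_cls SO.hq_cls)
  finally show "SO2.hq (pure_tensor N q x y) = pure_tensor N q (SO.hq x) (SO.hq y)"
    by (simp only: pure_tensor_def SOq2_eq)
qed (auto simp: SO2.hq_carrier SO2.hq_add SO2.hq_scale)

text \<open>Since \<open>SO2.hq\<close> makes sense on every union of cosets, this does not require
  \<^const>\<open>comult\<close> to be well defined on cosets.\<close>

lemma comult_hq:
  assumes "x \<in> carrier (SOq N q)"
  shows "comult N q (SO.hq x) = SO2.hq (comult N q x)"
proof -
  obtain p where p: "Poly_Mapping.keys p \<subseteq> T_words N" "x = SO.cls p"
    using assms by (auto simp: SOq_eq SO.carrier_Q)
  have keys: "Poly_Mapping.keys r \<subseteq> T_words N" if "r \<in> x" for r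
    using that p SO.cls_keys by simp
  have "SO2.hq (comult N q x) = (\<Union>r\<in>x. SO2.cls (anti_tensor f f (comult_free N r)))"
    unfolding comult_def SOq2_eq by (rule SO2.hq_UN[OF comult_free_closed[OF keys]])
  also have "\<dots> = (\<Union>r\<in>x. SO2.cls (comult_free N (anti_extend f r)))"
    by (intro SUP_cong refl) (simp add: comult_star keys)
  also have "\<dots> = (\<Union>r\<in>anti_extend f ` x. SO2.cls (comult_free N r))"
    by simp
  also have "anti_extend f ` x = SO.hq x"
    using p by (simp add: SO.h_cls SO.hq_cls)
  finally show ?thesis
    by (simp add: comult_def SOq2_eq)
qed

lemma counit_hq:
  assumes "x \<in> carrier (SOq N q)"
  shows "counit (SO.hq x) = cnj (counit x)"
proof -
  obtain p where p: "Poly_Mapping.keys p \<subseteq> T_words N" "x = SO.cls p"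
    using assms by (auto simp: SOq_eq SO.carrier_Q)
  then show ?thesis
    by (simp add: SO.hq_cls counit_cls SO.closed counit_star)
qed

lemma hq_eq: "SO.hq = (\<lambda>x. \<Union>p\<in>x. qclass N q (anti_extend f p))"
  by (simp add: fun_eq_iff SO.hq_def SOq_eq)

theorem star_conjugation: "is_star_conjugation N q (\<lambda>x. \<Union>p\<in>x. qclass N q (anti_extend f p))"
proof -
  have "is_star_conjugation N q SO.hq"
    unfolding is_star_conjugation_def
  proof (intro conjI ballI allI)
    show "\<exists>S. is_tensor_square N q SO.hq S \<and>
        (\<forall>x\<in>carrier (SOq N q). comult N q (SO.hq x) = S (comult N q x))"
      using tensor_square comult_hq by blast
  qed (auto simp: scale_def SOq_eq SO.hq_carrier SO.hq_add SO.hq_scale SO.hq_mult SO.hq_inv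
      intro: counit_hq[unfolded SOq_eq])
  then show ?thesis
    by (simp only: hq_eq)
qed

lemma star_gen:
  assumes "a < N" "b < N"
  shows "(\<Union>p\<in>qclass N q (gen (a, b)). qclass N q (anti_extend f p)) = qclass N q (f (a, b))"
  using SO.hq_cls[of "gen (a, b)"] assms
  by (simp add: SO.hq_def SOq_eq gen_keys T_index_iff anti_extend_gen)

end

section \<open>The index symmetries of the conjugations\<close>

lemma flip_less: "a < N \<Longrightarrow> flip_index N a < N"
  and flip_flip: "a < N \<Longrightarrow> flip_index N (flip_index N a) = a"
  and flip_less_iff: "a < N \<Longrightarrow> b < N \<Longrightarrow> flip_index N a < flip_index N b \<longleftrightarrow> b < a"
  and flip_eq_iff: "a < N \<Longrightarrow> b < N \<Longrightarrow> flip_index N a = flip_index N b \<longleftrightarrow> a = b"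
  and flip_swap: "a < N \<Longrightarrow> b < N \<Longrightarrow> a = flip_index N b \<longleftrightarrow> b = flip_index N a"
  by (auto simp: flip_index_def)

lemma two_rho_flip: "a < N \<Longrightarrow> two_rho N (flip_index N a) = - two_rho N a"
  by (auto simp: two_rho_def flip_index_def of_nat_diff)

lemma even_two_rho: "even N \<Longrightarrow> even (two_rho N a)"
  by (auto simp: two_rho_def)

lemma q_half_zero: "q_half N q 0 = 1"
  by (simp add: q_half_def)

text \<open>For even \<open>N\<close> the exponent is halved by integer division, which commutes
  with negation only on even numbers; hence the parity condition. For odd \<open>N\<close>
  positivity of \<open>q\<close> makes the square root invertible.\<close>

lemma q_half_minus:
  assumes "admissible_q N q" "even N \<longrightarrow> even k"
  shows "q_half N q k * q_half N q (- k) = 1"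
proof (cases "even N")
  case True
  then obtain j where "k = 2 * j" using assms(2) by (auto elim: evenE)
  moreover have "q \<noteq> 0" using assms(1) by (simp add: admissible_q_def)
  moreover have "- (2 * j) div 2 = - j" by simp
  ultimately show ?thesis
    using True by (simp add: q_half_def power_int_minus)
next
  case False
  then have "q > 0" using assms(1) by (simp add: admissible_q_def)
  then show ?thesis
    using False by (simp add: q_half_def power_int_minus)
qed

text \<open>The entries of R depend on the indices only through equalities, mirror relations, order
  comparisons and differences of rho, and each hypothesis is restricted to the branch that consults
  it. In \<open>val\<close> order and value are combined: for a mirror pair the order may change,
  provided that the factor 1 - q^(rho_a - rho_b) vanishes on the side where it is read.\<close>

lemma R_entry_cong:
  assumes id: "c' = a' \<and> d' = b' \<longleftrightarrow> c = a \<and> d = b"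
    and eq: "a' = b' \<longleftrightarrow> a = b"
    and mid: "a = b \<Longrightarrow> a' = flip_index N a' \<longleftrightarrow> a = flip_index N a"
    and opp: "b' = flip_index N a' \<longleftrightarrow> b = flip_index N a"
    and swap: "c' = b' \<and> d' = a' \<longleftrightarrow> c = b \<and> d = a"
    and order: "b \<noteq> flip_index N a \<Longrightarrow> b' < a' \<longleftrightarrow> b < a"
    and val: "b = flip_index N a \<Longrightarrow>
      (if b' < a' then 1 - q_half N q (two_rho N a' - two_rho N b') else 0) =
      (if b < a then 1 - q_half N q (two_rho N a - two_rho N b) else 0)"
    and opp': "b = flip_index N a \<Longrightarrow> d' = flip_index N c' \<longleftrightarrow> d = flip_index N c"
    and order': "b = flip_index N a \<Longrightarrow> d = flip_index N c \<Longrightarrow> \<not> (c = b \<and> d = a) \<Longrightarrow>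
      (c' < a' \<longleftrightarrow> c < a) \<and> two_rho N a' - two_rho N c' = two_rho N a - two_rho N c"
  shows "R_entry N q a' b' c' d' = R_entry N q a b c d"
proof -
  consider "c = a \<and> d = b" | "\<not> (c = a \<and> d = b)" "c = b \<and> d = a" "b = flip_index N a"
    | "\<not> (c = a \<and> d = b)" "c = b \<and> d = a" "b \<noteq> flip_index N a"
    | "\<not> (c = a \<and> d = b)" "\<not> (c = b \<and> d = a)" "b = flip_index N a" "d = flip_index N c"
    | "\<not> (c = a \<and> d = b)" "\<not> (c = b \<and> d = a)" "\<not> (b = flip_index N a \<and> d = flip_index N c)"
    by blast
  then show ?thesis
  proof cases
    case 1
    then show ?thesis
      unfolding R_entry_def id eq opp using mid by simp
  next
    case 2
    have "(if b' < a' then (q - inverse q) * (1 - q_half N q (two_rho N a' - two_rho N b')) else 0)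
      = (q - inverse q) * (if b' < a' then 1 - q_half N q (two_rho N a' - two_rho N b') else 0)"
      by simp
    also have "\<dots> = (if b < a then (q - inverse q) * (1 - q_half N q (two_rho N a - two_rho N b)) else 0)"
      using val[OF 2(3)] by simp
    finally show ?thesis
      unfolding R_entry_def id swap opp if_not_P[OF 2(1)] if_P[OF 2(2)] if_P[OF 2(3)] .
  next
    case 3
    then show ?thesis
      unfolding R_entry_def id swap opp using order by simp
  next
    case 4
    show ?thesis
      unfolding R_entry_def id swap opp if_not_P[OF 4(1)] if_not_P[OF 4(2)] opp'[OF 4(3)]
        conjunct1[OF order'[OF 4(3,4,2)]] conjunct2[OF order'[OF 4(3,4,2)]] ..
  next
    case 5
    then have "\<not> (b' = flip_index N a' \<and> d' = flip_index N c' \<and> a' > c')"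
      "\<not> (b = flip_index N a \<and> d = flip_index N c \<and> a > c)"
      using opp opp' by auto
    then show ?thesis
      unfolding R_entry_def id swap using 5 by (simp only: if_False)
  qed
qed

text \<open>The mirror reverses order and negates rho, and exchanging the two factors reverses both
  again.\<close>

lemma R_entry_flip:
  assumes "a < N" "b < N" "c < N" "d < N"
  shows "R_entry N q (flip_index N b) (flip_index N a) (flip_index N d) (flip_index N c)
    = R_entry N q a b c d"
  using assms flip_swap[of a N b] flip_swap[of c N d]
  by (intro R_entry_cong)
    (auto simp: flip_less_iff flip_eq_iff two_rho_flip flip_flip flip_less)

lemma R_entry_nonzero:
  assumes "R_entry N q a b c d \<noteq> 0"
  shows "c = a \<and> d = b \<or> c = b \<and> d = a \<or> b = flip_index N a \<and> d = flip_index N c"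
  using assms by (auto simp: R_entry_def split: if_splits)

section \<open>Monomial matrices\<close>

lemma mat_inv_eqI:
  assumes "A \<in> carrier_mat n n" "B \<in> carrier_mat n n" "A * B = 1\<^sub>m n" "B * A = 1\<^sub>m n"
  shows "mat_inv A = B"
  unfolding mat_inv_def
proof (rule the_equality)
  show "B \<in> carrier_mat (dim_row A) (dim_row A) \<and> inverts_mat A B \<and> inverts_mat B A"
    using assms by (auto simp: inverts_mat_def)
  fix B' assume "B' \<in> carrier_mat (dim_row A) (dim_row A) \<and> inverts_mat A B' \<and> inverts_mat B' A"
  then have B': "B' \<in> carrier_mat n n" "B' * A = 1\<^sub>m n"
    using assms(1) by (auto simp: inverts_mat_def)
  have "B' = B' * (A * B)" using B' assms by simp
  also have "\<dots> = (B' * A) * B" using B' assms by (intro assoc_mult_mat[symmetric]) auto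
  also have "\<dots> = B" using B' assms by simp
  finally show "B' = B" .
qed

definition monomial_mat :: "nat \<Rightarrow> (nat \<Rightarrow> nat) \<Rightarrow> (nat \<Rightarrow> 'a) \<Rightarrow> 'a::semiring_1 mat" where
  "monomial_mat N \<sigma> x = mat N N (\<lambda>(i, j). if i = \<sigma> j then x j else 0)"

lemma monomial_mat_carrier [simp]:
  "monomial_mat N \<sigma> x \<in> carrier_mat N N"
  "dim_row (monomial_mat N \<sigma> x) = N" "dim_col (monomial_mat N \<sigma> x) = N"
  by (simp_all add: monomial_mat_def)

lemma monomial_mat_index:
  "i < N \<Longrightarrow> j < N \<Longrightarrow> monomial_mat N \<sigma> x $$ (i, j) = (if i = \<sigma> j then x j else 0)"
  by (simp add: monomial_mat_def)

lemma mult_monomial_right: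
  assumes "A \<in> carrier_mat N N" "i < N" "j < N" "\<sigma> j < N"
  shows "(A * monomial_mat N \<sigma> x) $$ (i, j) = A $$ (i, \<sigma> j) * x j"
proof -
  have "(A * monomial_mat N \<sigma> x) $$ (i, j)
    = (\<Sum>k\<in>{0..<N}. A $$ (i, k) * (if k = \<sigma> j then x j else 0))"
    using assms by (simp add: scalar_prod_def monomial_mat_index cong: sum.cong_simp)
  also have "\<dots> = (\<Sum>k\<in>{0..<N}. if k = \<sigma> j then A $$ (i, k) * x j else 0)"
    by (intro sum.cong refl) simp
  also have "\<dots> = A $$ (i, \<sigma> j) * x j"
    using assms by (simp add: sum.delta)
  finally show ?thesis .
qed

lemma mult_monomial_left:
  assumes "A \<in> carrier_mat N N" "i < N" "j < N"
    and "\<sigma> i < N" "\<And>k. k < N \<Longrightarrow> i = \<sigma> k \<longleftrightarrow> k = \<sigma> i"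
  shows "(monomial_mat N \<sigma> x * A) $$ (i, j) = x (\<sigma> i) * A $$ (\<sigma> i, j)"
proof -
  have "(monomial_mat N \<sigma> x * A) $$ (i, j)
    = (\<Sum>k\<in>{0..<N}. (if k = \<sigma> i then x k else 0) * A $$ (k, j))"
    using assms by (simp add: scalar_prod_def monomial_mat_index cong: sum.cong_simp)
  also have "\<dots> = (\<Sum>k\<in>{0..<N}. if k = \<sigma> i then x k * A $$ (k, j) else 0)"
    by (intro sum.cong refl) simp
  also have "\<dots> = x (\<sigma> i) * A $$ (\<sigma> i, j)"
    using assms by (simp add: sum.delta)
  finally show ?thesis .
qed

lemma num_mat_monomial:
  "num_mat (monomial_mat N \<sigma> x) = monomial_mat N \<sigma> (\<lambda>j. scalar (x j))"
  by (rule eq_matI) (auto simp: monomial_mat_def)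

lemma transpose_metric_eq:
  "transpose_mat (metric N q) = monomial_mat N (flip_index N) (\<lambda>b. of_real (q_half N q (- two_rho N b)))"
  by (rule eq_matI) (auto simp: monomial_mat_def metric_def)

text \<open>Covers both families: \<open>s\<close> is the identity for the natural conjugations and
  the swap of the two middle indices for the sharp ones, and \<open>e\<close> lists the signs. A
  moved index has vanishing rho and goes to its mirror, and order can change only inside a mirror
  pair.\<close>

locale monomial_symmetry =
  fixes N :: nat and s :: "nat \<Rightarrow> nat" and e :: "nat \<Rightarrow> real"
  assumes s_less: "a < N \<Longrightarrow> s a < N"
    and s_s: "a < N \<Longrightarrow> s (s a) = a"
    and s_flip: "a < N \<Longrightarrow> s (flip_index N a) = flip_index N (s a)"
    and s_moved: "a < N \<Longrightarrow> s a \<noteq> a \<Longrightarrow> two_rho N a = 0 \<and> s a = flip_index N a"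
    and s_order: "a < N \<Longrightarrow> b < N \<Longrightarrow> b \<noteq> flip_index N a \<Longrightarrow> s a < s b \<longleftrightarrow> a < b"
    and e_sq: "a < N \<Longrightarrow> e a * e a = 1"
    and e_flip: "a < N \<Longrightarrow> e (flip_index N a) = e a"
    and e_s: "a < N \<Longrightarrow> e (s a) = e a"
begin

definition \<tau> :: "nat \<Rightarrow> nat" where "\<tau> a = flip_index N (s a)"

definition u :: "real \<Rightarrow> nat \<Rightarrow> real" where "u q a = q_half N q (two_rho N a) * e a"

definition W :: "complex mat" where "W = monomial_mat N s (\<lambda>j. of_real (e j))"

definition U :: "real \<Rightarrow> complex mat" where "U q = transpose_mat (metric N q) * W"

lemma s_eq_iff: "a < N \<Longrightarrow> b < N \<Longrightarrow> s a = s b \<longleftrightarrow> a = b"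
  using s_s by metis

lemma two_rho_s: "a < N \<Longrightarrow> two_rho N (s a) = two_rho N a"
  using s_moved[of a] s_moved[of "s a"] s_less[of a] s_s[of a] by metis

lemma tau_less: "a < N \<Longrightarrow> \<tau> a < N"
  by (simp add: \<tau>_def s_less flip_less)

lemma tau_tau: "a < N \<Longrightarrow> \<tau> (\<tau> a) = a"
  by (simp add: \<tau>_def s_flip s_less s_s flip_flip)

lemma tau_eq_iff: "a < N \<Longrightarrow> k < N \<Longrightarrow> a = \<tau> k \<longleftrightarrow> k = \<tau> a"
  using tau_tau by metis

lemma two_rho_tau: "a < N \<Longrightarrow> two_rho N (\<tau> a) = - two_rho N a"
  by (simp add: \<tau>_def two_rho_flip s_less two_rho_s)

lemma e_tau: "a < N \<Longrightarrow> e (\<tau> a) = e a"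
  by (simp add: \<tau>_def e_flip s_less e_s)

text \<open>Order can be lost only inside a mirror pair moved by \<open>s\<close>. There rho is zero
  at both indices, so the entry that compares them vanishes in either order.\<close>

lemma R_entry_s:
  assumes "a < N" "b < N" "c < N" "d < N"
  shows "R_entry N q (s a) (s b) (s c) (s d) = R_entry N q a b c d"
proof -
  have flip_s: "s x = flip_index N (s y) \<longleftrightarrow> x = flip_index N y" if "x < N" "y < N" for x y
    using s_flip[of y] s_eq_iff[of x "flip_index N y"] that flip_less by metis
  have swapped: "s b < s a \<longleftrightarrow> b < a" if "b \<noteq> flip_index N a"
    using that s_order[of b a] assms flip_swap[of a N b] by auto
  show ?thesis
  proof (rule R_entry_cong)
    assume b: "b = flip_index N a"
    show "(if s b < s a then 1 - q_half N q (two_rho N (s a) - two_rho N (s b)) else 0) =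
      (if b < a then 1 - q_half N q (two_rho N a - two_rho N b) else 0)"
    proof (cases "s a = a")
      case True
      then have "s b = b" using s_flip[of a] b assms by simp
      with True show ?thesis by simp
    next
      case False
      then have "two_rho N a = 0" "two_rho N b = 0"
        using s_moved[of a] assms b by (simp_all add: two_rho_flip)
      then show ?thesis
        using assms by (simp add: two_rho_s q_half_zero)
    qed
    assume "d = flip_index N c" "\<not> (c = b \<and> d = a)"
    \<comment> \<open>Otherwise c = a' = b and d = c' = a, the case just excluded; now
      \<open>s_order\<close> applies to c and a.\<close>
    then have "a \<noteq> flip_index N c"
      using b assms flip_swap[of a N c] flip_flip[of a N] by auto
    then show "(s c < s a \<longleftrightarrow> c < a)
      \<and> two_rho N (s a) - two_rho N (s c) = two_rho N a - two_rho N c"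
      using s_order[of c a] assms by (simp add: two_rho_s)
  qed (use assms swapped flip_s s_eq_iff in auto)
qed

lemma R_entry_tau:
  assumes "a < N" "b < N" "c < N" "d < N"
  shows "R_entry N q (\<tau> b) (\<tau> a) (\<tau> d) (\<tau> c) = R_entry N q a b c d"
  using assms by (simp add: \<tau>_def R_entry_flip s_less R_entry_s)

lemma U_eq: "U q = monomial_mat N \<tau> (\<lambda>k. of_real (q_half N q (- two_rho N k) * e k))"
proof (rule eq_matI)
  fix i j assume "i < dim_row (monomial_mat N \<tau> (\<lambda>k. complex_of_real (q_half N q (- two_rho N k) * e k)))"
    "j < dim_col (monomial_mat N \<tau> (\<lambda>k. complex_of_real (q_half N q (- two_rho N k) * e k)))"
  then show "U q $$ (i, j) = monomial_mat N \<tau> (\<lambda>k. of_real (q_half N q (- two_rho N k) * e k)) $$ (i, j)"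
    by (simp add: U_def W_def transpose_metric_eq mult_monomial_right s_less monomial_mat_index
        two_rho_s \<tau>_def del: index_mult_mat(1))
qed (simp_all add: U_def W_def transpose_metric_eq)

lemma W_W: "W * W = 1\<^sub>m N"
proof (rule eq_matI)
  fix i j assume "i < dim_row (1\<^sub>m N :: complex mat)" "j < dim_col (1\<^sub>m N :: complex mat)"
  then show "(W * W) $$ (i, j) = 1\<^sub>m N $$ (i, j)"
    using e_sq[of j]
    by (simp add: W_def mult_monomial_right s_less monomial_mat_index s_s e_s del: index_mult_mat(1) flip: of_real_mult)
qed (simp_all add: W_def)

lemma mat_inv_W: "mat_inv W = W"
  by (rule mat_inv_eqI[OF _ _ W_W W_W]) (simp_all add: W_def)

lemma inverse_u:
  assumes "admissible_q N q" "a < N"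
  shows "u q a * (q_half N q (- two_rho N a) * e a) = 1"
  using q_half_minus[OF assms(1), of "two_rho N a"] e_sq[OF assms(2)] even_two_rho
  by (simp add: u_def mult_ac)

lemma u_tau:
  assumes "a < N"
  shows "u q (\<tau> a) = q_half N q (- two_rho N a) * e a"
  using assms by (simp add: u_def two_rho_tau e_tau)

lemma u_div:
  assumes "admissible_q N q" "b < N"
  shows "u q a / u q b = u q a * (q_half N q (- two_rho N b) * e b)"
  using inverse_unique[OF inverse_u[OF assms]] by (simp add: divide_inverse)

lemma U_U:
  assumes "admissible_q N q"
  shows "U q * U q = 1\<^sub>m N"
proof (rule eq_matI)
  fix i j assume "i < dim_row (1\<^sub>m N :: complex mat)" "j < dim_col (1\<^sub>m N :: complex mat)"
  then have ij: "i < N" "j < N" by auto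
  have "complex_of_real (u q j * (q_half N q (- two_rho N j) * e j)) = 1"
    using inverse_u[OF assms ij(2)] by simp
  then show "(U q * U q) $$ (i, j) = 1\<^sub>m N $$ (i, j)"
    using ij
    by (simp add: U_eq mult_monomial_right tau_less monomial_mat_index tau_tau two_rho_tau e_tau
        u_def del: index_mult_mat(1))
qed (simp_all add: U_eq)

lemma mat_inv_U: "admissible_q N q \<Longrightarrow> mat_inv (U q) = U q"
  by (rule mat_inv_eqI[OF _ _ U_U U_U]) (simp_all add: U_eq)

lemma T_mat_carrier: "T_mat N \<in> carrier_mat N N"
  and T_mat_index: "i < N \<Longrightarrow> j < N \<Longrightarrow> T_mat N $$ (i, j) = gen (i, j)"
  by (simp_all add: T_mat_def)

lemma conjugate_entry:
  assumes "admissible_q N q" "a < N" "b < N"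
  shows "(num_mat (U q) * T_mat N * num_mat (mat_inv (U q))) $$ (a, b)
    = rscalar (u q a / u q b) * gen (\<tau> a, \<tau> b)"
proof -
  have "(num_mat (U q) * T_mat N * num_mat (mat_inv (U q))) $$ (a, b)
    = rscalar (u q (\<tau> (\<tau> a))) * gen (\<tau> a, \<tau> b) * rscalar (q_half N q (- two_rho N b) * e b)"
    using assms T_mat_carrier tau_eq_iff[of a] mult_carrier_mat[OF monomial_mat_carrier(1) T_mat_carrier]
    unfolding mat_inv_U[OF assms(1)]
    unfolding U_eq num_mat_monomial
    by (simp add: mult_monomial_right mult_monomial_left tau_less
        tau_tau two_rho_tau e_tau u_def T_mat_index del: index_mult_mat(1))
  then show ?thesis
    using assms by (simp only: u_div tau_tau scalar_normalize mult.assoc of_real_mult)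
qed

text \<open>C and W are their own inverses, so the right-hand factors multiply to the inverse of U =
  C^t W. The map written with two copies of C^t is thus conjugation by U.\<close>

lemma twisted_entry:
  assumes "admissible_q N q" "a < N" "b < N"
  shows "(num_mat (transpose_mat (metric N q)) * num_mat W * T_mat N * num_mat (mat_inv W)
      * num_mat (transpose_mat (metric N q))) $$ (a, b)
    = rscalar (u q a / u q b) * gen (\<tau> a, \<tau> b)"
proof -
  let ?C = "num_mat (transpose_mat (metric N q))"
  have "?C * num_mat W = num_mat (U q)"
  proof (rule eq_matI)
    fix i j assume "i < dim_row (num_mat (U q))" "j < dim_col (num_mat (U q))"
    then show "(?C * num_mat W) $$ (i, j) = num_mat (U q) $$ (i, j)"
      by (simp add: U_eq W_def transpose_metric_eq num_mat_monomial mult_monomial_right s_less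
          monomial_mat_index two_rho_s \<tau>_def scalar_mult del: index_mult_mat(1))
  qed (simp_all add: U_eq W_def transpose_metric_eq)
  moreover have "num_mat (U q) * T_mat N \<in> carrier_mat N N"
    by (intro mult_carrier_mat[of _ N N]) (simp_all add: U_eq T_mat_def)
  ultimately have "(?C * num_mat W * T_mat N * num_mat (mat_inv W) * ?C) $$ (a, b)
    = (num_mat (U q) * T_mat N) $$ (a, \<tau> b) * rscalar (e (flip_index N b)) * rscalar (q_half N q (- two_rho N b))"
    using assms unfolding mat_inv_W
    by (simp add: W_def transpose_metric_eq num_mat_monomial mult_monomial_right
        flip_less s_less s_flip \<tau>_def del: index_mult_mat(1))
  also have "\<dots> = rscalar (u q (\<tau> (\<tau> a))) * gen (\<tau> a, \<tau> b) * rscalar (q_half N q (- two_rho N b) * e b)"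
    using assms T_mat_carrier tau_eq_iff[of a]
    by (simp add: U_eq num_mat_monomial mult_monomial_left tau_less tau_tau two_rho_tau e_tau
        u_def T_mat_index e_flip mult.assoc mult.commute del: index_mult_mat(1) flip: scalar_mult)
  finally show ?thesis
    using assms by (simp only: u_div tau_tau scalar_normalize mult.assoc of_real_mult)
qed

lemma monomial_twist:
  assumes "admissible_q N q"
  shows "monomial_twist N q \<tau> (u q)
    (\<lambda>i. (num_mat (transpose_mat (metric N q)) * num_mat W * T_mat N * num_mat (mat_inv W)
      * num_mat (transpose_mat (metric N q))) $$ i)"
proof
  fix a b c d assume ab: "a < N" "b < N" and cd: "c < N" "d < N"
  \<comment> \<open>Source of both balance conditions: the metric pairs mirror indices only, and a
    nonzero entry of R has the same index pair above and below up to order, or a mirror pair in both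
    places.\<close>
  have pair: "u q x * u q (flip_index N x) = 1" if "x < N" for x
    using inverse_u[OF assms that] that by (simp add: u_def two_rho_flip e_flip)
  show "\<tau> a < N" "\<tau> (\<tau> a) = a" "u q a * u q (\<tau> a) = 1"
    using ab by (simp_all add: tau_less tau_tau u_tau inverse_u[OF assms])
  have "\<tau> a = flip_index N (\<tau> b) \<longleftrightarrow> b = flip_index N a"
  proof -
    have "flip_index N (\<tau> b) = s b" "\<tau> a = s (flip_index N a)"
      using ab by (simp_all add: \<tau>_def s_less flip_flip s_flip)
    then show ?thesis
      using ab s_eq_iff[of "flip_index N a" b] by (auto simp: flip_less)
  qed
  then show "metric_entry N q (\<tau> b) (\<tau> a) = metric_entry N q a b"
    using ab by (auto simp: two_rho_tau two_rho_flip)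
  show "u q a * u q b = 1" if "metric_entry N q a b \<noteq> 0"
    using that pair[OF ab(1)] by (auto split: if_splits)
  show "R_entry N q (\<tau> b) (\<tau> a) (\<tau> d) (\<tau> c) = R_entry N q a b c d"
    using ab cd by (rule R_entry_tau)
  show "u q c * u q d = u q a * u q b" if "R_entry N q a b c d \<noteq> 0"
    using R_entry_nonzero[OF that] pair ab cd by (auto simp: mult.commute)
qed (rule twisted_entry[OF assms])

lemma star_conjugation: "admissible_q N q \<Longrightarrow> is_star_conjugation N q (twisted_star N q W)"
  using monomial_twist.star_conjugation[OF monomial_twist]
  unfolding twisted_star_def Let_def by blast

lemma twisted_star_gen:
  assumes "admissible_q N q" "a < N" "b < N"
  shows "twisted_star N q W (qclass N q (gen (a, b)))
    = qclass N q ((num_mat (U q) * T_mat N * num_mat (mat_inv (U q))) $$ (a, b))"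
  using monomial_twist.star_gen[OF monomial_twist[OF assms(1)] assms(2,3)] assms
  by (simp add: twisted_star_def Let_def twisted_entry conjugate_entry)

end

section \<open>Real forms\<close>

interpretation cnj_hom: comm_ring_hom cnj
  by unfold_locales auto

text \<open>The columns of \<open>Q\<close> are fixed by v -> U (cnj v), so they form a real basis
  of the real form. In this basis the condition on conjugates becomes plain reality, since cnj (P g
  Q) = (P U)(U g U)(U Q) = P g Q, and the form \<open>J\<close> becomes \<open>c\<close> times
  \<open>\<eta>\<close>.\<close>

lemma conjugate_orthogonal_group:
  fixes J U Q P :: "complex mat" and \<eta> :: "real mat" and c :: real
  assumes J: "J \<in> carrier_mat N N" and U: "U \<in> carrier_mat N N" and Q: "Q \<in> carrier_mat N N"
    and P: "P \<in> carrier_mat N N" and \<eta>: "\<eta> \<in> carrier_mat N N"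
    and UU: "U * U = 1\<^sub>m N" and PQ: "P * Q = 1\<^sub>m N" and QP: "Q * P = 1\<^sub>m N"
    and real: "U * map_mat cnj Q = Q" and c: "c \<noteq> 0"
    and form: "transpose_mat Q * J * Q = of_real c \<cdot>\<^sub>m map_mat of_real \<eta>"
  shows "(\<lambda>g. P * g * Q) ` {g \<in> carrier_mat N N. det g = 1 \<and> transpose_mat g * J * g = J \<and>
        map_mat cnj g = U * g * U}
    = map_mat complex_of_real ` {h \<in> carrier_mat N N. det h = 1 \<and> transpose_mat h * \<eta> * h = \<eta>}"
    (is "?c ` ?G = ?r ` ?H")
proof -
  note carriers = J U Q P \<eta>
  note closed = mult_carrier_mat[of _ N N _ N] transpose_carrier_mat map_carrier_mat smult_carrier_mat
  note assoc = assoc_mult_mat[of _ N N _ N _ N]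
  note transp = transpose_mult[of _ N N _ N]
  have cancel: "A * (B * X) = X"
    if "A * B = 1\<^sub>m N" "A \<in> carrier_mat N N" "B \<in> carrier_mat N N" "X \<in> carrier_mat N N"
    for A B X :: "complex mat"
    using that by (simp flip: assoc)
  have PtQt: "transpose_mat P * transpose_mat Q = 1\<^sub>m N"
    using transp[OF Q P] QP by simp
  have QtPt: "transpose_mat Q * transpose_mat P = 1\<^sub>m N"
    using transp[OF P Q] PQ by simp
  note cancels = cancel[OF UU U U] cancel[OF PQ P Q] cancel[OF QP Q P]
    cancel[OF PtQt] cancel[OF QtPt]
  have Qc: "map_mat cnj Q = U * Q"
  proof -
    have "U * (U * map_mat cnj Q) = U * Q" by (simp only: real)
    then show ?thesis using carriers by (simp add: cancels)
  qed
  have Pc: "map_mat cnj P = P * U"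
  proof -
    have "map_mat cnj P * map_mat cnj Q = 1\<^sub>m N"
      using cnj_hom.mat_hom_mult[OF P Q] PQ cnj_hom.mat_hom_one by simp
    then have "map_mat cnj P * (U * Q) * (P * U) = P * U"
      using carriers by (simp add: Qc)
    then show ?thesis
      using carriers UU by (simp add: assoc closed cancels)
  qed
  let ?D = "transpose_mat Q * J * Q"
  have D: "?D \<in> carrier_mat N N" using carriers by (simp add: closed)
  \<comment> \<open>A nonzero factor of the form drops out of the invariance condition; this is what
    allows \<open>c = - 1\<close> later on.\<close>
  have form_iff: "transpose_mat (?r h) * ?D * ?r h = ?D \<longleftrightarrow> transpose_mat h * \<eta> * h = \<eta>"
    if h: "h \<in> carrier_mat N N" for h
  proof -
    have "transpose_mat (?r h) = ?r (transpose_mat h)"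
      by (rule eq_matI) auto
    then have "transpose_mat (?r h) * ?D * ?r h = of_real c \<cdot>\<^sub>m ?r (transpose_mat h * \<eta> * h)"
      using h \<eta> unfolding form
      by (simp add: mult_smult_distrib[of _ N N _ N] mult_smult_assoc_mat[of _ N N _ N] closed
          of_real_hom.mat_hom_mult[of _ N N _ N])
    moreover have "of_real c \<cdot>\<^sub>m ?r A = of_real c \<cdot>\<^sub>m ?r B \<longleftrightarrow> A = B"
      if "A \<in> carrier_mat N N" "B \<in> carrier_mat N N" for A B
      using that c by (auto simp: mat_eq_iff)
    ultimately show ?thesis
      using h \<eta> by (simp add: form closed)
  qed
  have cancel_form: "transpose_mat A * (B * (A * X)) = B * X"
    if "transpose_mat A * B * A = B" "A \<in> carrier_mat N N" "B \<in> carrier_mat N N"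
      "X \<in> carrier_mat N N" for A B X :: "complex mat"
    using that assoc[of "transpose_mat A" B "A * X"] assoc[of "transpose_mat A * B" A X]
    by (simp add: closed)
  have det_PQ: "det P * det Q = 1"
    using det_mult[OF P Q] PQ by simp
  show ?thesis
  proof (intro equalityI subsetI)
    fix x assume "x \<in> ?c ` ?G"
    then obtain g where g: "g \<in> carrier_mat N N" "det g = 1" "transpose_mat g * J * g = J"
      "map_mat cnj g = U * g * U" and x: "x = P * g * Q" by blast
    have xN: "x \<in> carrier_mat N N"
      using carriers g x by (simp add: closed)
    have "map_mat cnj x = (P * U) * (U * g * U) * (U * Q)"
      using carriers g by (simp add: x cnj_hom.mat_hom_mult[of _ N N _ N] closed Pc Qc assoc)
    also have "\<dots> = x"
      using carriers g by (simp add: x assoc closed cancels)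
    finally have "cnj (x $$ (i, j)) = x $$ (i, j)" if "i < N" "j < N" for i j
      using that xN by (metis carrier_matD index_map_mat(1))
    then have "Im (x $$ (i, j)) = 0" if "i < N" "j < N" for i j
      using that by (metis Reals_cnj_iff complex_is_Real_iff)
    then have r: "?r (map_mat Re x) = x"
      using xN by (intro eq_matI) (auto simp: complex_eq_iff)
    have "det x = 1"
      using carriers g det_PQ by (simp add: x det_mult[of _ N] closed)
    then have det: "det (map_mat Re x) = 1"
      using of_real_hom.hom_det[of "map_mat Re x"] r by (metis of_real_eq_1_iff)
    have "transpose_mat x * ?D * x = ?D"
      using carriers g
      by (simp add: x assoc closed cancels transp cancel_form[OF g(3) g(1) J])
    then have "transpose_mat (map_mat Re x) * \<eta> * map_mat Re x = \<eta>"
      using form_iff[of "map_mat Re x"] xN r by (simp add: closed)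
    then show "x \<in> ?r ` ?H"
      using r det xN by (intro image_eqI[of _ _ "map_mat Re x"]) (auto simp: closed)
  next
    fix x assume "x \<in> ?r ` ?H"
    then obtain h where h: "h \<in> carrier_mat N N" "det h = 1" "transpose_mat h * \<eta> * h = \<eta>"
      and x: "x = ?r h" by blast
    have xN: "x \<in> carrier_mat N N" using h x by (simp add: closed)
    have xc: "map_mat cnj x = x"
      by (rule eq_matI) (auto simp: x)
    have "det x = 1"
      using h of_real_hom.hom_det[of h] by (simp add: x)
    then have det: "det (Q * x * P) = 1"
      using carriers xN det_PQ by (simp add: det_mult[of _ N] closed mult.commute)
    have f: "transpose_mat x * ?D * x = ?D"
      using form_iff[OF h(1)] h x by simp
    have "transpose_mat (Q * x * P) * J * (Q * x * P)
      = transpose_mat P * (transpose_mat x * ?D * x) * P"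
      using carriers xN by (simp add: assoc closed transp)
    also have "\<dots> = J"
      using carriers xN QP unfolding f by (simp add: assoc closed cancels)
    finally have f': "transpose_mat (Q * x * P) * J * (Q * x * P) = J" .
    have "map_mat cnj (Q * x * P) = U * (Q * x * P) * U"
      using carriers xN
      by (simp add: cnj_hom.mat_hom_mult[of _ N N _ N] closed Pc Qc xc assoc)
    moreover have "x = P * (Q * x * P) * Q"
      using carriers xN PQ by (simp add: assoc closed cancels)
    ultimately show "x \<in> ?c ` ?G"
      using det f' carriers xN by (intro image_eqI[of _ _ "Q * x * P"]) (auto simp: closed)
  qed
qed

lemma q_half_one: "q_half N 1 k = 1"
  by (simp add: q_half_def)

lemma q_half_tendsto: "((\<lambda>q. q_half N q k) \<longlongrightarrow> 1) (at 1)"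
proof (cases "even N")
  case True
  then show ?thesis
    using tendsto_power_int[of "\<lambda>q::real. q" 1 "at 1" "k div 2"] by (simp add: q_half_def)
next
  case False
  have "((\<lambda>q. sqrt q powi k) \<longlongrightarrow> sqrt 1 powi k) (at 1)"
    by (intro tendsto_intros) auto
  with False show ?thesis by (simp add: q_half_def)
qed

text \<open>Each pair \<open>{j, j'}\<close> of indices carries two vectors that are fixed by the real structure
  \<open>v \<mapsto> U (cnj v)\<close>, orthonormal up to sign for the form \<open>\<Sum>\<^sub>a v\<^sub>a w\<^sub>a\<^sub>'\<close>; they are labelled
  by \<open>j\<close> and \<open>j'\<close>.\<close>

locale split_symmetry = monomial_symmetry +
  assumes e_mid: "a < N \<Longrightarrow> flip_index N a = a \<or> s a \<noteq> a \<Longrightarrow> e a = 1"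
begin

text \<open>For a pair not moved by \<open>s\<close>, the real structure sends the unit vectors x, y
  at j < j' to e y and e x with e = e_j. It fixes (x + e y) / sqrt 2 and i (x - e y) / sqrt 2, both
  of square e. For a swapped pair it fixes x and y themselves, and (x + y) / sqrt 2 and (x - y) /
  sqrt 2 have squares 1 and -1.\<close>

definition basis :: "nat \<Rightarrow> nat \<Rightarrow> complex" where
  "basis a j = (let j' = flip_index N j; r = of_real (1 / sqrt 2) in
    if j' = j then if a = j then 1 else 0
    else if s j = j then
      if j < j' then if a = j then r else if a = j' then of_real (e j) * r else 0
      else if a = j' then \<i> * r else if a = j then - (of_real (e j) * \<i> * r) else 0
    else if j < j' then if a = j \<or> a = j' then r else 0
      else if a = j' then r else if a = j then - r else 0)"

definition sign :: "nat \<Rightarrow> real" where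
  "sign j = (if s j = j then e j else if j < flip_index N j then 1 else - 1)"

lemma s_flip_fixed: "j < N \<Longrightarrow> s (flip_index N j) = flip_index N j \<longleftrightarrow> s j = j"
  using s_flip[of j] flip_eq_iff[of "s j" N j] s_less by auto

lemma basis_zero: "a \<noteq> j \<Longrightarrow> a \<noteq> flip_index N j \<Longrightarrow> basis a j = 0"
  by (simp add: basis_def Let_def)

lemma basis_real:
  assumes "a < N" "j < N"
  shows "of_real (e a) * cnj (basis (\<tau> a) j) = basis a j"
proof -
  let ?j' = "flip_index N j"
  consider "a = j" "?j' = j" | "a = j" "?j' \<noteq> j" | "a = ?j'" "?j' \<noteq> j" | "a \<noteq> j" "a \<noteq> ?j'"
    by blast
  then show ?thesis
  proof cases
    case 1
    have "s j = j"
      using s_moved[of j] 1 assms by auto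
    then show ?thesis
      using 1 assms e_mid[of j] by (simp add: basis_def \<tau>_def)
  next
    case 2
    have "of_real (e j) * of_real (e j) = (1 :: complex)"
      using e_sq[of j] assms by (simp flip: of_real_mult)
    then show ?thesis
      using 2 assms s_moved[of j] e_mid[of j] e_sq[of j]
      by (cases "s j = j") (auto simp: basis_def \<tau>_def Let_def flip_flip simp flip: mult.assoc)
  next
    case 3
    have "of_real (e j) * of_real (e j) = (1 :: complex)"
      using e_sq[of j] assms by (simp flip: of_real_mult)
    then show ?thesis
      using 3 assms s_moved[of j] e_mid[of j] e_flip[of j] s_flip[of j] s_flip_fixed[of j]
      by (cases "s j = j") (auto simp: basis_def \<tau>_def Let_def flip_flip simp flip: mult.assoc)
  next
    case 4
    have "\<tau> a = flip_index N a \<or> \<tau> a = a"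
      using assms s_moved[of a] by (cases "s a = a") (auto simp: \<tau>_def flip_flip)
    then have "\<tau> a \<noteq> j" "\<tau> a \<noteq> ?j'"
      using 4 assms flip_swap[of a N j] flip_eq_iff[of a N j] by auto
    then show ?thesis
      using basis_zero[OF 4] basis_zero[of "\<tau> a" j] by simp
  qed
qed

lemma basis_form:
  assumes "j < N" "k < N"
  shows "(\<Sum>a<N. basis a j * basis (flip_index N a) k) = (if j = k then of_real (sign j) else 0)"
proof -
  let ?j' = "flip_index N j"
  let ?r = "complex_of_real (1 / sqrt 2)"
  \<comment> \<open>The vector labelled j is supported on j and j', so two terms survive at
    most.\<close>
  have "(\<Sum>a<N. basis a j * basis (flip_index N a) k)
    = (\<Sum>a\<in>{j, ?j'}. basis a j * basis (flip_index N a) k)"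
    using assms by (intro sum.mono_neutral_right) (auto simp: flip_less basis_zero)
  also have "\<dots> = (if j = k then of_real (sign j) else 0)"
  proof (cases "?j' = j")
    case True
    have "s j = j"
      using s_moved[of j] True assms by auto
    then have "k \<noteq> j \<Longrightarrow> basis j k = 0"
      using basis_zero[of j k] True assms flip_swap[of j N k] by auto
    then show ?thesis
      using True \<open>s j = j\<close> assms e_mid[of j] by (auto simp: basis_def sign_def)
  next
    case False
    have rr: "?r * ?r = 1 / 2"
      by (simp flip: of_real_mult of_real_divide) simp
    have ee: "complex_of_real (e j) * complex_of_real (e j) = 1"
      using e_sq[of j] assms by (simp flip: of_real_mult)
    consider "k = j" | "k = ?j'" | "k \<noteq> j" "k \<noteq> ?j'" by blast
    then show ?thesis
    proof cases
      case 1
      then have "(\<Sum>a\<in>{j, ?j'}. basis a j * basis (flip_index N a) k)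
        = 2 * (basis j j * basis ?j' j)"
        using False assms by (simp add: flip_flip)
      also have "\<dots> = 2 * (of_real (sign j) * (?r * ?r))"
        using False assms by (auto simp: basis_def sign_def Let_def algebra_simps)
      finally show ?thesis
        using 1 unfolding rr by simp
    next
      case 2
      then have "(\<Sum>a\<in>{j, ?j'}. basis a j * basis (flip_index N a) k)
        = basis j j * basis ?j' ?j' + basis ?j' j * basis j ?j'"
        using False assms by (simp add: flip_flip)
      also have "\<dots> = 0"
        using False assms ee s_flip_fixed[of j] e_flip[of j]
        by (auto simp: basis_def Let_def flip_flip)
      finally show ?thesis
        using 2 False by simp
    next
      case 3
      then have "basis ?j' k = 0" "basis j k = 0"
        using basis_zero[of ?j' k] basis_zero[of j k] assms flip_swap[of j N k] flip_eq_iff[of j N k]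
        by auto
      then show ?thesis
        using 3 False assms by (simp add: flip_flip)
    qed
  qed
  finally show ?thesis .
qed

lemma sign_cases: "j < N \<Longrightarrow> sign j = 1 \<or> sign j = - 1"
  using e_sq[of j] by (auto simp: sign_def square_eq_1_iff)

text \<open>The vectors of sign \<open>c\<close> are placed first. For \<open>c = - 1\<close> this
  yields the negative of the standard form, so that one choice of signs serves both (l, m) and (m,
  l).\<close>

lemma sorted_signs:
  assumes card: "card {j. j < N \<and> sign j = c} = l" and lm: "l + m = N" and c: "c = 1 \<or> c = - 1"
  obtains \<pi> where "bij_betw \<pi> {..<N} {..<N}"
    and "\<And>j. j < N \<Longrightarrow> sign (\<pi> j) = c * (if j < l then 1 else - 1)"
proof -
  let ?A = "{j. j < N \<and> sign j = c}" and ?B = "{j. j < N \<and> sign j \<noteq> c}"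
  have AB: "?A \<union> ?B = {..<N}" "?A \<inter> ?B = {}" by auto
  have "finite ?A" "finite ?B" by auto
  then have "card ?A + card ?B = N"
    using card_Un_disjoint[of ?A ?B] AB by simp
  then have cards: "card {..<l} = card ?A" "card {l..<N} = card ?B"
    using card lm by simp_all
  obtain f where f: "bij_betw f {..<l} ?A"
    using finite_same_card_bij[OF _ _ cards(1)] by auto
  obtain g where g: "bij_betw g {l..<N} ?B"
    using finite_same_card_bij[OF _ _ cards(2)] by auto
  let ?\<pi> = "\<lambda>j. if j \<in> {..<l} then f j else g j"
  have "bij_betw ?\<pi> ({..<l} \<union> {l..<N}) (?A \<union> ?B)"
    using f g AB(2) by (intro bij_betw_disjoint_Un) auto
  moreover have "{..<l} \<union> {l..<N} = {..<N}"
    using lm by auto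
  ultimately have "bij_betw ?\<pi> {..<N} {..<N}"
    using AB(1) by simp
  moreover have "sign (?\<pi> j) = c * (if j < l then 1 else - 1)" if "j < N" for j
  proof (cases "j < l")
    case True
    then have "f j \<in> ?A" using f by (auto dest: bij_betwE)
    with True show ?thesis by simp
  next
    case False
    then have "j \<in> {l..<N}" using that by simp
    then have "g j < N" "sign (g j) \<noteq> c" using bij_betw_apply[OF g] by auto
    with False show ?thesis using c sign_cases[of "g j"] by auto
  qed
  ultimately show ?thesis by (rule that)
qed

lemma U_one: "U 1 = monomial_mat N \<tau> (\<lambda>k. of_real (e k))"
  by (simp add: U_eq q_half_one)

text \<open>The value \<open>q = 1\<close> is not admissible, so \<open>U_U\<close> does not reach
  the limit matrix.\<close>

lemma U_one_square: "U 1 * U 1 = 1\<^sub>m N"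
proof (rule eq_matI)
  fix i j assume "i < dim_row (1\<^sub>m N :: complex mat)" "j < dim_col (1\<^sub>m N :: complex mat)"
  then show "(U 1 * U 1) $$ (i, j) = 1\<^sub>m N $$ (i, j)"
    using e_sq[of j]
    by (simp add: U_one mult_monomial_right tau_less monomial_mat_index tau_tau e_tau
        del: index_mult_mat(1) flip: of_real_mult)
qed (simp_all add: U_one)

lemma U_tendsto:
  assumes "a < N" "b < N"
  shows "((\<lambda>q. U q $$ (a, b)) \<longlongrightarrow> U 1 $$ (a, b)) (at 1)"
proof (cases "a = \<tau> b")
  case True
  have "((\<lambda>q. complex_of_real (q_half N q (- two_rho N b) * e b)) \<longlongrightarrow> of_real (1 * e b)) (at 1)"
    by (intro tendsto_intros q_half_tendsto)
  with True show ?thesis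
    using assms by (simp add: U_eq monomial_mat_index q_half_one)
qed (use assms in \<open>simp add: U_eq monomial_mat_index\<close>)

lemma mult_mat_index:
  assumes "A \<in> carrier_mat n n" "B \<in> carrier_mat n n" "i < n" "j < n"
  shows "(A * B) $$ (i, j) = (\<Sum>a<n. A $$ (i, a) * B $$ (a, j))"
  using assms by (simp add: scalar_prod_def atLeast0LessThan cong: sum.cong_simp)

lemma orthogonal_basis:
  assumes \<pi>: "bij_betw \<pi> {..<N} {..<N}"
    and Q: "Q = mat N N (\<lambda>(i, j). basis i (\<pi> j))"
  shows "U 1 * map_mat cnj Q = Q"
    and "transpose_mat Q * metric N 1 * Q = mat_diag N (\<lambda>j. of_real (sign (\<pi> j)))"
proof -
  have \<pi>_less: "\<pi> j < N" if "j < N" for j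
    using \<pi> that by (auto dest: bij_betwE)
  have \<pi>_inj: "\<pi> i = \<pi> j \<longleftrightarrow> i = j" if "i < N" "j < N" for i j
    using \<pi> that by (auto simp: bij_betw_def inj_on_def)
  show "U 1 * map_mat cnj Q = Q"
  proof (rule eq_matI)
    fix i j assume "i < dim_row Q" "j < dim_col Q"
    then have ij: "i < N" "j < N" by (simp_all add: Q)
    then have "(U 1 * map_mat cnj Q) $$ (i, j) = of_real (e (\<tau> i)) * map_mat cnj Q $$ (\<tau> i, j)"
      unfolding U_one by (intro mult_monomial_left tau_eq_iff) (auto simp: Q tau_less)
    then show "(U 1 * map_mat cnj Q) $$ (i, j) = Q $$ (i, j)"
      using ij by (simp add: Q e_tau tau_less basis_real \<pi>_less)
  qed (simp_all add: Q U_one)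
  have metric_eq: "metric N 1 = monomial_mat N (flip_index N) (\<lambda>_. 1)"
    by (rule eq_matI) (auto simp: metric_def monomial_mat_def q_half_one flip_swap[of _ N])
  show "transpose_mat Q * metric N 1 * Q = mat_diag N (\<lambda>j. of_real (sign (\<pi> j)))"
  proof (rule eq_matI)
    fix i j assume "i < dim_row (mat_diag N (\<lambda>j. complex_of_real (sign (\<pi> j))))"
      "j < dim_col (mat_diag N (\<lambda>j. complex_of_real (sign (\<pi> j))))"
    then have ij: "i < N" "j < N" by (simp_all add: mat_diag_def)
    have "(transpose_mat Q * metric N 1 * Q) $$ (i, j)
      = (\<Sum>a<N. (transpose_mat Q * metric N 1) $$ (i, a) * Q $$ (a, j))"
      using ij unfolding metric_eq
      by (intro mult_mat_index mult_carrier_mat[of _ N N]) (simp_all add: Q)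
    also have "\<dots> = (\<Sum>a<N. basis (flip_index N a) (\<pi> i) * basis a (\<pi> j))"
      using ij unfolding metric_eq
      by (intro sum.cong refl) (simp add: mult_monomial_right Q flip_less del: index_mult_mat(1))
    also have "\<dots> = (\<Sum>a<N. basis a (\<pi> j) * basis (flip_index N a) (\<pi> i))"
      by (simp add: mult.commute)
    also have "\<dots> = mat_diag N (\<lambda>j. of_real (sign (\<pi> j))) $$ (i, j)"
      using ij by (auto simp: basis_form \<pi>_less \<pi>_inj mat_diag_def)
    finally show "(transpose_mat Q * metric N 1 * Q) $$ (i, j)
      = mat_diag N (\<lambda>j. of_real (sign (\<pi> j))) $$ (i, j)" .
  qed (simp_all add: Q mat_diag_def)
qed

end

section \<open>Identification of the classical limit group\<close>

context split_symmetry
begin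

theorem gives_real_form:
  assumes card: "card {j. j < N \<and> sign j = c} = l" and lm: "l + m = N" and c: "c = 1 \<or> c = - 1"
  shows "gives_real_form N (\<lambda>q. twisted_star N q W) l m"
proof -
  obtain \<pi> where \<pi>: "bij_betw \<pi> {..<N} {..<N}"
    and signs: "\<And>j. j < N \<Longrightarrow> sign (\<pi> j) = c * (if j < l then 1 else - 1)"
    using sorted_signs[OF card lm c] by blast
  define Q where "Q = mat N N (\<lambda>(i, j). basis i (\<pi> j))"
  note basis = orthogonal_basis[OF \<pi> Q_def]
  define \<eta> :: "real mat" where "\<eta> = mat_diag N (\<lambda>i. if i < l then 1 else - 1)"
  define D :: "complex mat" where "D = mat_diag N (\<lambda>j. of_real (sign (\<pi> j)))"
  \<comment> \<open>Since Q^t C Q = D and D^2 = 1, this is the inverse of Q, obtained from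
    orthogonality without inverting anything.\<close>
  define P where "P = D * (transpose_mat Q * metric N 1)"
  have carriers: "Q \<in> carrier_mat N N" "D \<in> carrier_mat N N" "metric N 1 \<in> carrier_mat N N"
    "\<eta> \<in> carrier_mat N N" "U q \<in> carrier_mat N N" for q
    by (simp_all add: Q_def D_def \<eta>_def lm metric_def U_eq mat_diag_def)
  then have P: "P \<in> carrier_mat N N"
    unfolding P_def by (intro mult_carrier_mat transpose_carrier_mat[THEN iffD2])
  have "P * Q = D * (transpose_mat Q * metric N 1 * Q)"
    unfolding P_def using carriers
    by (intro assoc_mult_mat[of _ N N _ N _ N] mult_carrier_mat[of _ N N _ N]) simp_all
  also have "\<dots> = D * D"
    by (simp only: basis(2) D_def)
  also have "\<dots> = 1\<^sub>m N"
  proof (rule eq_matI)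
    fix i j assume "i < dim_row (1\<^sub>m N :: complex mat)" "j < dim_col (1\<^sub>m N :: complex mat)"
    then show "(D * D) $$ (i, j) = 1\<^sub>m N $$ (i, j)"
      using signs[of i] c unfolding D_def mat_diag_diag by (auto simp: mat_diag_def)
  qed (use carriers in auto)
  finally have PQ: "P * Q = 1\<^sub>m N" .
  have QP: "Q * P = 1\<^sub>m N"
    by (rule mat_mult_left_right_inverse[OF P carriers(1) PQ])
  have form: "transpose_mat Q * metric N 1 * Q = of_real c \<cdot>\<^sub>m map_mat of_real \<eta>"
    unfolding basis(2) by (rule eq_matI) (use signs lm in \<open>auto simp: \<eta>_def mat_diag_def\<close>)
  have inv1: "mat_inv (U 1) = U 1"
    by (rule mat_inv_eqI[OF carriers(5) carriers(5) U_one_square U_one_square])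
  have invP: "mat_inv P = Q"
    by (rule mat_inv_eqI[OF P carriers(1) PQ QP])
  have invertible: "invertible_mat A" if "A * B = 1\<^sub>m N" "B * A = 1\<^sub>m N"
    "A \<in> carrier_mat N N" "B \<in> carrier_mat N N" for A B :: "complex mat"
    using that unfolding invertible_mat_def inverts_mat_def by auto
  have "(\<lambda>g. P * g * mat_inv P) ` classical_limit_group N (U 1)
      = map_mat complex_of_real ` SO_group l m"
    unfolding classical_limit_group_def SO_group_def Let_def invP inv1 lm \<eta>_def[symmetric]
    using c by (intro conjugate_orthogonal_group[OF carriers(3,5,1) P carriers(4) U_one_square PQ QP
        basis(1) _ form]) auto
  then show ?thesis
    unfolding gives_real_form_def
    using star_conjugation twisted_star_gen carriers P U_tendsto invertible[OF PQ QP P carriers(1)]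
      invertible[OF U_U U_U carriers(5) carriers(5)]
      invertible[OF U_one_square U_one_square carriers(5) carriers(5)]
    by (intro conjI exI[of _ U] exI[of _ "U 1"] bexI[of _ P] allI impI) auto
qed

end

section \<open>Sign matrices and the middle swap\<close>

lemma sign_matrix_cases:
  assumes "D' \<in> sign_matrices N"
  obtains e where "D' = monomial_mat N (\<lambda>j. j) (\<lambda>j. of_real (e j))"
    and "\<And>j. j < N \<Longrightarrow> e j * e j = 1" and "\<And>j. j < N \<Longrightarrow> e (flip_index N j) = e j"
    and "odd N \<Longrightarrow> e (N div 2) = 1"
    and "even N \<Longrightarrow> e (N div 2 - 1) = 1" and "even N \<Longrightarrow> e (N div 2) = 1"
proof -
  from assms obtain \<epsilon> where D': "D' = mat_diag N \<epsilon>"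
    and sq: "\<And>j. j < N \<Longrightarrow> (\<epsilon> j)\<^sup>2 = 1" and fl: "\<And>j. j < N \<Longrightarrow> \<epsilon> (flip_index N j) = \<epsilon> j"
    and mid: "if odd N then \<epsilon> (N div 2) = 1 else \<epsilon> (N div 2 - 1) = 1 \<and> \<epsilon> (N div 2) = 1"
    unfolding sign_matrices_def by blast
  have cases: "\<epsilon> j = 1 \<or> \<epsilon> j = - 1" if "j < N" for j
    using sq[OF that] by (simp add: power2_eq_1_iff)
  \<comment> \<open>A complex number with square 1 is 1 or -1, so passing to real parts loses
    nothing.\<close>
  show ?thesis
  proof (rule that[of "\<lambda>j. Re (\<epsilon> j)"])
    show "D' = monomial_mat N (\<lambda>j. j) (\<lambda>j. of_real (Re (\<epsilon> j)))"
      unfolding D' mat_diag_def monomial_mat_def using cases by (intro eq_matI) fastforce+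
    show "Re (\<epsilon> j) * Re (\<epsilon> j) = 1" if "j < N" for j
      using cases[OF that] by auto
  qed (use fl mid in auto)
qed

text \<open>The bound on \<open>k\<close> keeps the middle index, or both middle indices, inside the
  block of positive signs.\<close>

lemma block_sign_matrix:
  assumes "k \<le> (N - 1) div 2" "N > 0"
  shows "monomial_mat N (\<lambda>j. j) (\<lambda>j. of_real (if k \<le> j \<and> j < N - k then 1 else - 1))
    \<in> sign_matrices N"
proof -
  have "monomial_mat N (\<lambda>j. j) (\<lambda>j. of_real (if k \<le> j \<and> j < N - k then 1 else - 1))
    = mat_diag N (\<lambda>j. if k \<le> j \<and> j < N - k then 1 else - 1)"
    by (rule eq_matI) (auto simp: monomial_mat_def mat_diag_def)
  then show ?thesis
    unfolding sign_matrices_def using assms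
    by (intro CollectI exI[of _ "\<lambda>j. if k \<le> j \<and> j < N - k then 1 else - 1"])
      (auto simp: flip_index_def elim!: oddE evenE)
qed

definition middle_swap :: "nat \<Rightarrow> nat \<Rightarrow> nat" where
  "middle_swap N = Transposition.transpose (N div 2 - 1) (N div 2)"

lemma swap_matrix_eq: "swap_matrix N = monomial_mat N (middle_swap N) (\<lambda>_. 1)"
  by (simp add: swap_matrix_def monomial_mat_def middle_swap_def)

lemma middle_swap_simps:
  assumes "even N" "N > 2" "a < N"
  shows "middle_swap N a < N" "middle_swap N (middle_swap N a) = a"
    "middle_swap N (flip_index N a) = flip_index N (middle_swap N a)"
    "middle_swap N a \<noteq> a \<Longrightarrow> two_rho N a = 0 \<and> middle_swap N a = flip_index N a
      \<and> (a = N div 2 - 1 \<or> a = N div 2)"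
proof -
  from assms(1) obtain n where "N = 2 * n" by (elim evenE)
  with assms(2,3) show "middle_swap N a < N" "middle_swap N (middle_swap N a) = a"
    "middle_swap N (flip_index N a) = flip_index N (middle_swap N a)"
    "middle_swap N a \<noteq> a \<Longrightarrow> two_rho N a = 0 \<and> middle_swap N a = flip_index N a
      \<and> (a = N div 2 - 1 \<or> a = N div 2)"
    by (auto simp: middle_swap_def Transposition.transpose_def flip_index_def two_rho_def
        split: if_splits)
qed

text \<open>The two middle indices are adjacent, so every other index lies on the same side of
  both.\<close>

lemma middle_swap_order:
  assumes "even N" "N > 2" "a < N" "b < N" "b \<noteq> flip_index N a"
  shows "middle_swap N a < middle_swap N b \<longleftrightarrow> a < b"
proof -
  from assms(1) obtain n where "N = 2 * n" by (elim evenE)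
  with assms show ?thesis
    by (auto simp: middle_swap_def Transposition.transpose_def flip_index_def)
qed

lemma split_symmetry_natural:
  assumes "\<And>j. j < N \<Longrightarrow> e j * e j = 1" "\<And>j. j < N \<Longrightarrow> e (flip_index N j) = e j"
    and "odd N \<Longrightarrow> e (N div 2) = 1"
  shows "split_symmetry N (\<lambda>j. j) e"
proof
  fix a assume "a < N" "flip_index N a = a \<or> a \<noteq> a"
  then have "odd N" "a = N div 2"
    by (auto simp: flip_index_def) presburger+
  then show "e a = 1" using assms(3) by simp
qed (use assms in auto)

lemma split_symmetry_sharp:
  assumes N: "even N" "N > 2"
    and e: "\<And>j. j < N \<Longrightarrow> e j * e j = 1" "\<And>j. j < N \<Longrightarrow> e (flip_index N j) = e j"
    and mid: "e (N div 2 - 1) = 1" "e (N div 2) = 1"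
  shows "split_symmetry N (middle_swap N) e"
proof
  fix a b assume a: "a < N"
  note simps = middle_swap_simps[OF N a]
  show "middle_swap N a < N" "middle_swap N (middle_swap N a) = a"
    "middle_swap N (flip_index N a) = flip_index N (middle_swap N a)"
    by (fact simps(1-3))+
  show "middle_swap N a \<noteq> a \<Longrightarrow> two_rho N a = 0 \<and> middle_swap N a = flip_index N a"
    using simps(4) by blast
  show "b < N \<Longrightarrow> b \<noteq> flip_index N a \<Longrightarrow> middle_swap N a < middle_swap N b \<longleftrightarrow> a < b"
    by (rule middle_swap_order[OF N a])
  show "e (middle_swap N a) = e a"
    using simps(4) e(2)[OF a] by (cases "middle_swap N a = a") auto
  have "flip_index N a \<noteq> a"
    using N(1) a by (auto simp: flip_index_def) presburger
  then show "flip_index N a = a \<or> middle_swap N a \<noteq> a \<Longrightarrow> e a = 1"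
    using simps(4) mid by auto
qed (use e in auto)

lemma natural_W:
  assumes "split_symmetry N (\<lambda>j. j) e"
  shows "monomial_symmetry.W N (\<lambda>j. j) e = monomial_mat N (\<lambda>j. j) (\<lambda>j. of_real (e j))"
  using assms by (simp add: monomial_symmetry.W_def split_symmetry_def)

lemma sharp_W:
  assumes N: "even N" "N > 2" and "split_symmetry N (middle_swap N) e"
  shows "monomial_symmetry.W N (middle_swap N) e
    = swap_matrix N * monomial_mat N (\<lambda>j. j) (\<lambda>j. of_real (e j))"
proof -
  have "monomial_mat N (middle_swap N) (\<lambda>j. complex_of_real (e j))
    = swap_matrix N * monomial_mat N (\<lambda>j. j) (\<lambda>j. of_real (e j))"
    unfolding swap_matrix_eq
    by (rule eq_matI)
      (auto simp: mult_monomial_right monomial_mat_index simp del: index_mult_mat(1))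
  then show ?thesis
    using assms(3) by (simp add: monomial_symmetry.W_def split_symmetry_def)
qed

lemma star_natural_conjugation:
  assumes "admissible_q N q" "D' \<in> sign_matrices N"
  shows "is_star_conjugation N q (star_natural N D' q)"
proof -
  obtain e where e: "D' = monomial_mat N (\<lambda>j. j) (\<lambda>j. of_real (e j))"
    "\<And>j. j < N \<Longrightarrow> e j * e j = 1" "\<And>j. j < N \<Longrightarrow> e (flip_index N j) = e j"
    "odd N \<Longrightarrow> e (N div 2) = 1"
    using sign_matrix_cases[OF assms(2)] by blast
  then have sym: "split_symmetry N (\<lambda>j. j) e" by (intro split_symmetry_natural)
  show ?thesis
    using monomial_symmetry.star_conjugation[OF split_symmetry.axioms(1)[OF sym] assms(1)]
    by (simp add: star_natural_def natural_W[OF sym] e(1))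
qed

lemma star_sharp_natural_conjugation:
  assumes "admissible_q N q" "D' \<in> sign_matrices N" and N: "even N" "N > 2"
  shows "is_star_conjugation N q (star_sharp_natural N D' q)"
proof -
  obtain e where e: "D' = monomial_mat N (\<lambda>j. j) (\<lambda>j. of_real (e j))"
    "\<And>j. j < N \<Longrightarrow> e j * e j = 1" "\<And>j. j < N \<Longrightarrow> e (flip_index N j) = e j"
    "even N \<Longrightarrow> e (N div 2 - 1) = 1" "even N \<Longrightarrow> e (N div 2) = 1"
    using sign_matrix_cases[OF assms(2)] by blast
  then have sym: "split_symmetry N (middle_swap N) e" using N by (intro split_symmetry_sharp)
  show ?thesis
    using monomial_symmetry.star_conjugation[OF split_symmetry.axioms(1)[OF sym] assms(1)]
    by (simp add: star_sharp_natural_def sharp_W[OF N sym] e(1))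
qed

abbreviation block_sign :: "nat \<Rightarrow> nat \<Rightarrow> nat \<Rightarrow> real" where
  "block_sign N k j \<equiv> (if k \<le> j \<and> j < N - k then 1 else - 1)"

lemma block_sign_props:
  "block_sign N k j * block_sign N k j = 1"
  "j < N \<Longrightarrow> block_sign N k (flip_index N j) = block_sign N k j"
  "N > 0 \<Longrightarrow> k \<le> (N - 1) div 2 \<Longrightarrow> block_sign N k (N div 2) = 1"
  "even N \<Longrightarrow> N > 0 \<Longrightarrow> k \<le> (N - 1) div 2 \<Longrightarrow> block_sign N k (N div 2 - 1) = 1"
  by (auto simp: flip_index_def elim!: evenE)

text \<open>If the number of positive vectors is \<open>m\<close> instead of \<open>l\<close>, there
  are \<open>l\<close> negative ones, and the negative of the form is used.\<close>

lemma (in split_symmetry) gives_real_form_positive: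
  assumes "card {j. j < N \<and> sign j = 1} = p" "l + m = N" "p = l \<or> p = m"
  shows "gives_real_form N (\<lambda>q. twisted_star N q W) l m"
  using assms(3)
proof
  assume "p = l"
  then show ?thesis using gives_real_form[of 1 l m] assms by simp
next
  assume "p = m"
  have "{j. j < N \<and> sign j = - 1} = {..<N} - {j. j < N \<and> sign j = 1}"
    using sign_cases by force
  then have "card {j. j < N \<and> sign j = - 1} = N - p"
    using assms(1) by (subst (asm) eq_commute) (simp add: card_Diff_subset subset_iff)
  then show ?thesis using gives_real_form[of "- 1" l m] assms(2) \<open>p = m\<close> by simp
qed

text \<open>Without the swap the signature is that of the signs themselves, so a central block of p
  = N - 2k positive signs does it. As the middle signs are fixed to 1, \<open>p\<close> has to be
  positive and of the parity of \<open>N\<close>.\<close>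

lemma natural_real_form:
  assumes N: "N > 2" and lm: "l + m = N" and p: "p = l \<or> p = m" "p > 0" "even p \<longleftrightarrow> even N"
  shows "\<exists>D'\<in>sign_matrices N. gives_real_form N (star_natural N D') l m"
proof -
  define k where "k = (N - p) div 2"
  have "p \<le> N" using p lm by auto
  then have "even (N - p)" using p(3) by simp
  then have k: "N = p + 2 * k"
    using \<open>p \<le> N\<close> unfolding k_def by presburger
  then have k': "k \<le> (N - 1) div 2" using p(2) by simp
  have sym: "split_symmetry N (\<lambda>j. j) (block_sign N k)"
    using N k' by (intro split_symmetry_natural block_sign_props) auto
  have "split_symmetry.sign N (\<lambda>j. j) (block_sign N k) = block_sign N k"
    by (simp add: fun_eq_iff split_symmetry.sign_def[OF sym])
  then have "{j. j < N \<and> split_symmetry.sign N (\<lambda>j. j) (block_sign N k) j = 1} = {k..<k + p}"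
    using k by auto
  then have "gives_real_form N
      (\<lambda>q. twisted_star N q (monomial_symmetry.W N (\<lambda>j. j) (block_sign N k))) l m"
    using lm p by (intro split_symmetry.gives_real_form_positive[OF sym, of p]) simp_all
  then have "gives_real_form N
      (star_natural N (monomial_mat N (\<lambda>j. j) (\<lambda>j. of_real (block_sign N k j)))) l m"
    unfolding natural_W[OF sym] star_natural_def .
  then show ?thesis
    using block_sign_matrix[OF k'] N by (intro bexI) auto
qed

lemma sharp_natural_real_form:
  assumes N: "N > 2" "even N" and lm: "l + m = N" "odd l"
  shows "\<exists>D'\<in>sign_matrices N. gives_real_form N (star_sharp_natural N D') l m"
proof -
  \<comment> \<open>The block has l + 1 indices rather than l, because one vector of the swapped
    middle pair counts as negative.\<close>
  define k where "k = (N - 1 - l) div 2"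
  have "odd m" "m > 0" using lm N(2) by (auto intro: Nat.gr0I)
  then have k: "N = l + 1 + 2 * k"
    using lm N unfolding k_def by presburger
  then have k': "k \<le> (N - 1) div 2" using N by simp
  have sym: "split_symmetry N (middle_swap N) (block_sign N k)"
    using N k' by (intro split_symmetry_sharp block_sign_props) auto
  have l: "l > 0" using lm(2) by (auto intro: Nat.gr0I)
  obtain n where n: "N = 2 * n" using N(2) by (elim evenE)
  have swap: "middle_swap N j = j \<longleftrightarrow> j \<noteq> n - 1 \<and> j \<noteq> n" for j
    using n N by (auto simp: middle_swap_def Transposition.transpose_def)
  \<comment> \<open>The negative vector of the middle pair is labelled by its larger index,
    n.\<close>
  have "{j. j < N \<and> split_symmetry.sign N (middle_swap N) (block_sign N k) j = 1}
    = {k..<k + l + 1} - {n}"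
    unfolding split_symmetry.sign_def[OF sym] swap flip_index_def
    using k n l by auto
  moreover have "n \<in> {k..<k + l + 1}" using k n l by auto
  ultimately have "card {j. j < N \<and> split_symmetry.sign N (middle_swap N) (block_sign N k) j = 1} = l"
    by simp
  then have "gives_real_form N
      (\<lambda>q. twisted_star N q (monomial_symmetry.W N (middle_swap N) (block_sign N k))) l m"
    using lm by (intro split_symmetry.gives_real_form_positive[OF sym, of l]) simp_all
  then have "gives_real_form N
      (star_sharp_natural N (monomial_mat N (\<lambda>j. j) (\<lambda>j. of_real (block_sign N k j)))) l m"
    unfolding sharp_W[OF N(2,1) sym] star_sharp_natural_def .
  then show ?thesis
    using block_sign_matrix[OF k'] N by (intro bexI) auto
qed

theorem mainTheorem3:
  fixes N :: nat
  assumes "N > 2"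
  shows
    "(\<forall>q D'. admissible_q N q \<longrightarrow> D' \<in> sign_matrices N \<longrightarrow>
        is_star_conjugation N q (star_natural N D' q) \<and>
        (even N \<longrightarrow> is_star_conjugation N q (star_sharp_natural N D' q))) \<and>
     (odd N \<longrightarrow> (\<forall>l m. l + m = N \<longrightarrow>
        (\<exists>D' \<in> sign_matrices N. gives_real_form N (star_natural N D') l m))) \<and>
     (even N \<longrightarrow>
        (\<forall>l m. even l \<and> even m \<and> l + m = N \<longrightarrow>
          (\<exists>D' \<in> sign_matrices N. gives_real_form N (star_natural N D') l m)) \<and>
        (\<forall>l m. odd l \<and> odd m \<and> l + m = N \<longrightarrow>
          (\<exists>D' \<in> sign_matrices N. gives_real_form N (star_sharp_natural N D') l m)))"
proof (intro conjI impI allI)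
  fix q D' assume q: "admissible_q N q" and D': "D' \<in> sign_matrices N"
  show "is_star_conjugation N q (star_natural N D' q)"
    by (rule star_natural_conjugation[OF q D'])
  show "is_star_conjugation N q (star_sharp_natural N D' q)" if "even N"
    by (rule star_sharp_natural_conjugation[OF q D' that assms])
next
  fix l m assume odd: "odd N" and lm: "l + m = N"
  show "\<exists>D'\<in>sign_matrices N. gives_real_form N (star_natural N D') l m"
  \<comment> \<open>Exactly one of l and m is odd; it has the parity of N, is positive, and becomes
    the number of positive signs.\<close>
  proof (cases "odd l")
    case True
    with odd show ?thesis
      by (intro natural_real_form[OF assms lm, of l]) (auto intro: Nat.gr0I)
  next
    case False
    with odd lm have "odd m" by auto
    with odd show ?thesis
      by (intro natural_real_form[OF assms lm, of m]) (auto intro: Nat.gr0I)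
  qed
next
  fix l m assume N: "even N" and lm: "even l \<and> even m \<and> l + m = N"
  show "\<exists>D'\<in>sign_matrices N. gives_real_form N (star_natural N D') l m"
  \<comment> \<open>The number of positive signs cannot be zero, so for l = 0 the role is given to m
    = N.\<close>
  proof (cases "l = 0")
    case True
    with N lm assms show ?thesis
      by (intro natural_real_form[of N l m m]) auto
  next
    case False
    with N lm assms show ?thesis
      by (intro natural_real_form[of N l m l]) auto
  qed
next
  fix l m assume "even N" "odd l \<and> odd m \<and> l + m = N"
  then show "\<exists>D'\<in>sign_matrices N. gives_real_form N (star_sharp_natural N D') l m"
    using assms by (intro sharp_natural_real_form) auto
qed

end
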